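(* Let $Y$ be a tail random field. Then $R=\kappa(Y)^{1/\alpha}$ is an $\alpha$-Pareto random variable, independent of $\Theta=Y/R$. Further, $\Theta$ is a spectral tail random field satisfying $$\int_0^\infty\mathbb E\{\Gamma(z\Theta)\,\mathbb I(\kappa(zB^{-h}\Theta)>1)\}\,\alpha z^{-\alpha-1}\,dz=\mathbb E\{\Gamma(B^hY)\,\mathbb I(\kappa(B^hY)\neq0)\},\quad\forall\Gamma\in\mathfrak H_\star,\ \forall h\in\mathcal T.\qquad(1)$$ Moreover, for every $\tau\in\mathbb R$ such that $$\sup_{t\in[-c,c]^l\cap\mathcal T}\mathbb E\{\kappa(B^{-t}\Theta)^\tau\}<\infty,\quad\forall c>0,\qquad(2)$$ there exists a shift-invariant class $\mathscr C_\kappa[Z]$ with local random field $\Theta$ such that $$\int_{t\in[-c,c]^l\cap\mathcal T}\mathbb E\Bigl\{\frac{1}{\int_{s\in[-c,c]^l\cap\mathcal T}\kappa(B^{t-s}\Theta)^\tau\,\mathbb I(\kappa(B^{t-s}Y)>1)\,\lambda(ds)}\Bigr\}\lambda(dt)<\infty,\quad\forall c>0.\qquad(3)$$ Conversely, if $\Theta\in\mathfrak W_\kappa$ satisfies $\mathbb P\{\kappa(\Theta)=1\}=1$, and both (1) and (3) (with $\tau$ satisfying (2)) hold with $Y=R\Theta$, where $R$ is an $\alpha$-Pareto random variable independent of $\Theta$, then $Y$ is a tail random field.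
   Context: Setting. $d,l$ are positive integers, $\alpha>0$. $\mathcal T$ is either $\mathbb R^l$ or an additive subgroup of $\mathbb Z^l$; $\mathbb T_0$ is the set of points of $\mathcal T$ with rational coordinates. $\lambda$ is Lebesgue measure on $\mathbb R^l$, and counting measure when integrating over a countable set. $\mathrm D=\mathrm D(\mathcal T,\mathbb R^d)$ is the space of functions $f:\mathcal T\to\mathbb R^d$ with the product $\sigma$-field. $(B^hf)(t)=f(t-h)$. $\mathcal H$ is the class of all measurable maps $F:\mathrm D\to E$ with $E=\mathbb R$ or $E=[0,\infty]$; $\mathcal H_\beta\subset\mathcal H$ consists of those with $F(cf)=c^\beta F(f)$ for all $c>0$, $f\in\mathrm D$. $\kappa:\mathrm D\to[0,\infty]$ is a fixed element of $\mathcal H_\alpha$. Suprema $\sup_{t\in A}\kappa(B^{t}f)$, $A\subset\mathcal T$, are taken over $A\cap\mathbb T_0$. Conventions: $\infty\cdot0=0/0=0$; identities between expectations are understood for those maps for which the expectations exist. $\mathfrak G$: $\lambda$-measurable locally bounded $g:\mathcal T\to[0,\infty)$, almost everywhere positive when $\mathcal T=\mathbb R^l$. $\mathfrak H_\beta$ ($\beta\ge0$): $\beta$-homogeneous maps of the form $F(f)=\Gamma(f)I_1(f)\mathbb I(I_2(f)\in A)/I_3(f)$, $I_i(f)=\int_{\mathcal T}\kappa(B^{-t}f)^{\xi_i}g_i(t)\lambda(dt)$, with $\Gamma\in\mathcal H_{\xi_0}$, $g_i\in\mathfrak G$, constants $\xi_i$, Borel $A\subset[0,\infty]$; $F(f)=0$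 if undefined. $\mathfrak H_\star$: all products $F=F_1F_2$ with $F_1\in\mathfrak H_\beta$ for some $\beta\ge0$ and $F_2\in\mathcal H$. $\mathfrak W_\kappa$: $\mathbb R^d$-valued random fields $V(t),t\in\mathcal T$ on complete probability spaces such that $\kappa(B^{-t}V),t\in\mathcal T$ is stochastically continuous and $\kappa(B^tV),t\in\mathcal T$ is jointly measurable and separable with separant $\mathbb T_0$. For $Z\in\mathfrak W_\kappa$ with $\mathbb P\{\sup_{t\in\mathcal T}\kappa(B^{-t}Z)>0\}=1$, $\mathbb E\{\kappa(Z)\}=1$ and $\mathbb E\{\sup_{t\in[-c,c]^l\cap\mathcal T}\kappa(B^{-t}Z)\}<\infty$ for all $c\in(0,\infty)$, the class $\mathscr C_\kappa[Z]$ consists of $Z$ and all $\widetilde Z\in\mathfrak W_\kappa$ (possibly on other probability spaces) satisfying the same positivity and supremum conditions and $$\mathbb E\{\kappa(B^{-h}\widetilde Z)F(\widetilde Z/\kappa(B^{-h}\widetilde Z)^{1/\alpha})\}=\mathbb E\{\kappa(B^{-h}Z)F(Z/\kappa(B^{-h}Z)^{1/\alpha})\},\quad\forall F\in\mathcal H,\ \forall h\in\mathcal T.$$ It is shift-invariant if for some $\widetilde Z\in\mathscr C_\kappa[Z]$ one has $B^h\widetilde Z\in\mathscr C_\kappa[Z]$ for all $h\in\mathcal T$. Its local random field is $Z/\kappa(Z)^{1/\alpha}$ considered under the probability measure $\widehat{\mathbb P}(A)=\mathbb E\{\kappa(Z)\mathbb I(A)\}/\mathbb E\{\kappa(Z)\}$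 (and is identified through its law). $\mathcal P_{\mathbb T_0}$: functions $p:\mathbb T_0\to(0,\infty)$ with $\int_{\mathbb T_0}p\,d\lambda<\infty$. For a random field $V$ consider the condition (J): for all $p_N\in\mathcal P_{\mathbb T_0}$ and all $\mathbb T_0$-valued $N$ with density $p_N$ independent of $V$, $\mathbb E\bigl\{\sup_{s\in[-c,c]^l\cap\mathbb T_0}\kappa(B^{N-s}V)/\int_{\mathbb T_0}\kappa(B^{N-r}V)p_N(r)\lambda(dr)\bigr\}<\infty$ for all $c>0$. $\Theta\in\mathfrak W_\kappa$ is a spectral tail random field if: $\mathbb P\{\kappa(\Theta)=1\}=1$; $\mathbb E\{\kappa(B^{-h}\Theta)\Gamma(\Theta)\}=\mathbb E\{\mathbb I(\kappa(B^h\Theta)\ne0)\Gamma(B^h\Theta)\}$ for all $\Gamma\in\mathfrak H_0$, $h\in\mathcal T$; and (J) holds for $V=\Theta$. $Y\in\mathfrak W_\kappa$ is a tail random field if: $\mathbb P\{\kappa(Y)>1\}=1$; $\mathbb E\{\Gamma(xB^hY)\mathbb I(\kappa(xB^hY)>1)\}=x^\alpha\mathbb E\{\Gamma(Y)\mathbb I(\kappa(B^{-h}Y/x)>1)\}$ for all $\Gamma\in\mathcal H$, $h\in\mathcal T$, $x>0$; and (J) holds for $V=Y$. An $\alpha$-Pareto random variable $R$ has $\mathbb P\{R>t\}=t^{-\alpha}$, $t\ge1$. *)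

theory Defs
  imports "HOL-Probability.Probability"
begin

section \<open>Index set, path space, shifts\<close>

text \<open>
  The index set is a subset \<open>T\<close> of \<open>real^'l\<close>.  The path space \<open>D\<close> consists of the functions on \<open>T\<close>,
  represented as usual in product measure spaces by functions that are \<open>undefined\<close> off \<open>T\<close>; this is
  why shifting and scaling restrict to \<open>T\<close>.
\<close>

definition index_group :: "(real^'l) set \<Rightarrow> bool" where
  "index_group T \<longleftrightarrow>
     T = UNIV \<or> (0 \<in> T \<and> (\<forall>s\<in>T. \<forall>t\<in>T. s - t \<in> T) \<and> (\<forall>t\<in>T. \<forall>i. t $ i \<in> \<int>))"

definition rat_points :: "(real^'l) set \<Rightarrow> (real^'l) set" where
  "rat_points T = {t \<in> T. \<forall>i. t $ i \<in> \<rat>}"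

definition index_measure :: "(real^'l) set \<Rightarrow> (real^'l) measure" where
  "index_measure T = (if T = UNIV then lebesgue else count_space T)"

definition cube :: "real \<Rightarrow> (real^'l) set" where
  "cube c = {t. \<forall>i. \<bar>t $ i\<bar> \<le> c}"

definition path_space :: "(real^'l) set \<Rightarrow> (real^'l \<Rightarrow> real^'d) measure" where
  "path_space T = PiM T (\<lambda>_. borel)"

definition shift :: "(real^'l) set \<Rightarrow> real^'l \<Rightarrow> (real^'l \<Rightarrow> real^'d) \<Rightarrow> (real^'l \<Rightarrow> real^'d)" where
  "shift T h f = (\<lambda>t\<in>T. f (t - h))"

definition fscale :: "(real^'l) set \<Rightarrow> real \<Rightarrow> (real^'l \<Rightarrow> real^'d) \<Rightarrow> (real^'l \<Rightarrow> real^'d)" where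
  "fscale T c f = (\<lambda>t\<in>T. c *\<^sub>R f t)"

text \<open>
  Division of a path by \<open>r \<in> [0,\<infinity>]\<close>.  One gets the zero path for \<open>r = \<infinity>\<close>, and also (as a dummy value)
  for \<open>r = 0\<close>; where \<open>r = 0\<close> can occur below with positive probability, the result only enters
  multiplied by a factor that is then \<open>0\<close>.
\<close>
definition fdiv :: "(real^'l) set \<Rightarrow> (real^'l \<Rightarrow> real^'d) \<Rightarrow> ennreal \<Rightarrow> (real^'l \<Rightarrow> real^'d)" where
  "fdiv T f r = fscale T (1 / enn2real r) f"

text \<open>Real powers on \<open>[0,\<infinity>]\<close>; in particular \<open>x\<^sup>0 = 1\<close> for all \<open>x\<close>, and \<open>0\<close> to a negative power is \<open>\<infinity>\<close>.\<close>
definition epowr :: "ennreal \<Rightarrow> real \<Rightarrow> ennreal" where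
  "epowr x a =
     (if a = 0 then 1
      else if x = 0 then (if 0 < a then 0 else \<infinity>)
      else if x = \<infinity> then (if 0 < a then \<infinity> else 0)
      else ennreal (enn2real x powr a))"


section \<open>Extended-real expectations\<close>

text \<open>
  Maps into \<open>\<real>\<close> and maps into \<open>[0,\<infinity>]\<close> are treated together as \<open>ereal\<close>-valued maps.  Note that in
  \<open>ereal\<close> one has \<open>\<infinity> * 0 = 0 / 0 = \<infinity> / \<infinity> = 0\<close>.  An integral exists if the function is measurable and
  its positive and negative parts do not both have infinite integral.
\<close>

definition eintegral :: "'a measure \<Rightarrow> ('a \<Rightarrow> ereal) \<Rightarrow> ereal" where
  "eintegral M X =
     enn2ereal (\<integral>\<^sup>+\<omega>. e2ennreal (X \<omega>) \<partial>M) - enn2ereal (\<integral>\<^sup>+\<omega>. e2ennreal (- X \<omega>) \<partial>M)"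

definition eintegral_exists :: "'a measure \<Rightarrow> ('a \<Rightarrow> ereal) \<Rightarrow> bool" where
  "eintegral_exists M X \<longleftrightarrow> X \<in> borel_measurable M \<and>
     ((\<integral>\<^sup>+\<omega>. e2ennreal (X \<omega>) \<partial>M) < \<infinity> \<or> (\<integral>\<^sup>+\<omega>. e2ennreal (- X \<omega>) \<partial>M) < \<infinity>)"

text \<open>Identities between expectations are claimed only when both expectations exist.\<close>
definition eq_expect :: "'a measure \<Rightarrow> ('a \<Rightarrow> ereal) \<Rightarrow> 'b measure \<Rightarrow> ('b \<Rightarrow> ereal) \<Rightarrow> bool" where
  "eq_expect M X N X' \<longleftrightarrow>
     (eintegral_exists M X \<and> eintegral_exists N X' \<longrightarrow> eintegral M X = eintegral N X')"


section \<open>Classes of maps on the path space\<close>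

definition maps :: "(real^'l) set \<Rightarrow> ((real^'l \<Rightarrow> real^'d) \<Rightarrow> ereal) set" where
  "maps T = {F \<in> borel_measurable (path_space T).
     (\<forall>f\<in>space (path_space T). \<bar>F f\<bar> \<noteq> \<infinity>) \<or> (\<forall>f\<in>space (path_space T). 0 \<le> F f)}"

definition homogeneous ::
  "(real^'l) set \<Rightarrow> real \<Rightarrow> ((real^'l \<Rightarrow> real^'d) \<Rightarrow> ereal) \<Rightarrow> bool" where
  "homogeneous T \<beta> F \<longleftrightarrow>
     (\<forall>c>0. \<forall>f\<in>space (path_space T). F (fscale T c f) = ereal (c powr \<beta>) * F f)"

definition hom_maps :: "(real^'l) set \<Rightarrow> real \<Rightarrow> ((real^'l \<Rightarrow> real^'d) \<Rightarrow> ereal) set" where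
  "hom_maps T \<beta> = {F \<in> maps T. homogeneous T \<beta> F}"

definition weights :: "(real^'l) set \<Rightarrow> (real^'l \<Rightarrow> real) set" where
  "weights T = {g \<in> borel_measurable (index_measure T).
     (\<forall>t\<in>T. 0 \<le> g t) \<and> (\<forall>c>0. \<exists>K. \<forall>t\<in>T \<inter> cube c. g t \<le> K) \<and>
     (T = UNIV \<longrightarrow> (AE t in lebesgue. 0 < g t))}"

definition kint_fun ::
  "(real^'l) set \<Rightarrow> ((real^'l \<Rightarrow> real^'d) \<Rightarrow> ennreal) \<Rightarrow> real \<Rightarrow> (real^'l \<Rightarrow> real)
     \<Rightarrow> (real^'l \<Rightarrow> real^'d) \<Rightarrow> real^'l \<Rightarrow> ennreal" where
  "kint_fun T \<kappa> \<xi> g f = (\<lambda>t. epowr (\<kappa> (shift T (- t) f)) \<xi> * ennreal (g t))"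

definition kint ::
  "(real^'l) set \<Rightarrow> ((real^'l \<Rightarrow> real^'d) \<Rightarrow> ennreal) \<Rightarrow> real \<Rightarrow> (real^'l \<Rightarrow> real)
     \<Rightarrow> (real^'l \<Rightarrow> real^'d) \<Rightarrow> ennreal" where
  "kint T \<kappa> \<xi> g f = (\<integral>\<^sup>+t. kint_fun T \<kappa> \<xi> g f t \<partial>index_measure T)"

text \<open>
  For a fixed path \<open>f\<close> the integrand need not be measurable in \<open>t\<close>; the integral is then undefined,
  whence the value \<open>0\<close>.
\<close>
definition int_maps ::
  "(real^'l) set \<Rightarrow> ((real^'l \<Rightarrow> real^'d) \<Rightarrow> ennreal) \<Rightarrow> real \<Rightarrow> ((real^'l \<Rightarrow> real^'d) \<Rightarrow> ereal) set" where
  "int_maps T \<kappa> \<beta> = {F. homogeneous T \<beta> F \<and>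
     (\<exists>\<Gamma> \<xi>\<^sub>0 \<xi>\<^sub>1 \<xi>\<^sub>2 \<xi>\<^sub>3 g\<^sub>1 g\<^sub>2 g\<^sub>3 A.
        \<Gamma> \<in> hom_maps T \<xi>\<^sub>0 \<and> g\<^sub>1 \<in> weights T \<and> g\<^sub>2 \<in> weights T \<and> g\<^sub>3 \<in> weights T \<and> A \<in> sets borel \<and>
        (\<forall>f\<in>space (path_space T). F f =
           (if kint_fun T \<kappa> \<xi>\<^sub>1 g\<^sub>1 f \<in> borel_measurable (index_measure T) \<and>
               kint_fun T \<kappa> \<xi>\<^sub>2 g\<^sub>2 f \<in> borel_measurable (index_measure T) \<and>
               kint_fun T \<kappa> \<xi>\<^sub>3 g\<^sub>3 f \<in> borel_measurable (index_measure T)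
            then \<Gamma> f * enn2ereal (kint T \<kappa> \<xi>\<^sub>1 g\<^sub>1 f) * indicator A (kint T \<kappa> \<xi>\<^sub>2 g\<^sub>2 f)
                   / enn2ereal (kint T \<kappa> \<xi>\<^sub>3 g\<^sub>3 f)
            else 0)))}"

definition star_maps ::
  "(real^'l) set \<Rightarrow> ((real^'l \<Rightarrow> real^'d) \<Rightarrow> ennreal) \<Rightarrow> ((real^'l \<Rightarrow> real^'d) \<Rightarrow> ereal) set" where
  "star_maps T \<kappa> = {F. \<exists>\<beta>\<ge>0. \<exists>F\<^sub>1\<in>int_maps T \<kappa> \<beta>. \<exists>F\<^sub>2\<in>maps T. F = (\<lambda>f. F\<^sub>1 f * F\<^sub>2 f)}"


section \<open>Random fields\<close>

text \<open>The distance \<open>|x - y|\<close> on \<open>[0,\<infinity>]\<close>, with \<open>|\<infinity> - \<infinity>| = 0\<close>.\<close>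
definition edistance :: "ennreal \<Rightarrow> ennreal \<Rightarrow> ennreal" where
  "edistance x y = (if x = y then 0 else max (x - y) (y - x))"

definition stoch_continuous ::
  "(real^'l) set \<Rightarrow> 'a measure \<Rightarrow> (real^'l \<Rightarrow> 'a \<Rightarrow> ennreal) \<Rightarrow> bool" where
  "stoch_continuous T M X \<longleftrightarrow> (\<forall>t\<in>T. \<forall>\<epsilon>>0.
     ((\<lambda>s. measure M {\<omega> \<in> space M. ennreal \<epsilon> < edistance (X s \<omega>) (X t \<omega>)}) \<longlongrightarrow> 0) (at t within T))"

definition separable_with ::
  "(real^'l) set \<Rightarrow> (real^'l) set \<Rightarrow> 'a measure \<Rightarrow> (real^'l \<Rightarrow> 'a \<Rightarrow> ennreal) \<Rightarrow> bool" where
  "separable_with S T M X \<longleftrightarrow> (AE \<omega> in M. \<forall>t\<in>T. \<forall>U. open U \<and> t \<in> U \<longrightarrow>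
     X t \<omega> \<in> closure ((\<lambda>s. X s \<omega>) ` (U \<inter> S)))"

definition random_field ::
  "(real^'l) set \<Rightarrow> ((real^'l \<Rightarrow> real^'d) \<Rightarrow> ennreal) \<Rightarrow> 'a measure \<Rightarrow> ('a \<Rightarrow> real^'l \<Rightarrow> real^'d) \<Rightarrow> bool"
where
  "random_field T \<kappa> M V \<longleftrightarrow>
     prob_space M \<and> complete_measure M \<and> V \<in> measurable M (path_space T) \<and>
     stoch_continuous T M (\<lambda>t \<omega>. \<kappa> (shift T (- t) (V \<omega>))) \<and>
     (\<lambda>(t, \<omega>). \<kappa> (shift T t (V \<omega>))) \<in> borel_measurable (restrict_space borel T \<Otimes>\<^sub>M M) \<and>
     separable_with (rat_points T) T M (\<lambda>t \<omega>. \<kappa> (shift T t (V \<omega>)))"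

text \<open>Suprema of \<open>\<kappa>\<close> along shifts are over rational points.\<close>
definition positive_finite ::
  "(real^'l) set \<Rightarrow> ((real^'l \<Rightarrow> real^'d) \<Rightarrow> ennreal) \<Rightarrow> 'a measure \<Rightarrow> ('a \<Rightarrow> real^'l \<Rightarrow> real^'d) \<Rightarrow> bool"
where
  "positive_finite T \<kappa> M Z \<longleftrightarrow>
     (AE \<omega> in M. 0 < (SUP t\<in>rat_points T. \<kappa> (shift T (- t) (Z \<omega>)))) \<and>
     (\<forall>c>0. (\<integral>\<^sup>+\<omega>. (SUP t\<in>cube c \<inter> rat_points T. \<kappa> (shift T (- t) (Z \<omega>))) \<partial>M) < \<infinity>)"

definition generates_class ::
  "(real^'l) set \<Rightarrow> ((real^'l \<Rightarrow> real^'d) \<Rightarrow> ennreal) \<Rightarrow> 'a measure \<Rightarrow> ('a \<Rightarrow> real^'l \<Rightarrow> real^'d) \<Rightarrow> bool"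
where
  "generates_class T \<kappa> M Z \<longleftrightarrow>
     random_field T \<kappa> M Z \<and> positive_finite T \<kappa> M Z \<and> (\<integral>\<^sup>+\<omega>. \<kappa> (Z \<omega>) \<partial>M) = 1"

text \<open>
  The class of \<open>Z\<close>, as a set of random fields \<open>Z'\<close> together with the probability space \<open>N\<close> they live
  on; the sample space type \<open>'b\<close> may differ from that of \<open>Z\<close>.  The field \<open>Z\<close> itself belongs to the
  class by reflexivity.
\<close>
definition field_class ::
  "(real^'l) set \<Rightarrow> ((real^'l \<Rightarrow> real^'d) \<Rightarrow> ennreal) \<Rightarrow> real \<Rightarrow> 'a measure \<Rightarrow> ('a \<Rightarrow> real^'l \<Rightarrow> real^'d)
     \<Rightarrow> ('b measure \<times> ('b \<Rightarrow> real^'l \<Rightarrow> real^'d)) set"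
where
  "field_class T \<kappa> \<alpha> M Z = {(N, Z'). random_field T \<kappa> N Z' \<and> positive_finite T \<kappa> N Z' \<and>
     (\<forall>F\<in>maps T. \<forall>h\<in>T. eq_expect
        N (\<lambda>\<omega>. enn2ereal (\<kappa> (shift T (- h) (Z' \<omega>))) *
                F (fdiv T (Z' \<omega>) (epowr (\<kappa> (shift T (- h) (Z' \<omega>))) (1 / \<alpha>))))
        M (\<lambda>\<omega>. enn2ereal (\<kappa> (shift T (- h) (Z \<omega>))) *
                F (fdiv T (Z \<omega>) (epowr (\<kappa> (shift T (- h) (Z \<omega>))) (1 / \<alpha>)))))}"

text \<open>
  HOL cannot quantify over the type of the sample space inside a formula, so the shift-invariant
  representative is sought on the sample space type of \<open>Z\<close> (with an arbitrary probability measure).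
\<close>
definition shift_invariant_class ::
  "(real^'l) set \<Rightarrow> ((real^'l \<Rightarrow> real^'d) \<Rightarrow> ennreal) \<Rightarrow> real \<Rightarrow> 'a measure \<Rightarrow> ('a \<Rightarrow> real^'l \<Rightarrow> real^'d) \<Rightarrow> bool"
where
  "shift_invariant_class T \<kappa> \<alpha> M Z \<longleftrightarrow>
     (\<exists>(N :: 'a measure) Z'. (N, Z') \<in> field_class T \<kappa> \<alpha> M Z \<and>
        (\<forall>h\<in>T. (N, \<lambda>\<omega>. shift T h (Z' \<omega>)) \<in> field_class T \<kappa> \<alpha> M Z))"

definition local_field_law ::
  "(real^'l) set \<Rightarrow> ((real^'l \<Rightarrow> real^'d) \<Rightarrow> ennreal) \<Rightarrow> real \<Rightarrow> 'a measure \<Rightarrow> ('a \<Rightarrow> real^'l \<Rightarrow> real^'d)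
     \<Rightarrow> (real^'l \<Rightarrow> real^'d) measure"
where
  "local_field_law T \<kappa> \<alpha> M Z =
     distr (density M (\<lambda>\<omega>. \<kappa> (Z \<omega>) / (\<integral>\<^sup>+\<omega>. \<kappa> (Z \<omega>) \<partial>M))) (path_space T)
       (\<lambda>\<omega>. fdiv T (Z \<omega>) (epowr (\<kappa> (Z \<omega>)) (1 / \<alpha>)))"

text \<open>
  Positive functions on the rational points with finite sum.  A random point \<open>N\<close> with density \<open>p\<close>
  (so that \<open>p\<close> sums to \<open>1\<close>) that is independent of \<open>V\<close> is realized as a coordinate on the product
  of its law and the sample space of \<open>V\<close>.
\<close>
definition pos_summable :: "(real^'l) set \<Rightarrow> (real^'l \<Rightarrow> real) set" where
  "pos_summable T = {p. (\<forall>r\<in>rat_points T. 0 < p r) \<and>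
     (\<integral>\<^sup>+r. ennreal (p r) \<partial>count_space (rat_points T)) < \<infinity>}"

definition cond_J ::
  "(real^'l) set \<Rightarrow> ((real^'l \<Rightarrow> real^'d) \<Rightarrow> ennreal) \<Rightarrow> 'a measure \<Rightarrow> ('a \<Rightarrow> real^'l \<Rightarrow> real^'d) \<Rightarrow> bool"
where
  "cond_J T \<kappa> M V \<longleftrightarrow>
     (\<forall>p\<in>pos_summable T. prob_space (density (count_space (rat_points T)) (\<lambda>r. ennreal (p r))) \<longrightarrow>
        (\<forall>c>0. (\<integral>\<^sup>+(n, \<omega>).
            (SUP s\<in>cube c \<inter> rat_points T. \<kappa> (shift T (n - s) (V \<omega>)))
              / (\<integral>\<^sup>+r. \<kappa> (shift T (n - r) (V \<omega>)) * ennreal (p r) \<partial>count_space (rat_points T))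
            \<partial>(density (count_space (rat_points T)) (\<lambda>r. ennreal (p r)) \<Otimes>\<^sub>M M)) < \<infinity>))"

definition spectral_tail_field ::
  "(real^'l) set \<Rightarrow> ((real^'l \<Rightarrow> real^'d) \<Rightarrow> ennreal) \<Rightarrow> 'a measure \<Rightarrow> ('a \<Rightarrow> real^'l \<Rightarrow> real^'d) \<Rightarrow> bool"
where
  "spectral_tail_field T \<kappa> M \<Theta> \<longleftrightarrow>
     random_field T \<kappa> M \<Theta> \<and> (AE \<omega> in M. \<kappa> (\<Theta> \<omega>) = 1) \<and>
     (\<forall>\<Gamma>\<in>int_maps T \<kappa> 0. \<forall>h\<in>T. eq_expect
        M (\<lambda>\<omega>. enn2ereal (\<kappa> (shift T (- h) (\<Theta> \<omega>))) * \<Gamma> (\<Theta> \<omega>))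
        M (\<lambda>\<omega>. indicator (- {0}) (\<kappa> (shift T h (\<Theta> \<omega>))) * \<Gamma> (shift T h (\<Theta> \<omega>)))) \<and>
     cond_J T \<kappa> M \<Theta>"

definition tail_field ::
  "(real^'l) set \<Rightarrow> ((real^'l \<Rightarrow> real^'d) \<Rightarrow> ennreal) \<Rightarrow> real \<Rightarrow> 'a measure \<Rightarrow> ('a \<Rightarrow> real^'l \<Rightarrow> real^'d) \<Rightarrow> bool"
where
  "tail_field T \<kappa> \<alpha> M Y \<longleftrightarrow>
     random_field T \<kappa> M Y \<and> (AE \<omega> in M. 1 < \<kappa> (Y \<omega>)) \<and>
     (\<forall>\<Gamma>\<in>maps T. \<forall>h\<in>T. \<forall>x>0. eq_expect
        M (\<lambda>\<omega>. \<Gamma> (fscale T x (shift T h (Y \<omega>))) * indicator {1<..} (\<kappa> (fscale T x (shift T h (Y \<omega>)))))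
        M (\<lambda>\<omega>. ereal (x powr \<alpha>) *
                 (\<Gamma> (Y \<omega>) * indicator {1<..} (\<kappa> (fscale T (1 / x) (shift T (- h) (Y \<omega>))))))) \<and>
     cond_J T \<kappa> M Y"

text \<open>
  Pareto variables are taken with values in \<open>[0,\<infinity>]\<close>, as is the variable \<open>\<kappa>(Y)\<^sup>1\<^sup>/\<^sup>\<alpha>\<close>; they are a.s. finite
  and greater than \<open>1\<close>.  Excluding negative values (which only occur with probability \<open>0\<close>) matters
  for the joint measurability of \<open>\<kappa>(B\<^sup>t(R\<Theta>))\<close>, which is required on the whole sample space.
\<close>
definition pareto :: "real \<Rightarrow> 'a measure \<Rightarrow> ('a \<Rightarrow> ennreal) \<Rightarrow> bool" where
  "pareto \<alpha> M R \<longleftrightarrow> R \<in> borel_measurable M \<and>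
     (\<forall>t\<ge>1. measure M {\<omega> \<in> space M. ennreal t < R \<omega>} = t powr (- \<alpha>))"

text \<open>
  Independence of two random variables.  The library constant \<open>indep_var\<close> is the same notion, but
  asks both variables to take values in the same type.
\<close>
definition independent_rv ::
  "'a measure \<Rightarrow> 'b measure \<Rightarrow> ('a \<Rightarrow> 'b) \<Rightarrow> 'c measure \<Rightarrow> ('a \<Rightarrow> 'c) \<Rightarrow> bool"
where
  "independent_rv M N X N' X' \<longleftrightarrow> X \<in> measurable M N \<and> X' \<in> measurable M N' \<and>
     prob_space.indep_set M {X -` A \<inter> space M | A. A \<in> sets N} {X' -` A \<inter> space M | A. A \<in> sets N'}"


section \<open>The relations between tail and spectral tail fields\<close>

definition tail_spectral_identity ::
  "(real^'l) set \<Rightarrow> ((real^'l \<Rightarrow> real^'d) \<Rightarrow> ennreal) \<Rightarrow> real \<Rightarrow> 'a measure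
     \<Rightarrow> ('a \<Rightarrow> real^'l \<Rightarrow> real^'d) \<Rightarrow> ('a \<Rightarrow> real^'l \<Rightarrow> real^'d) \<Rightarrow> bool"
where
  "tail_spectral_identity T \<kappa> \<alpha> M \<Theta> Y \<longleftrightarrow>
     (\<forall>\<Gamma>\<in>star_maps T \<kappa>. \<forall>h\<in>T.
        let X = (\<lambda>z \<omega>. \<Gamma> (fscale T z (\<Theta> \<omega>)) *
                         indicator {1<..} (\<kappa> (fscale T z (shift T (- h) (\<Theta> \<omega>)))))
        in (AE z in restrict_space lborel {0<..}. eintegral_exists M (X z)) \<longrightarrow>
           eq_expect
             (restrict_space lborel {0<..}) (\<lambda>z. eintegral M (X z) * ereal (\<alpha> * z powr (- \<alpha> - 1)))
             M (\<lambda>\<omega>. \<Gamma> (shift T h (Y \<omega>)) * indicator (- {0}) (\<kappa> (shift T h (Y \<omega>)))))"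

definition locally_bounded_moments ::
  "(real^'l) set \<Rightarrow> ((real^'l \<Rightarrow> real^'d) \<Rightarrow> ennreal) \<Rightarrow> 'a measure \<Rightarrow> ('a \<Rightarrow> real^'l \<Rightarrow> real^'d) \<Rightarrow> real \<Rightarrow> bool"
where
  "locally_bounded_moments T \<kappa> M \<Theta> \<tau> \<longleftrightarrow>
     (\<forall>c>0. (SUP t\<in>cube c \<inter> T. \<integral>\<^sup>+\<omega>. epowr (\<kappa> (shift T (- t) (\<Theta> \<omega>))) \<tau> \<partial>M) < \<infinity>)"

definition exceedance_condition ::
  "(real^'l) set \<Rightarrow> ((real^'l \<Rightarrow> real^'d) \<Rightarrow> ennreal) \<Rightarrow> 'a measure
     \<Rightarrow> ('a \<Rightarrow> real^'l \<Rightarrow> real^'d) \<Rightarrow> ('a \<Rightarrow> real^'l \<Rightarrow> real^'d) \<Rightarrow> real \<Rightarrow> bool"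
where
  "exceedance_condition T \<kappa> M \<Theta> Y \<tau> \<longleftrightarrow>
     (\<forall>c>0. (\<integral>\<^sup>+t\<in>cube c. (\<integral>\<^sup>+\<omega>. 1 / (\<integral>\<^sup>+s\<in>cube c.
           epowr (\<kappa> (shift T (t - s) (\<Theta> \<omega>))) \<tau> * indicator {1<..} (\<kappa> (shift T (t - s) (Y \<omega>)))
           \<partial>index_measure T) \<partial>M) \<partial>index_measure T) < \<infinity>)"

end

theory Submission
  imports Defs
begin

text \<open>
  Write \<open>k\<^sub>t(f)\<close> for \<open>\<kappa>(B\<^sup>-\<^sup>t f)\<close> (the constant \<open>kap\<close>).  The proof works with identities of laws on the
  path space, that is, with identities for nonnegative product-measurable maps, and turns them into the
  stated expectation identities at the end.
  
  \<^bold>\<open>Polar decomposition.\<close>  For \<open>h = 0\<close> the identity defining a tail field says that the radius \<open>R\<close> is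
  Pareto and independent of \<open>\<Theta> = Y/R\<close>.  So \<open>Y\<close> has the law of \<open>z\<Theta>\<close> under the intensity
  \<open>\<rho>(dz) = \<alpha> z\<^sup>-\<^sup>\<alpha>\<^sup>-\<^sup>1 dz\<close> on \<open>z > 1\<close>.  For general \<open>h\<close>, substituting this law and letting \<open>x \<rightarrow> \<infinity>\<close> gives
  the law of \<open>B\<^sup>hY\<close> on \<open>k\<^sub>-\<^sub>h(Y) \<noteq> 0\<close> as the law of \<open>z\<Theta>\<close> under \<open>\<rho>\<close> on \<open>k\<^sub>h(z\<Theta>) > 1\<close>; the substitution
  can be undone, so the two identities are equivalent (\<open>spectral_law_of_tail_law\<close>,
  \<open>tail_law_of_spectral_law\<close>).  Applied to maps that depend only on the normalized path, it becomes
  \<open>E k\<^sub>h(\<Theta>) H(\<Theta>) = E 1(k\<^sub>-\<^sub>h(\<Theta>) \<noteq> 0) H(B\<^sup>h\<Theta> / k\<^sub>-\<^sub>h(\<Theta>)\<^sup>1\<^sup>/\<^sup>\<alpha>)\<close>, the spectral identity (\<open>shift_law_of_spectral_law\<close>).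
  
  \<^bold>\<open>Integral maps.\<close>  The maps in the identities contain integrals of the path, which in general are not
  measurable functions on the path space.  But along a jointly measurable field such an integral is almost surely a
  measurable function of the path, and the same function for any two fields with the same law
  (\<open>integral_functional_determined_by_law\<close>).  Hence identities of laws extend to integral maps.
  
  \<^bold>\<open>The mixed field.\<close>  For a density \<open>p\<close> on the rational points let \<open>N\<close> have density \<open>p\<close>
  independently of \<open>\<Theta>\<close> and put \<open>Z = B\<^sup>N\<Theta> / D\<^sup>1\<^sup>/\<^sup>\<alpha>\<close> with \<open>D = \<Sum>\<^sub>r k\<^sub>r(B\<^sup>N\<Theta>) p(r)\<close>.  The spectral identity
  yields \<open>E k\<^sub>h(Z) H(Z/k\<^sub>h(Z)\<^sup>1\<^sup>/\<^sup>\<alpha>) = E H(B\<^sup>h\<Theta>)\<close> for all \<open>h\<close> (\<open>Z_identity\<close>), which makes the class of \<open>Z\<close>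
  shift-invariant with local field \<open>\<Theta>\<close>; and condition (J) for \<open>p\<close> says precisely that the supremum of
  \<open>k\<^sub>s(Z)\<close> over each cube has finite mean (\<open>J_integral\<close>).
  
  \<^bold>\<open>Exceedances.\<close>  The field \<open>B\<^sup>tY\<close> has the law of \<open>zZ\<close> under \<open>\<rho>(dz) \<Otimes> P\<close> on \<open>k\<^sub>t(zZ) > 1\<close>.  With
  \<open>I\<close> the integral of \<open>k\<^sub>s(zZ)\<^sup>\<tau>\<close> over the positions \<open>s\<close> of the cube with \<open>k\<^sub>s(zZ) > 1\<close>, Fubini turns the
  double integral of the exceedance condition into the integral of \<open>I/I\<close>, that is, into the mass of
  \<open>{0 < I < \<infinity>}\<close> (\<open>exceedance_integral\<close>).  The mean supremum over the cube is the mass of the event that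
  \<open>k\<^sub>s(zZ) > 1\<close> somewhere in the cube (\<open>local_sup_integral\<close>).  The event \<open>I > 0\<close> lies in it, up to a slight
  enlargement of the cube; conversely stochastic continuity gives \<open>I > 0\<close> on it (\<open>occupation_pos\<close>), and
  the moment condition gives \<open>I < \<infinity>\<close> (\<open>power_integral_AE_finite\<close>).  So (J) implies the exceedance
  condition, and under the moment condition it is implied by it.
\<close>


section \<open>Integral functionals of a process and its law\<close>

text \<open>
  An integral of functions of \<open>F\<close> cannot tell an event \<open>B\<close> from its conditional probability \<open>b(F)\<close> given
  \<open>F\<close>: by Fubini both have the same mean product with the integral.  Therefore it is enough to compare
  the integral with \<open>G(F)\<close> on events of the form \<open>F \<in> A\<close>, as in the last assumption.
\<close>

lemma integral_functional_eq_of_weighted_laws: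
  fixes F :: "'m \<Rightarrow> 'p" and x :: "'t \<Rightarrow> 'p \<Rightarrow> ennreal" and G :: "'p \<Rightarrow> ennreal"
  assumes "finite_measure M" and F[measurable]: "F \<in> measurable M P"
    and "sigma_finite_measure \<mu>"
    and x: "\<And>t. t \<in> space \<mu> \<Longrightarrow> x t \<in> borel_measurable P"
    and jm[measurable]: "(\<lambda>(t, \<omega>). x t (F \<omega>)) \<in> borel_measurable (\<mu> \<Otimes>\<^sub>M M)"
    and G[measurable]: "G \<in> borel_measurable P"
    and eq: "\<And>A. A \<in> sets P \<Longrightarrow> (\<integral>\<^sup>+\<omega>. indicator A (F \<omega>) * (\<integral>\<^sup>+t. x t (F \<omega>) \<partial>\<mu>) \<partial>M)
                             = (\<integral>\<^sup>+\<omega>. indicator A (F \<omega>) * G (F \<omega>) \<partial>M)"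
  shows "AE \<omega> in M. (\<integral>\<^sup>+t. x t (F \<omega>) \<partial>\<mu>) = G (F \<omega>)"
proof -
  interpret M: finite_measure M by fact
  interpret \<mu>: sigma_finite_measure \<mu> by fact
  interpret pair_sigma_finite \<mu> M ..
  let ?I = "\<lambda>\<omega>. \<integral>\<^sup>+t. x t (F \<omega>) \<partial>\<mu>"
  let ?\<nu> = "distr M P F"
  interpret \<nu>: finite_measure ?\<nu> by (rule M.finite_measure_distr) fact
  have Im[measurable]: "?I \<in> borel_measurable M" by measurable
  have "distr (density M ?I) P F = density ?\<nu> G"
  proof (rule measure_eqI)
    fix A assume "A \<in> sets (distr (density M ?I) P F)"
    then have A[measurable]: "A \<in> sets P" by simp
    have "emeasure (distr (density M ?I) P F) A = (\<integral>\<^sup>+\<omega>. indicator A (F \<omega>) * ?I \<omega> \<partial>M)"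
      by (simp add: emeasure_distr emeasure_density)
         (auto intro!: nn_integral_cong simp: indicator_def)
    also have "\<dots> = emeasure (density ?\<nu> G) A"
      by (simp add: eq emeasure_density nn_integral_distr) (simp add: mult.commute)
    finally show "emeasure (distr (density M ?I) P F) A = emeasure (density ?\<nu> G) A" .
  qed simp
  then have ext: "(\<integral>\<^sup>+\<omega>. h (F \<omega>) * ?I \<omega> \<partial>M) = (\<integral>\<^sup>+\<omega>. h (F \<omega>) * G (F \<omega>) \<partial>M)"
    if [measurable]: "h \<in> borel_measurable P" for h
  proof -
    assume e: "distr (density M ?I) P F = density ?\<nu> G"
    have "(\<integral>\<^sup>+\<omega>. h (F \<omega>) * ?I \<omega> \<partial>M) = (\<integral>\<^sup>+f. h f \<partial>distr (density M ?I) P F)"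
      by (simp add: nn_integral_distr nn_integral_density mult.commute)
    also have "\<dots> = (\<integral>\<^sup>+f. h f \<partial>density ?\<nu> G)" by (simp only: e)
    also have "\<dots> = (\<integral>\<^sup>+\<omega>. h (F \<omega>) * G (F \<omega>) \<partial>M)"
      by (simp add: nn_integral_distr nn_integral_density mult.commute)
    finally show ?thesis .
  qed
  show ?thesis
  proof (rule M.density_unique2)
    fix B assume B[measurable]: "B \<in> sets M"
    let ?\<beta> = "distr (density M (indicator B)) P F"
    define b where "b = RN_deriv ?\<nu> ?\<beta>"
    have [measurable]: "b \<in> borel_measurable P"
      unfolding b_def using borel_measurable_RN_deriv[of ?\<nu> ?\<beta>] by simp
    have "absolutely_continuous ?\<nu> ?\<beta>"
      unfolding absolutely_continuous_def
    proof
      fix A assume "A \<in> null_sets ?\<nu>"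
      then have A[measurable]: "A \<in> sets P" and 0: "emeasure M (F -` A \<inter> space M) = 0"
        by (auto simp: null_sets_def emeasure_distr)
      have "emeasure ?\<beta> A = (\<integral>\<^sup>+\<omega>. indicator B \<omega> * indicator (F -` A \<inter> space M) \<omega> \<partial>M)"
        by (simp add: emeasure_distr emeasure_density)
      also have "\<dots> \<le> (\<integral>\<^sup>+\<omega>. indicator (F -` A \<inter> space M) \<omega> \<partial>M)"
        by (intro nn_integral_mono) (auto simp: indicator_def)
      finally show "A \<in> null_sets ?\<beta>" using 0 by (auto simp: null_sets_def)
    qed
    then have "density ?\<nu> b = ?\<beta>" unfolding b_def by (intro \<nu>.density_RN_deriv) simp_all
    then have b: "(\<integral>\<^sup>+\<omega>. indicator B \<omega> * h (F \<omega>) \<partial>M) = (\<integral>\<^sup>+\<omega>. b (F \<omega>) * h (F \<omega>) \<partial>M)"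
      if [measurable]: "h \<in> borel_measurable P" for h
    proof -
      assume e: "density ?\<nu> b = ?\<beta>"
      have "(\<integral>\<^sup>+\<omega>. indicator B \<omega> * h (F \<omega>) \<partial>M) = (\<integral>\<^sup>+f. h f \<partial>?\<beta>)"
        by (simp add: nn_integral_distr nn_integral_density)
      also have "\<dots> = (\<integral>\<^sup>+f. h f \<partial>density ?\<nu> b)" by (simp only: e)
      also have "\<dots> = (\<integral>\<^sup>+\<omega>. b (F \<omega>) * h (F \<omega>) \<partial>M)"
        by (simp add: nn_integral_distr nn_integral_density)
      finally show ?thesis .
    qed
    have xt[measurable]: "(\<lambda>\<omega>. x t (F \<omega>)) \<in> borel_measurable M" if "t \<in> space \<mu>" for t
      using x[OF that] by measurable
    have "(\<integral>\<^sup>+\<omega>\<in>B. ?I \<omega> \<partial>M) = (\<integral>\<^sup>+\<omega>. \<integral>\<^sup>+t. indicator B \<omega> * x t (F \<omega>) \<partial>\<mu> \<partial>M)"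
      by (intro nn_integral_cong, subst nn_integral_cmult) (auto simp: mult.commute)
    also have "\<dots> = (\<integral>\<^sup>+t. \<integral>\<^sup>+\<omega>. indicator B \<omega> * x t (F \<omega>) \<partial>M \<partial>\<mu>)"
      by (rule Fubini') measurable
    also have "\<dots> = (\<integral>\<^sup>+t. \<integral>\<^sup>+\<omega>. b (F \<omega>) * x t (F \<omega>) \<partial>M \<partial>\<mu>)"
      by (intro nn_integral_cong b x)
    also have "\<dots> = (\<integral>\<^sup>+\<omega>. \<integral>\<^sup>+t. b (F \<omega>) * x t (F \<omega>) \<partial>\<mu> \<partial>M)"
      by (rule Fubini'[symmetric]) measurable
    also have "\<dots> = (\<integral>\<^sup>+\<omega>. b (F \<omega>) * ?I \<omega> \<partial>M)"
      by (intro nn_integral_cong, subst nn_integral_cmult) auto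
    also have "\<dots> = (\<integral>\<^sup>+\<omega>. b (F \<omega>) * G (F \<omega>) \<partial>M)" by (rule ext) measurable
    also have "\<dots> = (\<integral>\<^sup>+\<omega>\<in>B. G (F \<omega>) \<partial>M)" by (subst b[symmetric]) (auto simp: mult.commute)
    finally show "(\<integral>\<^sup>+\<omega>\<in>B. ?I \<omega> \<partial>M) = (\<integral>\<^sup>+\<omega>\<in>B. G (F \<omega>) \<partial>M)" .
  qed measurable
qed

text \<open>
  The common \<open>G\<close> is the density of the law weighted by the integral with respect to the law itself.  By
  Fubini the weighted law is a mixture over \<open>t\<close> of laws weighted by \<open>x t\<close>, which depend on the law only.
\<close>

lemma integral_functional_determined_by_law:
  fixes F\<^sub>1 :: "'m \<Rightarrow> 'p" and F\<^sub>2 :: "'n \<Rightarrow> 'p" and x :: "'t \<Rightarrow> 'p \<Rightarrow> ennreal"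
  assumes "finite_measure M\<^sub>1" and F1[measurable]: "F\<^sub>1 \<in> measurable M\<^sub>1 P"
    and "finite_measure M\<^sub>2" and F2[measurable]: "F\<^sub>2 \<in> measurable M\<^sub>2 P"
    and law: "distr M\<^sub>1 P F\<^sub>1 = distr M\<^sub>2 P F\<^sub>2"
    and "sigma_finite_measure \<mu>"
    and x: "\<And>t. t \<in> space \<mu> \<Longrightarrow> x t \<in> borel_measurable P"
    and jm1[measurable]: "(\<lambda>(t, \<omega>). x t (F\<^sub>1 \<omega>)) \<in> borel_measurable (\<mu> \<Otimes>\<^sub>M M\<^sub>1)"
    and jm2[measurable]: "(\<lambda>(t, \<omega>). x t (F\<^sub>2 \<omega>)) \<in> borel_measurable (\<mu> \<Otimes>\<^sub>M M\<^sub>2)"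
  obtains G where "G \<in> borel_measurable P"
    and "AE \<omega> in M\<^sub>1. (\<integral>\<^sup>+t. x t (F\<^sub>1 \<omega>) \<partial>\<mu>) = G (F\<^sub>1 \<omega>)"
    and "AE \<omega> in M\<^sub>2. (\<integral>\<^sup>+t. x t (F\<^sub>2 \<omega>) \<partial>\<mu>) = G (F\<^sub>2 \<omega>)"
proof -
  interpret M1: finite_measure M\<^sub>1 by fact
  interpret M2: finite_measure M\<^sub>2 by fact
  interpret \<mu>: sigma_finite_measure \<mu> by fact
  interpret A1: pair_sigma_finite \<mu> M\<^sub>1 ..
  interpret A2: pair_sigma_finite \<mu> M\<^sub>2 ..
  let ?I1 = "\<lambda>\<omega>. \<integral>\<^sup>+t. x t (F\<^sub>1 \<omega>) \<partial>\<mu>"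
  let ?I2 = "\<lambda>\<omega>. \<integral>\<^sup>+t. x t (F\<^sub>2 \<omega>) \<partial>\<mu>"
  let ?\<nu> = "distr M\<^sub>1 P F\<^sub>1"
  let ?\<eta> = "distr (density M\<^sub>1 ?I1) P F\<^sub>1"
  interpret \<nu>: finite_measure ?\<nu> by (rule M1.finite_measure_distr) fact
  define G where "G = RN_deriv ?\<nu> ?\<eta>"
  have G[measurable]: "G \<in> borel_measurable P"
    unfolding G_def using borel_measurable_RN_deriv[of ?\<nu> ?\<eta>] by simp
  have "absolutely_continuous ?\<nu> ?\<eta>"
    unfolding absolutely_continuous_def
  proof
    fix A assume "A \<in> null_sets ?\<nu>"
    then have A[measurable]: "A \<in> sets P" and 0: "emeasure M\<^sub>1 (F\<^sub>1 -` A \<inter> space M\<^sub>1) = 0"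
      by (auto simp: null_sets_def emeasure_distr)
    have ae: "AE \<omega> in M\<^sub>1. \<omega> \<notin> F\<^sub>1 -` A \<inter> space M\<^sub>1"
      using 0 by (intro AE_not_in) (auto simp: null_sets_def)
    have "emeasure ?\<eta> A = (\<integral>\<^sup>+\<omega>. ?I1 \<omega> * indicator (F\<^sub>1 -` A \<inter> space M\<^sub>1) \<omega> \<partial>M\<^sub>1)"
      by (simp add: emeasure_distr emeasure_density)
    also have "\<dots> = (\<integral>\<^sup>+\<omega>. 0 \<partial>M\<^sub>1)"
      by (intro nn_integral_cong_AE, rule AE_mp[OF ae]) (auto simp: indicator_def)
    finally show "A \<in> null_sets ?\<eta>" by (auto simp: null_sets_def)
  qed
  then have d: "density ?\<nu> G = ?\<eta>" unfolding G_def by (intro \<nu>.density_RN_deriv) simp_all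
  have eq1: "(\<integral>\<^sup>+\<omega>. indicator A (F\<^sub>1 \<omega>) * ?I1 \<omega> \<partial>M\<^sub>1) = (\<integral>\<^sup>+\<omega>. indicator A (F\<^sub>1 \<omega>) * G (F\<^sub>1 \<omega>) \<partial>M\<^sub>1)"
    if [measurable]: "A \<in> sets P" for A
  proof -
    have "(\<integral>\<^sup>+\<omega>. indicator A (F\<^sub>1 \<omega>) * ?I1 \<omega> \<partial>M\<^sub>1) = (\<integral>\<^sup>+f. indicator A f \<partial>?\<eta>)"
      by (subst nn_integral_distr, simp, simp, subst nn_integral_density) (simp_all add: mult.commute)
    also have "\<dots> = (\<integral>\<^sup>+f. indicator A f \<partial>density ?\<nu> G)" by (simp only: d)
    also have "\<dots> = (\<integral>\<^sup>+\<omega>. indicator A (F\<^sub>1 \<omega>) * G (F\<^sub>1 \<omega>) \<partial>M\<^sub>1)"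
      by (subst nn_integral_density, simp, simp, subst nn_integral_distr) (simp_all add: mult.commute)
    finally show ?thesis .
  qed
  have xm1[measurable]: "(\<lambda>\<omega>. x t (F\<^sub>1 \<omega>)) \<in> borel_measurable M\<^sub>1" if "t \<in> space \<mu>" for t
    using x[OF that] by measurable
  have xm2[measurable]: "(\<lambda>\<omega>. x t (F\<^sub>2 \<omega>)) \<in> borel_measurable M\<^sub>2" if "t \<in> space \<mu>" for t
    using x[OF that] by measurable
  have law': "(\<integral>\<^sup>+\<omega>. h (F\<^sub>1 \<omega>) \<partial>M\<^sub>1) = (\<integral>\<^sup>+\<omega>. h (F\<^sub>2 \<omega>) \<partial>M\<^sub>2)"
    if [measurable]: "h \<in> borel_measurable P" for h :: "'p \<Rightarrow> ennreal"
    using arg_cong[OF law, of "\<lambda>N. \<integral>\<^sup>+f. h f \<partial>N"] by (simp add: nn_integral_distr)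
  have eq2: "(\<integral>\<^sup>+\<omega>. indicator A (F\<^sub>2 \<omega>) * ?I2 \<omega> \<partial>M\<^sub>2) = (\<integral>\<^sup>+\<omega>. indicator A (F\<^sub>2 \<omega>) * G (F\<^sub>2 \<omega>) \<partial>M\<^sub>2)"
    if A[measurable]: "A \<in> sets P" for A
  proof -
    have "(\<integral>\<^sup>+\<omega>. indicator A (F\<^sub>2 \<omega>) * ?I2 \<omega> \<partial>M\<^sub>2)
        = (\<integral>\<^sup>+\<omega>. \<integral>\<^sup>+t. indicator A (F\<^sub>2 \<omega>) * x t (F\<^sub>2 \<omega>) \<partial>\<mu> \<partial>M\<^sub>2)"
      by (intro nn_integral_cong, subst nn_integral_cmult) auto
    also have "\<dots> = (\<integral>\<^sup>+t. \<integral>\<^sup>+\<omega>. indicator A (F\<^sub>2 \<omega>) * x t (F\<^sub>2 \<omega>) \<partial>M\<^sub>2 \<partial>\<mu>)"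
      by (rule A2.Fubini') measurable
    also have "\<dots> = (\<integral>\<^sup>+t. \<integral>\<^sup>+\<omega>. indicator A (F\<^sub>1 \<omega>) * x t (F\<^sub>1 \<omega>) \<partial>M\<^sub>1 \<partial>\<mu>)"
    proof (intro nn_integral_cong)
      fix t assume "t \<in> space \<mu>"
      from x[OF this] have [measurable]: "x t \<in> borel_measurable P" .
      show "(\<integral>\<^sup>+\<omega>. indicator A (F\<^sub>2 \<omega>) * x t (F\<^sub>2 \<omega>) \<partial>M\<^sub>2) = (\<integral>\<^sup>+\<omega>. indicator A (F\<^sub>1 \<omega>) * x t (F\<^sub>1 \<omega>) \<partial>M\<^sub>1)"
        by (rule law'[symmetric]) measurable
    qed
    also have "\<dots> = (\<integral>\<^sup>+\<omega>. \<integral>\<^sup>+t. indicator A (F\<^sub>1 \<omega>) * x t (F\<^sub>1 \<omega>) \<partial>\<mu> \<partial>M\<^sub>1)"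
      by (rule A1.Fubini'[symmetric]) measurable
    also have "\<dots> = (\<integral>\<^sup>+\<omega>. indicator A (F\<^sub>1 \<omega>) * ?I1 \<omega> \<partial>M\<^sub>1)"
      by (intro nn_integral_cong, subst nn_integral_cmult) auto
    also have "\<dots> = (\<integral>\<^sup>+\<omega>. indicator A (F\<^sub>1 \<omega>) * G (F\<^sub>1 \<omega>) \<partial>M\<^sub>1)" by (rule eq1) fact
    also have "\<dots> = (\<integral>\<^sup>+\<omega>. indicator A (F\<^sub>2 \<omega>) * G (F\<^sub>2 \<omega>) \<partial>M\<^sub>2)"
      by (rule law') measurable
    finally show ?thesis .
  qed
  show thesis
  proof (rule that[OF G])
    show "AE \<omega> in M\<^sub>1. ?I1 \<omega> = G (F\<^sub>1 \<omega>)"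
      by (rule integral_functional_eq_of_weighted_laws[OF assms(1) F1 assms(6) x jm1 G eq1])
    show "AE \<omega> in M\<^sub>2. ?I2 \<omega> = G (F\<^sub>2 \<omega>)"
      by (rule integral_functional_eq_of_weighted_laws[OF assms(3) F2 assms(6) x jm2 G eq2])
  qed
qed

section \<open>The Pareto intensity\<close>

text \<open>
  The mass is infinite near \<open>0\<close>; the restriction to \<open>(1,\<infinity>)\<close> is the \<open>\<alpha>\<close>-Pareto law.
\<close>

definition pareto_intensity :: "real \<Rightarrow> real measure" where
  "pareto_intensity \<alpha> = density lborel (\<lambda>z. indicator {0<..} z * ennreal (\<alpha> * z powr (- \<alpha> - 1)))"

lemma sets_pareto_intensity[simp, measurable_cong]: "sets (pareto_intensity \<alpha>) = sets borel"
  by (simp add: pareto_intensity_def)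

lemma space_pareto_intensity[simp]: "space (pareto_intensity \<alpha>) = UNIV"
  by (simp add: pareto_intensity_def)

lemma nn_integral_pareto_intensity:
  assumes "f \<in> borel_measurable borel"
  shows "(\<integral>\<^sup>+z. f z \<partial>pareto_intensity \<alpha>)
       = (\<integral>\<^sup>+z. indicator {0<..} z * ennreal (\<alpha> * z powr (- \<alpha> - 1)) * f z \<partial>lborel)"
  unfolding pareto_intensity_def using assms by (intro nn_integral_density) auto

lemma AE_pareto_intensity_pos: "AE z in pareto_intensity \<alpha>. 0 < z"
  unfolding pareto_intensity_def by (subst AE_density) (auto simp: indicator_def)

lemma sigma_finite_pareto_intensity: "sigma_finite_measure (pareto_intensity \<alpha>)"
  unfolding pareto_intensity_def
  by (subst sigma_finite_measure.sigma_finite_iff_density_finite[OF sigma_finite_lborel]) (auto simp: indicator_def)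

lemma nn_integral_pareto_intensity_scale:
  assumes "0 < \<alpha>" "0 < x" and [measurable]: "f \<in> borel_measurable borel"
  shows "(\<integral>\<^sup>+z. f (x * z) \<partial>pareto_intensity \<alpha>) = ennreal (x powr \<alpha>) * (\<integral>\<^sup>+z. f z \<partial>pareto_intensity \<alpha>)"
proof -
  have "(\<integral>\<^sup>+z. f z \<partial>pareto_intensity \<alpha>)
     = \<bar>x\<bar> * (\<integral>\<^sup>+z. indicator {0<..} (0 + x * z) * ennreal (\<alpha> * (0 + x * z) powr (- \<alpha> - 1)) * f (0 + x * z) \<partial>lborel)"
    using assms by (subst nn_integral_pareto_intensity, simp, intro nn_integral_real_affine) auto
  also have "\<dots> = (\<integral>\<^sup>+z. ennreal x * (indicator {0<..} (x * z) * ennreal (\<alpha> * (x * z) powr (- \<alpha> - 1)) * f (x * z)) \<partial>lborel)"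
    using assms(2) by (subst nn_integral_cmult) auto
  finally have "ennreal (x powr \<alpha>) * (\<integral>\<^sup>+z. f z \<partial>pareto_intensity \<alpha>)
     = (\<integral>\<^sup>+z. ennreal (x powr \<alpha>) * (ennreal x * (indicator {0<..} (x * z) * ennreal (\<alpha> * (x * z) powr (- \<alpha> - 1)) * f (x * z))) \<partial>lborel)"
    by (simp only: nn_integral_cmult[symmetric]) (subst nn_integral_cmult, measurable)
  also have "\<dots> = (\<integral>\<^sup>+z. indicator {0<..} z * ennreal (\<alpha> * z powr (- \<alpha> - 1)) * f (x * z) \<partial>lborel)"
  proof (intro nn_integral_cong)
    fix z :: real
    show "ennreal (x powr \<alpha>) * (ennreal x * (indicator {0<..} (x * z) * ennreal (\<alpha> * (x * z) powr (- \<alpha> - 1)) * f (x * z)))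
      = indicator {0<..} z * ennreal (\<alpha> * z powr (- \<alpha> - 1)) * f (x * z)"
    proof (cases "0 < z")
      case True
      have "x powr \<alpha> * (x * (\<alpha> * (x * z) powr (- \<alpha> - 1))) = \<alpha> * z powr (- \<alpha> - 1) * (x powr \<alpha> * (x powr 1 * x powr (-\<alpha>-1)))"
        using assms True by (simp add: powr_mult mult_ac)
      also have "\<dots> = \<alpha> * z powr (- \<alpha> - 1)"
        using assms by (simp only: powr_add[symmetric]) simp
      finally have "ennreal (x powr \<alpha>) * (ennreal x * ennreal (\<alpha> * (x * z) powr (- \<alpha> - 1))) = ennreal (\<alpha> * z powr (- \<alpha> - 1))"
        using assms by (simp add: ennreal_mult[symmetric])
      then show ?thesis using True assms by (simp add: mult.assoc[symmetric] zero_less_mult_iff)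
    next
      case False
      then show ?thesis using assms by (simp add: zero_less_mult_iff)
    qed
  qed
  also have "\<dots> = (\<integral>\<^sup>+z. f (x * z) \<partial>pareto_intensity \<alpha>)"
    by (rule nn_integral_pareto_intensity[symmetric]) simp
  finally show ?thesis ..
qed

lemma emeasure_pareto_intensity_greaterThan:
  assumes "0 < \<alpha>" "0 < a"
  shows "emeasure (pareto_intensity \<alpha>) {a<..} = ennreal (a powr (- \<alpha>))"
proof -
  have "emeasure (pareto_intensity \<alpha>) {a<..} = (\<integral>\<^sup>+z. indicator {a<..} z \<partial>pareto_intensity \<alpha>)"
    by simp
  also have "\<dots> = (\<integral>\<^sup>+z. ennreal (\<alpha> * z powr (- \<alpha> - 1)) * indicator {a..} z \<partial>lborel)"
    using assms by (subst nn_integral_pareto_intensity, simp, intro nn_integral_cong_AE)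
      (auto intro!: AE_I[of _ _ "{a}"] simp: indicator_def)
  also have "\<dots> = ennreal (0 - (- (a powr (- \<alpha>))))"
  proof (rule nn_integral_FTC_atLeast)
    fix x assume "a \<le> x"
    then have "0 < x" using assms by simp
    then show "((\<lambda>x. - (x powr (- \<alpha>))) has_real_derivative \<alpha> * x powr (- \<alpha> - 1)) (at x)"
      by (auto intro!: derivative_eq_intros)
  next
    show "((\<lambda>x. - (x powr (- \<alpha>))) \<longlongrightarrow> 0) at_top"
      using assms tendsto_minus[OF tendsto_neg_powr[of "- \<alpha>" "\<lambda>x. x" at_top]] filterlim_ident[of at_top] by auto
  qed (use assms in auto)
  finally show ?thesis by simp
qed

lemma one_less_powr_iff:
  fixes x :: real
  assumes "0 < a" "0 \<le> x"
  shows "1 < x powr a \<longleftrightarrow> 1 < x"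
  using assms powr_less_mono2[of a 1 x] powr_mono2[of a x 1] by (cases "1 < x") simp_all

text \<open>
  Means of \<open>[0,\<infinity>]\<close>-valued variables thus become masses of exceedance events.
\<close>

lemma pareto_intensity_threshold:
  assumes "0 < \<alpha>"
  shows "(\<integral>\<^sup>+z. indicator {1<..} (ennreal (z powr \<alpha>) * k) \<partial>pareto_intensity \<alpha>) = k"
proof -
  consider "k = 0" | r where "0 < r" "k = ennreal r" | "k = \<infinity>"
    by (cases k) (auto simp: less_le)
  then show ?thesis
  proof cases
    case 1 then show ?thesis by simp
  next
    case (2 r)
    have *: "1 < z powr \<alpha> * r \<longleftrightarrow> r powr (- (1 / \<alpha>)) < z" if "0 < z" for z
    proof -
      have "r powr (- (1 / \<alpha>)) < z \<longleftrightarrow> (r powr (- (1 / \<alpha>))) powr \<alpha> < z powr \<alpha>"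
        using assms that 2 powr_less_mono2[of \<alpha> "r powr (- (1 / \<alpha>))" z]
          powr_mono2[of \<alpha> z "r powr (- (1 / \<alpha>))"] by (auto simp: not_less[symmetric])
      also have "(r powr (- (1 / \<alpha>))) powr \<alpha> = r powr (-1)"
        using assms by (simp only: powr_powr) simp
      also have "\<dots> = 1 / r" using 2 by (simp add: powr_minus_divide)
      finally show ?thesis using 2 by (simp add: field_simps)
    qed
    have "(\<integral>\<^sup>+z. indicator {1<..} (ennreal (z powr \<alpha>) * k) \<partial>pareto_intensity \<alpha>)
        = (\<integral>\<^sup>+z. indicator {r powr (- (1 / \<alpha>))<..} z \<partial>pareto_intensity \<alpha>)"
      using AE_pareto_intensity_pos[of \<alpha>] 2 *
      by (intro nn_integral_cong_AE) (auto simp: indicator_def ennreal_mult[symmetric] elim!: AE_mp)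
    also have "\<dots> = ennreal ((r powr (- (1 / \<alpha>))) powr (- \<alpha>))"
      using assms 2 by (simp add: emeasure_pareto_intensity_greaterThan)
    finally show ?thesis using 2 assms by (simp add: powr_powr)
  next
    case 3
    have "(\<integral>\<^sup>+z. indicator {1<..} (ennreal (z powr \<alpha>) * k) \<partial>pareto_intensity \<alpha>)
        = (\<integral>\<^sup>+z. indicator {0<..} z \<partial>pareto_intensity \<alpha>)"
      using AE_pareto_intensity_pos[of \<alpha>] 3 
      by (intro nn_integral_cong_AE) (auto simp: indicator_def ennreal_mult_top elim!: AE_mp)
    also have "\<dots> = emeasure (pareto_intensity \<alpha>) {0<..}" by simp
    also have "\<dots> = \<infinity>"
    proof (rule ccontr)
      assume "emeasure (pareto_intensity \<alpha>) {0<..} \<noteq> \<infinity>"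
      then obtain r where r: "emeasure (pareto_intensity \<alpha>) {0<..} = ennreal r" "0 \<le> r"
        by (cases "emeasure (pareto_intensity \<alpha>) {0<..}") auto
      define a where "a = (r + 1) powr (- (1 / \<alpha>))"
      have "ennreal (a powr (- \<alpha>)) \<le> ennreal r"
        using assms r by (subst emeasure_pareto_intensity_greaterThan[symmetric], simp,
            simp add: a_def, subst r(1)[symmetric], intro emeasure_mono) (auto simp: a_def intro: less_trans[rotated])
      moreover have "a powr (- \<alpha>) = r + 1" using assms r by (simp add: a_def powr_powr)
      ultimately show False using r by simp
    qed
    finally show ?thesis using 3 by simp
  qed
qed

section \<open>Arithmetic in the extended half-line\<close>

lemma epowr_measurable[measurable]: "(\<lambda>x. epowr x a) \<in> borel_measurable borel"
  unfolding epowr_def by measurable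

lemma epowr_ennreal: "0 < r \<Longrightarrow> epowr (ennreal r) a = ennreal (r powr a)"
  by (simp add: epowr_def)

lemma epowr_pos_finite: "0 < x \<Longrightarrow> x < \<infinity> \<Longrightarrow> 0 < epowr x a \<and> epowr x a < \<infinity>"
  by (cases x) (auto simp: epowr_ennreal)

lemma epowr_mult:
  assumes "0 < r"
  shows "epowr (ennreal r * x) a = ennreal (r powr a) * epowr x a"
proof -
  consider "x = 0" | q where "0 < q" "x = ennreal q" | "x = \<infinity>"
    by (cases x) (auto simp: less_le)
  then show ?thesis
  proof cases
    case 1 then show ?thesis using assms by (simp add: epowr_def ennreal_mult_top)
  next
    case 2
    have "epowr (ennreal (r * q)) a = ennreal (r powr a * q powr a)"
      using 2 assms by (simp add: epowr_ennreal powr_mult)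
    then show ?thesis using 2 assms by (simp add: epowr_ennreal ennreal_mult)
  next
    case 3 then show ?thesis using assms by (simp add: epowr_def ennreal_mult_top)
  qed
qed

lemma e2ennreal_enn2ereal_times: "e2ennreal (enn2ereal a * x) = a * e2ennreal x"
proof (cases "0 \<le> x")
  case True
  then have "enn2ereal a * x = enn2ereal (a * e2ennreal x)"
    by (simp add: times_ennreal.rep_eq enn2ereal_e2ennreal)
  then show ?thesis by simp
next
  case False
  then have "enn2ereal a * x \<le> 0" by (simp add: mult_nonneg_nonpos ereal_mult_le_0_iff)
  then show ?thesis using False by (simp add: e2ennreal_neg)
qed

lemma e2ennreal_uminus_enn2ereal_times: "e2ennreal (- (enn2ereal a * x)) = a * e2ennreal (- x)"
  by (simp add: e2ennreal_enn2ereal_times[symmetric])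

lemma indicator_enn2ereal: "(indicator A x :: ereal) = enn2ereal (indicator A x)"
  by (simp add: indicator_def one_ereal_def[symmetric] zero_ennreal.rep_eq one_ennreal.rep_eq)

lemma eintegral_cong_AE:
  assumes "AE \<omega> in M. X \<omega> = X' \<omega>"
  shows "eintegral M X = eintegral M X'"
proof -
  have "(\<integral>\<^sup>+\<omega>. e2ennreal (X \<omega>) \<partial>M) = (\<integral>\<^sup>+\<omega>. e2ennreal (X' \<omega>) \<partial>M)"
    using assms by (intro nn_integral_cong_AE) (auto elim: AE_mp)
  moreover have "(\<integral>\<^sup>+\<omega>. e2ennreal (- X \<omega>) \<partial>M) = (\<integral>\<^sup>+\<omega>. e2ennreal (- X' \<omega>) \<partial>M)"
    using assms by (intro nn_integral_cong_AE) (auto elim: AE_mp)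
  ultimately show ?thesis by (simp add: eintegral_def)
qed

lemma eintegral_weighted:
  "eintegral M (\<lambda>\<omega>. enn2ereal (a \<omega>) * X \<omega>)
    = enn2ereal (\<integral>\<^sup>+\<omega>. a \<omega> * e2ennreal (X \<omega>) \<partial>M) - enn2ereal (\<integral>\<^sup>+\<omega>. a \<omega> * e2ennreal (- X \<omega>) \<partial>M)"
  by (simp add: eintegral_def e2ennreal_enn2ereal_times e2ennreal_uminus_enn2ereal_times)

lemma eintegral_nonneg:
  assumes "\<And>\<omega>. 0 \<le> X \<omega>"
  shows "eintegral M X = enn2ereal (\<integral>\<^sup>+\<omega>. e2ennreal (X \<omega>) \<partial>M)"
proof -
  have "e2ennreal (- X \<omega>) = 0" for \<omega> using assms[of \<omega>] by (simp add: e2ennreal_neg)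
  then show ?thesis by (simp add: eintegral_def zero_ennreal.rep_eq)
qed

lemma eintegral_exists_nonneg:
  assumes "\<And>\<omega>. 0 \<le> X \<omega>" "X \<in> borel_measurable M"
  shows "eintegral_exists M X"
proof -
  have "e2ennreal (- X \<omega>) = 0" for \<omega> using assms(1)[of \<omega>] by (simp add: e2ennreal_neg)
  then show ?thesis using assms by (simp add: eintegral_exists_def)
qed

section \<open>Stochastic continuity\<close>

lemma edistance_self[simp]: "edistance x x = 0"
  by (simp add: edistance_def)

lemma edistance_measurable[measurable]:
  assumes [measurable]: "f \<in> borel_measurable M" "g \<in> borel_measurable M"
  shows "(\<lambda>\<omega>. edistance (f \<omega>) (g \<omega>)) \<in> borel_measurable M"
  unfolding edistance_def by measurable

lemma edistance_scale:
  assumes "0 \<le> c"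
  shows "edistance (ennreal c * x) (ennreal c * y) \<le> ennreal c * edistance x y"
proof -
  have "ennreal (c * r - c * q) \<le> ennreal c * ennreal (r - q)" for r q
  proof (cases "q \<le> r")
    case True
    then show ?thesis using assms by (simp add: ennreal_mult[symmetric] right_diff_distrib)
  next
    case False
    then have "c * r - c * q \<le> 0" using assms by (simp add: mult_left_mono)
    then show ?thesis by (simp add: ennreal_neg)
  qed
  note * = this
  have *: "ennreal c * x - ennreal c * y \<le> ennreal c * (x - y)" for x y
  proof (cases "c = 0")
    case False
    then show ?thesis using assms
      by (cases x; cases y)
         (simp_all add: ennreal_mult[symmetric] ennreal_minus ennreal_mult_top
            ennreal_mult_eq_top_iff ennreal_top_minus *)
  qed simp
  show ?thesis
  proof (cases "x = y")
    case False
    then have "edistance x y = max (x - y) (y - x)" by (simp add: edistance_def)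
    then have "x - y \<le> edistance x y" "y - x \<le> edistance x y" by simp_all
    then have "ennreal c * x - ennreal c * y \<le> ennreal c * edistance x y"
      "ennreal c * y - ennreal c * x \<le> ennreal c * edistance x y"
      by (auto intro!: order_trans[OF *] mult_left_mono)
    then show ?thesis by (simp add: edistance_def)
  qed simp
qed

lemma edistance_triangle:
  shows "x \<le> y + edistance x y" and "y \<noteq> \<infinity> \<Longrightarrow> y - edistance x y \<le> x"
proof -
  have d: "x - y \<le> edistance x y" "y - x \<le> edistance x y" if "x \<noteq> y"
    using that by (simp_all add: edistance_def)
  have le: "u \<le> v + (u - v)" for u v :: ennreal
    by (cases "v \<le> u") (auto simp: add_diff_inverse_ennreal not_le intro: add_increasing2)
  show "x \<le> y + edistance x y"
  proof (cases "x = y")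
    case False
    have "x \<le> y + (x - y)" by (rule le)
    also have "\<dots> \<le> y + edistance x y" by (intro add_left_mono d False)
    finally show ?thesis .
  qed simp
  show "y - edistance x y \<le> x" if "y \<noteq> \<infinity>"
  proof (cases "x = y")
    case False
    have "y \<le> x + (y - x)" by (rule le)
    also have "\<dots> \<le> edistance x y + x" unfolding add.commute[of x] by (intro add_right_mono d False)
    finally show ?thesis using that by (simp add: ennreal_minus_le_iff)
  qed simp
qed

lemma tendsto_of_edistance:
  assumes "(\<lambda>n. edistance (x n) y) \<longlonglongrightarrow> 0"
  shows "x \<longlonglongrightarrow> y"
proof (cases "y = \<infinity>")
  case True
  have "\<forall>\<^sub>F n in sequentially. edistance (x n) y < 1"
    using order_tendstoD(2)[OF assms, of 1] by simp
  then have "\<forall>\<^sub>F n in sequentially. x n = y"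
  proof eventually_elim
    case (elim n)
    then show ?case using True
      by (cases "x n") (auto simp: edistance_def split: if_splits)
  qed
  then show ?thesis by (rule tendsto_eventually)
next
  case False
  let ?e = "\<lambda>n. edistance (x n) y"
  show ?thesis
  proof (rule tendsto_sandwich)
    show "(\<lambda>n. y - ?e n) \<longlonglongrightarrow> y"
      using tendsto_diff_ennreal[OF tendsto_const[of y] assms] False by simp
    show "(\<lambda>n. y + ?e n) \<longlonglongrightarrow> y"
      using tendsto_add[OF tendsto_const[of y] assms] by simp
  qed (use False in \<open>simp_all add: edistance_triangle\<close>)
qed

text \<open>
  The events \<open>|X(s\<^sub>n) - X(t)| > 2\<^sup>-\<^sup>n\<close> have summable probabilities along a fast subsequence, so the
  Borel-Cantelli lemma applies.
\<close>

lemma stoch_continuous_subsequence: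
  assumes M: "finite_measure M" and sc: "stoch_continuous T M X"
    and X[measurable]: "\<And>t. t \<in> T \<Longrightarrow> X t \<in> borel_measurable M"
    and t: "t \<in> T" and s: "\<And>n. s n \<in> T" "s \<longlonglongrightarrow> t"
  obtains r where "\<And>n. n \<le> r n" "AE \<omega> in M. (\<lambda>n. X (s (r n)) \<omega>) \<longlonglongrightarrow> X t \<omega>"
proof -
  interpret finite_measure M by fact
  have [measurable]: "X t \<in> borel_measurable M" "\<And>n. X (s n) \<in> borel_measurable M"
    using X t s by auto
  define e :: "nat \<Rightarrow> real" where "e n = (1/2)^n" for n
  have e_eq: "e = (\<lambda>n. (1/2)^n)" by (simp add: e_def fun_eq_iff)
  have e: "0 < e n" "e \<longlonglongrightarrow> 0" "summable e" for n
    unfolding e_eq by (auto intro!: LIMSEQ_power_zero summable_geometric)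
  have "\<exists>r\<ge>n. measure M {\<omega> \<in> space M. ennreal (e n) < edistance (X (s r) \<omega>) (X t \<omega>)} < e n" for n
  proof -
    let ?f = "\<lambda>u. measure M {\<omega> \<in> space M. ennreal (e n) < edistance (X u \<omega>) (X t \<omega>)}"
    have "continuous (at t within T) ?f"
      using sc t e(1)[of n] by (simp add: stoch_continuous_def continuous_within)
    then have "(?f \<circ> s) \<longlonglongrightarrow> ?f t"
      using s by (simp add: continuous_within_sequentially)
    then have "\<forall>\<^sub>F k in sequentially. ?f (s k) < e n"
      using e(1)[of n] order_tendstoD(2)[of _ "?f t" sequentially "e n"] by (simp add: o_def)
    then obtain N where "\<And>k. k \<ge> N \<Longrightarrow> ?f (s k) < e n"
      by (auto simp: eventually_sequentially)
    then show ?thesis by (intro exI[of _ "max n N"]) auto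
  qed
  then obtain r where r: "\<And>n. n \<le> r n"
    "\<And>n. measure M {\<omega> \<in> space M. ennreal (e n) < edistance (X (s (r n)) \<omega>) (X t \<omega>)} < e n"
    by metis
  let ?A = "\<lambda>n. {\<omega> \<in> space M. ennreal (e n) < edistance (X (s (r n)) \<omega>) (X t \<omega>)}"
  have "AE \<omega> in M. \<forall>\<^sub>F n in sequentially. \<omega> \<in> space M - ?A n"
  proof (rule borel_cantelli_AE1)
    show "summable (\<lambda>n. measure M (?A n))"
      by (rule summable_comparison_test'[OF e(3), of 0]) (simp add: less_imp_le[OF r(2)])
  qed (auto simp: less_top[symmetric])
  then have "AE \<omega> in M. (\<lambda>n. X (s (r n)) \<omega>) \<longlonglongrightarrow> X t \<omega>"
  proof eventually_elim
    case (elim \<omega>)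
    have "(\<lambda>n. ennreal (e n)) \<longlonglongrightarrow> ennreal 0"
      by (intro tendsto_ennrealI e)
    then have l: "(\<lambda>n. ennreal (e n)) \<longlonglongrightarrow> 0" by simp
    have "\<forall>\<^sub>F n in sequentially. edistance (X (s (r n)) \<omega>) (X t \<omega>) \<le> ennreal (e n)"
      using elim by eventually_elim (simp add: not_less)
    then have "(\<lambda>n. edistance (X (s (r n)) \<omega>) (X t \<omega>)) \<longlonglongrightarrow> 0"
      by (intro tendsto_sandwich[OF always_eventually _ tendsto_const l]) auto
    then show ?case by (rule tendsto_of_edistance)
  qed
  then show thesis using r(1) that by blast
qed

text \<open>
  A random factor is bounded by a constant outside an event of small probability.
\<close>

lemma stoch_continuous_scale:
  fixes c :: "'a \<Rightarrow> real"
  assumes M: "finite_measure M" and sc: "stoch_continuous T M X"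
    and X[measurable]: "\<And>t. t \<in> T \<Longrightarrow> X t \<in> borel_measurable M"
    and c[measurable]: "c \<in> borel_measurable M" and c0: "\<And>\<omega>. 0 \<le> c \<omega>"
    and X'[measurable]: "\<And>t. t \<in> T \<Longrightarrow> X' t \<in> borel_measurable M"
    and eq: "AE \<omega> in M. \<forall>t\<in>T. X' t \<omega> = ennreal (c \<omega>) * X t \<omega>"
  shows "stoch_continuous T M X'"
  unfolding stoch_continuous_def
proof (intro ballI allI impI)
  interpret finite_measure M by fact
  fix t and \<epsilon> :: real assume t: "t \<in> T" and \<epsilon>: "0 < \<epsilon>"
  note [measurable] = X[OF t] X'[OF t]
  show "((\<lambda>s. measure M {\<omega> \<in> space M. ennreal \<epsilon> < edistance (X' s \<omega>) (X' t \<omega>)}) \<longlongrightarrow> 0) (at t within T)"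
  proof (rule tendstoI)
    fix \<delta> :: real assume \<delta>: "0 < \<delta>"
    have "(\<lambda>n. measure M {\<omega> \<in> space M. real n < c \<omega>}) \<longlonglongrightarrow> measure M (\<Inter>n. {\<omega> \<in> space M. real n < c \<omega>})"
      by (intro finite_Lim_measure_decseq) (auto simp: decseq_def)
    also have "(\<Inter>n. {\<omega> \<in> space M. real n < c \<omega>}) = {}"
      using reals_Archimedean2 by (auto dest: less_asym)
    finally have "\<forall>\<^sub>F n in sequentially. measure M {\<omega> \<in> space M. real n < c \<omega>} < \<delta> / 2"
      using \<delta> by (intro order_tendstoD(2)) auto
    then obtain n where n: "measure M {\<omega> \<in> space M. real n < c \<omega>} < \<delta> / 2"
      by (auto simp: eventually_sequentially)
    define K where "K = real (Suc n)"
    have K: "0 < K" "measure M {\<omega> \<in> space M. K < c \<omega>} < \<delta> / 2"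
      by (simp add: K_def) (rule le_less_trans[OF finite_measure_mono n], auto simp: K_def)
    let ?B = "\<lambda>s. {\<omega> \<in> space M. ennreal (\<epsilon> / K) < edistance (X s \<omega>) (X t \<omega>)}"
    have "((\<lambda>s. measure M (?B s)) \<longlongrightarrow> 0) (at t within T)"
      using sc t \<epsilon> K unfolding stoch_continuous_def by auto
    then have "\<forall>\<^sub>F s in at t within T. measure M (?B s) < \<delta> / 2"
      using \<delta> by (intro order_tendstoD(2)) auto
    moreover have "\<forall>\<^sub>F s in at t within T. s \<in> T" by (auto simp: eventually_at_filter)
    ultimately show "\<forall>\<^sub>F s in at t within T.
        dist (measure M {\<omega> \<in> space M. ennreal \<epsilon> < edistance (X' s \<omega>) (X' t \<omega>)}) 0 < \<delta>"
    proof eventually_elim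
      case (elim s)
      note [measurable] = X[OF elim(2)] X'[OF elim(2)]
      have "measure M {\<omega> \<in> space M. ennreal \<epsilon> < edistance (X' s \<omega>) (X' t \<omega>)}
          \<le> measure M ({\<omega> \<in> space M. K < c \<omega>} \<union> ?B s)"
      proof (rule finite_measure_mono_AE)
        show "AE \<omega> in M. \<omega> \<in> {\<omega> \<in> space M. ennreal \<epsilon> < edistance (X' s \<omega>) (X' t \<omega>)} \<longrightarrow>
            \<omega> \<in> {\<omega> \<in> space M. K < c \<omega>} \<union> ?B s"
          using eq
        proof eventually_elim
          case e: (elim \<omega>)
          show ?case
          proof (intro impI UnCI)
            assume a: "\<omega> \<in> {\<omega> \<in> space M. ennreal \<epsilon> < edistance (X' s \<omega>) (X' t \<omega>)}"
              and b: "\<omega> \<notin> ?B s"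
            show "\<omega> \<in> {\<omega> \<in> space M. K < c \<omega>}"
            proof (rule ccontr)
              assume "\<omega> \<notin> {\<omega> \<in> space M. K < c \<omega>}"
              then have "c \<omega> \<le> K" using a by auto
              have "edistance (X' s \<omega>) (X' t \<omega>) \<le> ennreal (c \<omega>) * edistance (X s \<omega>) (X t \<omega>)"
                using e t elim(2) edistance_scale[OF c0] by simp
              also have "\<dots> \<le> ennreal K * ennreal (\<epsilon> / K)"
                using \<open>c \<omega> \<le> K\<close> a b by (intro mult_mono) (auto simp: not_less intro: ennreal_leI)
              also have "\<dots> = ennreal \<epsilon>" using K \<epsilon> by (simp add: ennreal_mult[symmetric])
              finally show False using a by (simp add: not_less[symmetric])
            qed
          qed
        qed
      qed measurable
      also have "\<dots> \<le> measure M {\<omega> \<in> space M. K < c \<omega>} + measure M (?B s)"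
        by (intro measure_Un_le) measurable
      also have "\<dots> < \<delta>" using K elim by simp
      finally show ?case by simp
    qed
  qed
qed

section \<open>Paths, shifts and scalings\<close>

locale homogeneous_functional =
  fixes T :: "(real^'l::finite) set"
    and \<kappa> :: "(real^'l \<Rightarrow> real^'d::finite) \<Rightarrow> ennreal"
    and \<alpha> :: real
  assumes index_group: "index_group T" and \<alpha>_pos: "0 < \<alpha>"
    and \<kappa>_hom: "(\<lambda>f. enn2ereal (\<kappa> f)) \<in> hom_maps T \<alpha>"
begin

abbreviation S :: "(real^'l \<Rightarrow> real^'d) measure" where "S \<equiv> path_space T"

text \<open>
  Indexed by the position at which the path is inspected: shifting a path by \<open>h\<close> moves the values by \<open>h\<close>.
\<close>

definition kap :: "real^'l \<Rightarrow> (real^'l \<Rightarrow> real^'d) \<Rightarrow> ennreal" where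
  "kap t f = \<kappa> (shift T (- t) f)"

lemma T_zero: "0 \<in> T" and T_diff: "s \<in> T \<Longrightarrow> t \<in> T \<Longrightarrow> s - t \<in> T"
  using index_group by (auto simp: index_group_def)

lemma T_uminus: "t \<in> T \<Longrightarrow> - t \<in> T"
  using T_diff[OF T_zero] by simp

lemma T_add: "s \<in> T \<Longrightarrow> t \<in> T \<Longrightarrow> s + t \<in> T"
  using T_diff[OF _ T_uminus] by simp

lemma space_S: "space S = extensional T"
  by (simp add: path_space_def space_PiM PiE_UNIV_domain PiE_def)

lemma measurable_S_iff: "V \<in> measurable M S \<longleftrightarrow>
    (\<forall>\<omega>\<in>space M. V \<omega> \<in> extensional T) \<and> (\<forall>t\<in>T. (\<lambda>\<omega>. V \<omega> t) \<in> borel_measurable M)"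
  (is "?l \<longleftrightarrow> ?r")
proof
  assume l: ?l
  have "(\<lambda>\<omega>. V \<omega> t) \<in> borel_measurable M" if "t \<in> T" for t
    using measurable_compose[OF l[unfolded path_space_def] measurable_component_singleton[OF that]] .
  then show ?r using measurable_space[OF l] by (auto simp: space_S)
next
  assume r: ?r
  show ?l unfolding path_space_def
    by (rule measurable_PiM_single') (use r in \<open>auto simp: PiE_def\<close>)
qed

lemma shift_in_S[simp]: "shift T h f \<in> space S"
  by (simp add: space_S shift_def)

lemma fscale_in_S[simp]: "fscale T c f \<in> space S"
  by (simp add: space_S fscale_def)

lemma fdiv_in_S[simp]: "fdiv T f r \<in> space S"
  by (simp add: fdiv_def)

lemma shift_measurable:
  assumes V: "V \<in> measurable M S" and h: "h \<in> T"
  shows "(\<lambda>\<omega>. shift T h (V \<omega>)) \<in> measurable M S"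
  using V h T_diff by (auto simp: measurable_S_iff shift_def)

lemma fscale_measurable:
  assumes V: "V \<in> measurable M S" and c[measurable]: "c \<in> borel_measurable M"
  shows "(\<lambda>\<omega>. fscale T (c \<omega>) (V \<omega>)) \<in> measurable M S"
  unfolding measurable_S_iff
proof (intro conjI ballI)
  fix t assume "t \<in> T"
  then have [measurable]: "(\<lambda>\<omega>. V \<omega> t) \<in> borel_measurable M" using V by (simp add: measurable_S_iff)
  show "(\<lambda>\<omega>. fscale T (c \<omega>) (V \<omega>) t) \<in> borel_measurable M"
    using \<open>t \<in> T\<close> by (simp add: fscale_def)
qed (simp add: fscale_def)

lemma fdiv_measurable:
  assumes V: "V \<in> measurable M S" and c[measurable]: "c \<in> borel_measurable M"
  shows "(\<lambda>\<omega>. fdiv T (V \<omega>) (c \<omega>)) \<in> measurable M S"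
  unfolding fdiv_def by (rule fscale_measurable[OF V]) measurable

lemma shift_shift: "s \<in> T \<Longrightarrow> h \<in> T \<Longrightarrow> shift T s (shift T h f) = shift T (s + h) f"
  using T_diff by (auto simp: shift_def fun_eq_iff diff_diff_eq add.commute)

lemma shift_zero: "f \<in> space S \<Longrightarrow> shift T 0 f = f"
  by (simp add: shift_def space_S extensional_restrict)

lemma shift_fscale: "h \<in> T \<Longrightarrow> shift T h (fscale T c f) = fscale T c (shift T h f)"
  using T_diff by (auto simp: shift_def fscale_def fun_eq_iff)

lemma shift_fdiv: "h \<in> T \<Longrightarrow> shift T h (fdiv T f r) = fdiv T (shift T h f) r"
  by (simp add: fdiv_def shift_fscale)

lemma fscale_fscale: "fscale T a (fscale T b f) = fscale T (a * b) f"
  by (auto simp: fscale_def fun_eq_iff)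

lemma fscale_one: "f \<in> space S \<Longrightarrow> fscale T 1 f = f"
  by (simp add: fscale_def space_S extensional_restrict)

lemma fscale_zero: "fscale T 0 f = fscale T 0 g"
  by (simp add: fscale_def)

lemma \<kappa>_measurable[measurable]: "\<kappa> \<in> borel_measurable S"
proof -
  have [measurable]: "(\<lambda>f. enn2ereal (\<kappa> f)) \<in> borel_measurable S"
    using \<kappa>_hom by (simp add: hom_maps_def maps_def)
  have "(\<lambda>f. e2ennreal (enn2ereal (\<kappa> f))) \<in> borel_measurable S" by measurable
  then show ?thesis by simp
qed

lemma \<kappa>_fscale:
  assumes "0 < c" "f \<in> space S"
  shows "\<kappa> (fscale T c f) = ennreal (c powr \<alpha>) * \<kappa> f"
proof -
  have "enn2ereal (\<kappa> (fscale T c f)) = ereal (c powr \<alpha>) * enn2ereal (\<kappa> f)"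
    using \<kappa>_hom assms by (simp add: hom_maps_def homogeneous_def)
  also have "\<dots> = enn2ereal (ennreal (c powr \<alpha>) * \<kappa> f)"
    by (simp add: times_ennreal.rep_eq)
  finally show ?thesis by (simp add: enn2ereal_inject)
qed

lemma kap_measurable: "V \<in> measurable M S \<Longrightarrow> t \<in> T \<Longrightarrow> (\<lambda>\<omega>. kap t (V \<omega>)) \<in> borel_measurable M"
  unfolding kap_def by (rule measurable_compose[OF shift_measurable \<kappa>_measurable]) (auto intro: T_uminus)

lemma kap_measurable_S[measurable]: "t \<in> T \<Longrightarrow> kap t \<in> borel_measurable S"
  using kap_measurable[OF measurable_ident_sets] by simp

lemma kap_fscale: "0 < c \<Longrightarrow> t \<in> T \<Longrightarrow> kap t (fscale T c f) = ennreal (c powr \<alpha>) * kap t f"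
  by (simp add: kap_def shift_fscale T_uminus \<kappa>_fscale)

text \<open>
  On the zero path the functional is \<open>0\<close> or \<open>\<infinity>\<close> by homogeneity.  Since the value is the same at all
  positions, fields scaled by a factor that may vanish remain jointly measurable.
\<close>

lemma kap_fscale_zero:
  assumes "t \<in> T"
  shows "kap t (fscale T 0 f) = \<kappa> (fscale T 0 g)"
proof -
  have "shift T (- t) (fscale T 0 f) = fscale T 0 g"
    unfolding shift_fscale[OF T_uminus[OF assms]] by (rule fscale_zero)
  then show ?thesis by (simp add: kap_def)
qed

lemma kap_shift: "t \<in> T \<Longrightarrow> h \<in> T \<Longrightarrow> kap t (shift T h f) = kap (t - h) f"
  by (simp add: kap_def shift_shift T_uminus)

lemma kap_zero: "f \<in> space S \<Longrightarrow> kap 0 f = \<kappa> f"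
  by (simp add: kap_def shift_zero)

text \<open>Scaling a path to the level set on which a given value of the functional becomes one.\<close>

abbreviation normalize :: "(real^'l \<Rightarrow> real^'d) \<Rightarrow> ennreal \<Rightarrow> (real^'l \<Rightarrow> real^'d)" where
  "normalize f v \<equiv> fdiv T f (epowr v (1 / \<alpha>))"

lemma normalize_measurable:
  "V \<in> measurable M S \<Longrightarrow> v \<in> borel_measurable M \<Longrightarrow> (\<lambda>\<omega>. normalize (V \<omega>) (v \<omega>)) \<in> measurable M S"
  by (rule fdiv_measurable) auto

lemma normalize_eq_fscale:
  assumes "0 < v" "v < \<infinity>"
  obtains c where "0 < c" "ennreal (c powr \<alpha>) * v = 1" "\<And>f. normalize f v = fscale T c f"
    "v = ennreal (enn2real v)" "c = enn2real v powr (- (1 / \<alpha>))"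
proof -
  obtain r where r: "0 < r" "v = ennreal r" using assms by (cases v) auto
  show thesis
  proof (rule that[of "r powr (- (1 / \<alpha>))"])
    have "(r powr (- (1 / \<alpha>))) powr \<alpha> = 1 / r"
      using \<alpha>_pos r by (simp only: powr_powr) (simp add: powr_minus_divide)
    then show "ennreal ((r powr (- (1 / \<alpha>))) powr \<alpha>) * v = 1"
      using r by (simp add: ennreal_mult[symmetric])
    show "normalize f v = fscale T (r powr (- (1 / \<alpha>))) f" for f
      using r by (simp add: fdiv_def epowr_ennreal powr_minus_divide)
  qed (use r in auto)
qed

lemma normalize_fscale:
  assumes "0 < c"
  shows "normalize (fscale T c f) (ennreal (c powr \<alpha>) * v) = normalize f v"
proof -
  have "enn2real (ennreal ((c powr \<alpha>) powr (1 / \<alpha>))) = c"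
    using assms \<alpha>_pos by (simp add: powr_powr)
  then show ?thesis
    using assms by (simp add: fdiv_def epowr_mult enn2real_mult fscale_fscale)
qed

lemma normalize_one: "f \<in> space S \<Longrightarrow> normalize f 1 = f"
  using epowr_ennreal[of 1 "1 / \<alpha>"] by (simp add: fdiv_def fscale_one)

subsection \<open>The index set\<close>

lemma countable_rat_points: "countable (rat_points T)"
proof -
  have "rat_points T \<subseteq> (\<lambda>f. \<chi> i. f i) ` (PiE UNIV (\<lambda>_. \<rat>) :: ('l \<Rightarrow> real) set)"
  proof
    fix t assume "t \<in> rat_points T"
    then have "t = (\<chi> i. (\<lambda>i. t $ i) i)" "(\<lambda>i. t $ i) \<in> PiE UNIV (\<lambda>_. \<rat>)"
      by (auto simp: rat_points_def)
    then show "t \<in> (\<lambda>f. \<chi> i. f i) ` (PiE UNIV (\<lambda>_. \<rat>))" by blast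
  qed
  moreover have "countable (PiE UNIV (\<lambda>_. \<rat>) :: ('l \<Rightarrow> real) set)"
    by (intro countable_PiE) (auto simp: countable_rat)
  ultimately show ?thesis by (meson countable_image countable_subset)
qed

lemma rat_points_subset: "t \<in> rat_points T \<Longrightarrow> t \<in> T"
  by (simp add: rat_points_def)

lemma rat_points_discrete: "T \<noteq> UNIV \<Longrightarrow> rat_points T = T"
  using index_group Ints_subset_Rats by (auto simp: rat_points_def index_group_def)

lemma rat_points_diff: "s \<in> rat_points T \<Longrightarrow> t \<in> rat_points T \<Longrightarrow> s - t \<in> rat_points T"
  by (auto simp: rat_points_def T_diff)

lemma rat_points_zero: "0 \<in> rat_points T"
  by (auto simp: rat_points_def T_zero)

lemma rat_points_uminus: "t \<in> rat_points T \<Longrightarrow> - t \<in> rat_points T"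
  using rat_points_diff[OF rat_points_zero] by simp

lemma rat_points_add: "s \<in> rat_points T \<Longrightarrow> t \<in> rat_points T \<Longrightarrow> s + t \<in> rat_points T"
  using rat_points_diff[OF _ rat_points_uminus] by simp

lemma rat_points_dense:
  assumes "t \<in> T"
  obtains s where "\<And>n. s n \<in> rat_points T" "s \<longlonglongrightarrow> t"
proof (cases "T = UNIV")
  case True
  have "\<exists>r\<in>\<rat>. \<bar>r - t $ i\<bar> < 1 / Suc n" for i and n :: nat
    using Rats_dense_in_real[of "t $ i - 1 / Suc n" "t $ i + 1 / Suc n"]
    by (force simp: abs_less_iff)
  then obtain r where r: "\<And>i n. r i n \<in> \<rat>" "\<And>i n. \<bar>r i n - t $ i\<bar> < 1 / Suc n" by metis
  show thesis
  proof (rule that[of "\<lambda>n. \<chi> i. r i n"])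
    show "(\<chi> i. r i n) \<in> rat_points T" for n using True r by (simp add: rat_points_def)
    have "(\<lambda>n. r i n) \<longlonglongrightarrow> t $ i" for i
    proof (rule Lim_transform[OF tendsto_const])
      have "\<forall>\<^sub>F n in sequentially. norm (r i n - t $ i) \<le> 1 / real (Suc n)"
        using r(2)[of i] by (intro always_eventually allI) (simp add: less_imp_le del: of_nat_Suc)
      then show "(\<lambda>n. r i n - t $ i) \<longlonglongrightarrow> 0"
        by (rule Lim_null_comparison) (rule lim_1_over_n[THEN LIMSEQ_Suc])
    qed
    then show "(\<lambda>n. \<chi> i. r i n) \<longlonglongrightarrow> t" by (intro vec_tendstoI) simp
  qed
next
  case False
  then show thesis using that[of "\<lambda>_. t"] assms rat_points_discrete by auto
qed

lemma countable_T: "T \<noteq> UNIV \<Longrightarrow> countable T"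
  using countable_rat_points rat_points_discrete by simp

lemma space_index_measure[simp]: "space (index_measure T) = T"
  by (simp add: index_measure_def)

lemma sigma_finite_index_measure: "sigma_finite_measure (index_measure T)"
proof (cases "T = UNIV")
  case True
  have "sigma_finite_measure (completion lborel :: (real^'l) measure)"
  proof -
    obtain A :: "(real^'l) set set" where A: "countable A" "A \<subseteq> sets lborel" "\<Union>A = space lborel"
      "\<forall>a\<in>A. emeasure lborel a \<noteq> \<infinity>"
      using sigma_finite_measure.sigma_finite_countable[OF sigma_finite_lborel] by blast
    then show ?thesis
      by (intro sigma_finite_measure.intro exI[of _ A]) (auto simp: emeasure_completion)
  qed
  then show ?thesis using True by (simp add: index_measure_def)
qed (simp add: index_measure_def countable_T sigma_finite_measure_count_space_countable)

lemma index_measure_ident: "(\<lambda>t. t) \<in> measurable (index_measure T) (restrict_space borel T)"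
  by (cases "T = UNIV")
     (auto simp: index_measure_def measurable_restrict_space2_iff intro!: measurable_completion)

subsection \<open>Jointly measurable fields\<close>

text \<open>
  The measurability requirements on a random field, on an arbitrary measure space.
\<close>

definition kfield :: "'m measure \<Rightarrow> ('m \<Rightarrow> real^'l \<Rightarrow> real^'d) \<Rightarrow> bool" where
  "kfield M V \<longleftrightarrow> V \<in> measurable M S \<and>
     (\<lambda>(t, \<omega>). kap t (V \<omega>)) \<in> borel_measurable (restrict_space borel T \<Otimes>\<^sub>M M)"

lemma kfield_measurable: "kfield M V \<Longrightarrow> V \<in> measurable M S"
  by (simp add: kfield_def)

lemma kfield_joint:
  "kfield M V \<Longrightarrow> (\<lambda>(t, \<omega>). kap t (V \<omega>)) \<in> borel_measurable (restrict_space borel T \<Otimes>\<^sub>M M)"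
  by (simp add: kfield_def)

lemma kfield_index_measurable:
  assumes "kfield M V"
  shows "(\<lambda>(t, \<omega>). kap t (V \<omega>)) \<in> borel_measurable (index_measure T \<Otimes>\<^sub>M M)"
proof -
  have "(\<lambda>x. (fst x, snd x)) \<in> measurable (index_measure T \<Otimes>\<^sub>M M) (restrict_space borel T \<Otimes>\<^sub>M M)"
    by (intro measurable_Pair measurable_compose[OF measurable_fst index_measure_ident] measurable_snd)
  from measurable_compose[OF this kfield_joint[OF assms]] show ?thesis by (simp add: split_beta')
qed

lemma kfield_compose:
  assumes "kfield M V" and g: "g \<in> measurable M' M"
  shows "kfield M' (\<lambda>\<omega>. V (g \<omega>))"
proof -
  have "(\<lambda>x. (fst x, g (snd x))) \<in> measurable (restrict_space borel T \<Otimes>\<^sub>M M') (restrict_space borel T \<Otimes>\<^sub>M M)"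
    by (intro measurable_Pair measurable_fst measurable_compose[OF measurable_snd g])
  from measurable_compose[OF this kfield_joint[OF assms(1)]] show ?thesis
    using measurable_compose[OF g kfield_measurable[OF assms(1)]] by (simp add: kfield_def split_beta')
qed

lemma kfield_density: "kfield M V \<Longrightarrow> kfield (density M p) V"
  by (rule kfield_compose[where g = "\<lambda>x. x"]) (auto simp: measurable_ident_sets)

lemma kfield_shift:
  assumes V: "kfield M V" and h: "h \<in> T"
  shows "kfield M (\<lambda>\<omega>. shift T h (V \<omega>))"
proof -
  have "(\<lambda>x. (fst x - h, snd x)) \<in> measurable (restrict_space borel T \<Otimes>\<^sub>M M) (restrict_space borel T \<Otimes>\<^sub>M M)"
  proof (intro measurable_Pair measurable_snd measurable_compose[OF measurable_fst])
    show "(\<lambda>x. x - h) \<in> measurable (restrict_space borel T) (restrict_space borel T)"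
      using T_diff[OF _ h]
      by (intro measurable_restrict_space2 measurable_restrict_space1) (auto simp: space_restrict_space)
  qed
  from measurable_compose[OF this kfield_joint[OF V]]
  have "(\<lambda>x. kap (fst x - h) (V (snd x))) \<in> borel_measurable (restrict_space borel T \<Otimes>\<^sub>M M)"
    by (simp add: split_beta')
  also have "?this \<longleftrightarrow> (\<lambda>x. kap (fst x) (shift T h (V (snd x)))) \<in> borel_measurable (restrict_space borel T \<Otimes>\<^sub>M M)"
    using h by (intro measurable_cong) (auto simp: space_pair_measure space_restrict_space kap_shift)
  finally show ?thesis using V h by (auto simp: kfield_def split_beta' shift_measurable)
qed

lemma kfield_fscale:
  assumes V: "kfield M V" and c[measurable]: "c \<in> borel_measurable M" and c0: "\<And>\<omega>. 0 \<le> c \<omega>"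
  shows "kfield M (\<lambda>\<omega>. fscale T (c \<omega>) (V \<omega>))"
proof -
  have [measurable]: "(\<lambda>x. kap (fst x) (V (snd x))) \<in> borel_measurable (restrict_space borel T \<Otimes>\<^sub>M M)"
    using V by (simp add: kfield_def split_beta')
  have "(\<lambda>x. if 0 < c (snd x) then ennreal (c (snd x) powr \<alpha>) * kap (fst x) (V (snd x))
            else \<kappa> (fscale T 0 undefined)) \<in> borel_measurable (restrict_space borel T \<Otimes>\<^sub>M M)"
    by measurable
  also have "?this \<longleftrightarrow> (\<lambda>x. kap (fst x) (fscale T (c (snd x)) (V (snd x)))) \<in> borel_measurable (restrict_space borel T \<Otimes>\<^sub>M M)"
  proof (intro measurable_cong)
    fix x assume "x \<in> space (restrict_space borel T \<Otimes>\<^sub>M M)"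
    then have "fst x \<in> T" by (auto simp: space_pair_measure space_restrict_space)
    then show "(if 0 < c (snd x) then ennreal (c (snd x) powr \<alpha>) * kap (fst x) (V (snd x))
            else \<kappa> (fscale T 0 undefined)) = kap (fst x) (fscale T (c (snd x)) (V (snd x)))"
      using c0[of "snd x"] kap_fscale_zero[OF \<open>fst x \<in> T\<close>, of "V (snd x)" undefined]
      by (auto simp: kap_fscale not_less dest: antisym)
  qed
  finally show ?thesis using V by (auto simp: kfield_def split_beta' fscale_measurable)
qed

lemma kfield_fdiv:
  assumes V: "kfield M V" and c[measurable]: "c \<in> borel_measurable M"
  shows "kfield M (\<lambda>\<omega>. fdiv T (V \<omega>) (c \<omega>))"
  unfolding fdiv_def by (rule kfield_fscale[OF V]) auto

end

section \<open>Stability of the class of random fields\<close>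

context homogeneous_functional
begin

definition separable_path :: "(real^'l \<Rightarrow> ennreal) \<Rightarrow> bool" where
  "separable_path x \<longleftrightarrow> (\<forall>t\<in>T. \<forall>U. open U \<and> t \<in> U \<longrightarrow> x t \<in> closure (x ` (U \<inter> rat_points T)))"

lemma separable_pathD:
  "separable_path x \<Longrightarrow> t \<in> T \<Longrightarrow> open U \<Longrightarrow> t \<in> U \<Longrightarrow> x t \<in> closure (x ` (U \<inter> rat_points T))"
  by (simp add: separable_path_def)

lemma separable_path_cong:
  assumes "\<And>t. t \<in> T \<Longrightarrow> x t = y t"
  shows "separable_path x \<longleftrightarrow> separable_path y"
proof -
  have "x ` (U \<inter> rat_points T) = y ` (U \<inter> rat_points T)" for U
    using assms rat_points_subset by (intro image_cong) auto
  then show ?thesis using assms by (simp add: separable_path_def)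
qed

lemma separable_path_uminus:
  assumes "separable_path x"
  shows "separable_path (\<lambda>t. x (- t))"
  unfolding separable_path_def
proof (intro ballI allI impI, elim conjE)
  fix t U assume t: "t \<in> T" "open U" "t \<in> U"
  have "(\<lambda>t. x (- t)) ` (U \<inter> rat_points T) = x ` ((uminus ` U) \<inter> rat_points T)"
    using rat_points_uminus by (force simp: image_iff)
  moreover have "x (- t) \<in> closure (x ` ((uminus ` U) \<inter> rat_points T))"
    using t T_uminus by (intro separable_pathD assms open_negations) auto
  ultimately show "x (- t) \<in> closure ((\<lambda>t. x (- t)) ` (U \<inter> rat_points T))" by simp
qed

lemma separable_path_translate:
  assumes "separable_path x" and n: "n \<in> rat_points T"
  shows "separable_path (\<lambda>t. x (t - n))"
  unfolding separable_path_def
proof (intro ballI allI impI, elim conjE)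
  fix t U assume t: "t \<in> T" "open U" "t \<in> U"
  let ?U = "(\<lambda>s. s - n) ` U"
  have "(\<lambda>t. x (t - n)) ` (U \<inter> rat_points T) = x ` (?U \<inter> rat_points T)"
  proof -
    have "(\<lambda>s. s - n) ` (U \<inter> rat_points T) = ?U \<inter> rat_points T"
      using rat_points_diff[OF _ n] rat_points_add[OF _ n] by (force simp: image_iff)
    then show ?thesis by (metis image_image)
  qed
  moreover have "open ?U" using open_translation_subtract[of U n] t by simp
  then have "x (t - n) \<in> closure (x ` (?U \<inter> rat_points T))"
    using t T_diff rat_points_subset[OF n] by (intro separable_pathD assms) auto
  ultimately show "x (t - n) \<in> closure ((\<lambda>t. x (t - n)) ` (U \<inter> rat_points T))" by simp
qed

lemma separable_path_scale:
  assumes "separable_path x"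
  shows "separable_path (\<lambda>t. ennreal c * x t)"
  unfolding separable_path_def
proof (intro ballI allI impI, elim conjE)
  fix t U assume t: "t \<in> T" "open U" "t \<in> U"
  let ?A = "x ` (U \<inter> rat_points T)"
  have c: "continuous_on UNIV (\<lambda>y. ennreal c * y)"
    by (auto simp: continuous_on_def intro!: ennreal_tendsto_cmult tendsto_ident_at)
  have "(\<lambda>y. ennreal c * y) ` closure ?A \<subseteq> closure ((\<lambda>y. ennreal c * y) ` ?A)"
    by (rule image_closure_subset[OF continuous_on_subset[OF c]]) (auto simp: closure_subset)
  then show "ennreal c * x t \<in> closure ((\<lambda>t. ennreal c * x t) ` (U \<inter> rat_points T))"
    using separable_pathD[OF assms t] by (auto simp: image_image)
qed

lemma random_field_iff:
  "random_field T \<kappa> M V \<longleftrightarrow> prob_space M \<and> complete_measure M \<and> kfield M V \<and>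
     stoch_continuous T M (\<lambda>t \<omega>. kap t (V \<omega>)) \<and> (AE \<omega> in M. separable_path (\<lambda>t. kap t (V \<omega>)))"
proof -
  have neg: "(\<lambda>x. (- fst x, snd x)) \<in> measurable (restrict_space borel T \<Otimes>\<^sub>M M) (restrict_space borel T \<Otimes>\<^sub>M M)"
    by (intro measurable_Pair measurable_snd measurable_compose[OF measurable_fst]
          measurable_restrict_space2 measurable_restrict_space1)
       (auto simp: space_restrict_space T_uminus)
  have joint: "(\<lambda>(t, \<omega>). \<kappa> (shift T t (V \<omega>))) \<in> borel_measurable (restrict_space borel T \<Otimes>\<^sub>M M) \<longleftrightarrow>
     (\<lambda>(t, \<omega>). kap t (V \<omega>)) \<in> borel_measurable (restrict_space borel T \<Otimes>\<^sub>M M)" (is "?a \<longleftrightarrow> ?b")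
  proof
    assume ?a from measurable_compose[OF neg this] show ?b by (simp add: kap_def split_beta')
  next
    assume ?b from measurable_compose[OF neg this] show ?a by (simp add: kap_def split_beta')
  qed
  have sep: "separable_with (rat_points T) T M (\<lambda>t \<omega>. \<kappa> (shift T t (V \<omega>))) \<longleftrightarrow>
      (AE \<omega> in M. separable_path (\<lambda>t. kap t (V \<omega>)))"
  proof -
    have "separable_path (\<lambda>t. \<kappa> (shift T t (V \<omega>))) \<longleftrightarrow> separable_path (\<lambda>t. kap t (V \<omega>))" (is "?c \<longleftrightarrow> ?d") for \<omega>
    proof
      assume ?c from separable_path_uminus[OF this] show ?d by (simp add: kap_def)
    next
      assume ?d from separable_path_uminus[OF this] show ?c by (simp add: kap_def)
    qed
    then show ?thesis unfolding separable_with_def separable_path_def by simp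
  qed
  show ?thesis
    unfolding random_field_def kfield_def joint sep unfolding kap_def by (simp only: conj_assoc) (simp only: conj_ac)
qed

lemma random_fieldD:
  assumes "random_field T \<kappa> M V"
  shows "prob_space M" "complete_measure M" "kfield M V" "stoch_continuous T M (\<lambda>t \<omega>. kap t (V \<omega>))"
    "AE \<omega> in M. separable_path (\<lambda>t. kap t (V \<omega>))" "V \<in> measurable M S"
  using assms unfolding random_field_iff kfield_def by simp_all

lemma random_field_subsequence:
  assumes V: "random_field T \<kappa> M V" and t: "t \<in> T" and s: "\<And>n. s n \<in> T" "s \<longlonglongrightarrow> t"
  shows "\<exists>r. (\<forall>n. n \<le> r n) \<and> (AE \<omega> in M. (\<lambda>n. kap (s (r n)) (V \<omega>)) \<longlonglongrightarrow> kap t (V \<omega>))"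
proof -
  note V' = random_fieldD[OF V]
  interpret prob_space M by (rule V'(1))
  show ?thesis
  proof (rule stoch_continuous_subsequence[OF finite_measure_axioms V'(4) kap_measurable[OF V'(6)] t s])
    fix r assume "\<And>n. n \<le> r n" "AE \<omega> in M. (\<lambda>n. kap (s (r n)) (V \<omega>)) \<longlonglongrightarrow> kap t (V \<omega>)"
    then show ?thesis by (intro exI[of _ r] conjI allI)
  qed
qed

lemma random_field_fscale:
  assumes V: "random_field T \<kappa> M V" and c[measurable]: "c \<in> borel_measurable M"
    and c0: "\<And>\<omega>. 0 \<le> c \<omega>" and c1: "AE \<omega> in M. 0 < c \<omega>"
  shows "random_field T \<kappa> M (\<lambda>\<omega>. fscale T (c \<omega>) (V \<omega>))"
proof -
  note V' = random_fieldD[OF V]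
  interpret prob_space M by (rule V'(1))
  have kf: "kfield M (\<lambda>\<omega>. fscale T (c \<omega>) (V \<omega>))" by (rule kfield_fscale[OF V'(3) c c0])
  have eq: "AE \<omega> in M. \<forall>t\<in>T. kap t (fscale T (c \<omega>) (V \<omega>)) = ennreal (c \<omega> powr \<alpha>) * kap t (V \<omega>)"
    using c1 by eventually_elim (simp add: kap_fscale)
  have "stoch_continuous T M (\<lambda>t \<omega>. kap t (fscale T (c \<omega>) (V \<omega>)))"
    by (rule stoch_continuous_scale[OF finite_measure_axioms V'(4) kap_measurable[OF V'(6)] _ _
          kap_measurable[OF kfield_measurable[OF kf]] eq]) auto
  moreover have "AE \<omega> in M. separable_path (\<lambda>t. kap t (fscale T (c \<omega>) (V \<omega>)))"
    using eq V'(5)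
  proof eventually_elim
    case (elim \<omega>)
    have "separable_path (\<lambda>t. ennreal (c \<omega> powr \<alpha>) * kap t (V \<omega>))"
      by (rule separable_path_scale) fact
    also have "?this \<longleftrightarrow> separable_path (\<lambda>t. kap t (fscale T (c \<omega>) (V \<omega>)))"
      using elim by (intro separable_path_cong) auto
    finally show ?case .
  qed
  ultimately show ?thesis using V' kf by (simp add: random_field_iff)
qed

text \<open>
  The point is separability: the shifted separant need not consist of rational points.  By stochastic
  continuity, each value at a rational point is almost surely a limit of values at points of any other
  dense set, so closures over the shifted separant contain all values at rational points and hence all
  values.
\<close>

lemma random_field_shift:
  assumes V: "random_field T \<kappa> M V" and h: "h \<in> T"
  shows "random_field T \<kappa> M (\<lambda>\<omega>. shift T h (V \<omega>))"
proof -
  note V' = random_fieldD[OF V]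
  interpret prob_space M by (rule V'(1))
  have "stoch_continuous T M (\<lambda>t \<omega>. kap t (shift T h (V \<omega>)))"
    unfolding stoch_continuous_def
  proof (intro ballI allI impI)
    fix t and \<epsilon> :: real assume t: "t \<in> T" and \<epsilon>: "0 < \<epsilon>"
    have "((\<lambda>s. measure M {\<omega> \<in> space M. ennreal \<epsilon> < edistance (kap s (V \<omega>)) (kap (t - h) (V \<omega>))}) \<longlongrightarrow> 0)
        (at (t - h) within T)"
      using V'(4) T_diff[OF t h] \<epsilon> by (auto simp: stoch_continuous_def)
    moreover have "filterlim (\<lambda>s. s - h) (at (t - h) within T) (at t within T)"
      unfolding filterlim_at
      by (auto simp: eventually_at_filter T_diff h intro!: tendsto_intros)
    ultimately have "((\<lambda>s. measure M {\<omega> \<in> space M. ennreal \<epsilon> < edistance (kap (s - h) (V \<omega>)) (kap (t - h) (V \<omega>))}) \<longlongrightarrow> 0)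
        (at t within T)"
      by (rule filterlim_compose)
    also have "?this \<longleftrightarrow> ((\<lambda>s. measure M {\<omega> \<in> space M. ennreal \<epsilon> < edistance (kap s (shift T h (V \<omega>))) (kap t (shift T h (V \<omega>)))}) \<longlongrightarrow> 0)
        (at t within T)"
      using t h by (intro filterlim_cong refl) (auto simp: eventually_at_filter kap_shift)
    finally show "((\<lambda>s. measure M {\<omega> \<in> space M. ennreal \<epsilon> < edistance (kap s (shift T h (V \<omega>))) (kap t (shift T h (V \<omega>)))}) \<longlongrightarrow> 0)
        (at t within T)" .
  qed
  moreover have "AE \<omega> in M. \<forall>r\<in>rat_points T. \<forall>U. open U \<and> r \<in> U \<longrightarrow>
      kap r (V \<omega>) \<in> closure ((\<lambda>s. kap (s - h) (V \<omega>)) ` {s \<in> rat_points T. s - h \<in> U})"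
  proof (rule AE_ball_countable[THEN iffD2, OF countable_rat_points], intro ballI)
    fix r assume r: "r \<in> rat_points T"
    obtain s where s: "\<And>n. s n \<in> rat_points T" "s \<longlonglongrightarrow> r + h"
      using rat_points_dense[OF T_add[OF rat_points_subset[OF r] h]] by blast
    have "(\<lambda>n. s n - h) \<longlonglongrightarrow> r" using tendsto_diff[OF s(2) tendsto_const[of h]] by simp
    then obtain k where k: "\<And>n. n \<le> k n" "AE \<omega> in M. (\<lambda>n. kap (s (k n) - h) (V \<omega>)) \<longlonglongrightarrow> kap r (V \<omega>)"
      using random_field_subsequence[OF V rat_points_subset[OF r], of "\<lambda>n. s n - h"]
        T_diff[OF rat_points_subset[OF s(1)] h] by blast
    from k(2) show "AE \<omega> in M. \<forall>U. open U \<and> r \<in> U \<longrightarrow>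
      kap r (V \<omega>) \<in> closure ((\<lambda>s. kap (s - h) (V \<omega>)) ` {s \<in> rat_points T. s - h \<in> U})"
    proof eventually_elim
      case (elim \<omega>)
      show ?case
      proof (intro allI impI, elim conjE)
        fix U assume U: "open U" "r \<in> U"
        have "\<forall>\<^sub>F n in sequentially. s n - h \<in> U"
          using topological_tendstoD[OF \<open>(\<lambda>n. s n - h) \<longlonglongrightarrow> r\<close> U] .
        then obtain N where N: "\<And>n. n \<ge> N \<Longrightarrow> s n - h \<in> U" by (auto simp: eventually_sequentially)
        have "\<forall>\<^sub>F n in sequentially. kap (s (k n) - h) (V \<omega>) \<in> closure ((\<lambda>s. kap (s - h) (V \<omega>)) ` {s \<in> rat_points T. s - h \<in> U})"
          unfolding eventually_sequentially
        proof (intro exI[of _ N] allI impI)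
          fix n assume "N \<le> n"
          then have "s (k n) - h \<in> U" using N[of "k n"] k(1)[of n] by simp
          then show "kap (s (k n) - h) (V \<omega>) \<in> closure ((\<lambda>s. kap (s - h) (V \<omega>)) ` {s \<in> rat_points T. s - h \<in> U})"
            using s(1) by (intro closure_subset[THEN subsetD]) auto
        qed
        then show "kap r (V \<omega>) \<in> closure ((\<lambda>s. kap (s - h) (V \<omega>)) ` {s \<in> rat_points T. s - h \<in> U})"
          by (rule Lim_in_closed_set[OF closed_closure _ sequentially_bot elim])
      qed
    qed
  qed
  with V'(5) have "AE \<omega> in M. separable_path (\<lambda>t. kap t (shift T h (V \<omega>)))"
  proof eventually_elim
    case (elim \<omega>)
    show ?case unfolding separable_path_def
    proof (intro ballI allI impI, elim conjE)
      fix t U assume t: "t \<in> T" "open U" "t \<in> U"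
      let ?U = "(\<lambda>s. s - h) ` U"
      have oU: "open ?U" using open_translation_subtract[of U h] t by simp
      have "kap (t - h) (V \<omega>) \<in> closure ((\<lambda>s. kap s (V \<omega>)) ` (?U \<inter> rat_points T))"
        using t oU by (intro separable_pathD[OF elim(1)]) (auto simp: T_diff h)
      also have "\<dots> \<subseteq> closure ((\<lambda>s. kap (s - h) (V \<omega>)) ` {s \<in> rat_points T. s - h \<in> ?U})"
        using elim(2) oU by (intro closure_minimal) auto
      also have "(\<lambda>s. kap (s - h) (V \<omega>)) ` {s \<in> rat_points T. s - h \<in> ?U}
          = (\<lambda>s. kap s (shift T h (V \<omega>))) ` (U \<inter> rat_points T)"
        using rat_points_subset h by (force simp: image_iff kap_shift)
      finally show "kap t (shift T h (V \<omega>)) \<in> closure ((\<lambda>s. kap s (shift T h (V \<omega>))) ` (U \<inter> rat_points T))"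
        using t h by (simp add: kap_shift)
    qed
  qed
  ultimately show ?thesis using V' h by (simp add: random_field_iff kfield_shift)
qed

lemma kfield_random_shift:
  assumes V: "kfield M V" and sets: "sets K = sets (count_space (rat_points T))"
  shows "kfield (M \<Otimes>\<^sub>M K) (\<lambda>(\<omega>, n). shift T n (V \<omega>))"
proof -
  have sh: "(\<lambda>x. shift T n (V (fst x))) \<in> measurable (M \<Otimes>\<^sub>M K) S" if "n \<in> rat_points T" for n
    using shift_measurable[OF kfield_measurable[OF V] rat_points_subset[OF that]] by measurable
  have snd: "snd \<in> measurable (M \<Otimes>\<^sub>M K) (count_space (rat_points T))"
    using measurable_snd measurable_cong_sets[OF refl sets] by blast
  have "(\<lambda>x. shift T (snd x) (V (fst x))) \<in> measurable (M \<Otimes>\<^sub>M K) S"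
    by (rule measurable_compose_countable'[OF sh snd countable_rat_points])
  moreover have "(\<lambda>x. kap (fst x) (shift T (snd (snd x)) (V (fst (snd x)))))
      \<in> borel_measurable (restrict_space borel T \<Otimes>\<^sub>M (M \<Otimes>\<^sub>M K))"
  proof (rule measurable_compose_countable'[where g = "\<lambda>x. snd (snd x)", OF _ _ countable_rat_points])
    fix n assume n: "n \<in> rat_points T"
    have "kfield (M \<Otimes>\<^sub>M K) (\<lambda>x. shift T n (V (fst x)))"
      by (rule kfield_compose[OF kfield_shift[OF V rat_points_subset[OF n]]]) simp
    from kfield_joint[OF this]
    show "(\<lambda>x. kap (fst x) (shift T n (V (fst (snd x))))) \<in> borel_measurable (restrict_space borel T \<Otimes>\<^sub>M (M \<Otimes>\<^sub>M K))"
      by (simp add: split_beta')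
  next
    show "(\<lambda>x. snd (snd x)) \<in> measurable (restrict_space borel T \<Otimes>\<^sub>M (M \<Otimes>\<^sub>M K)) (count_space (rat_points T))"
      by (rule measurable_compose[OF measurable_snd snd])
  qed
  ultimately show ?thesis by (simp add: kfield_def split_beta')
qed

text \<open>
  Rational shifts preserve the separant, and stochastic continuity passes to the mixture of countably many
  shifts by dominated convergence.
\<close>

lemma random_field_random_shift:
  assumes V: "random_field T \<kappa> M V" and sets: "sets K = sets (count_space (rat_points T))"
    and K: "prob_space K"
  shows "random_field T \<kappa> (completion (M \<Otimes>\<^sub>M K)) (\<lambda>(\<omega>, n). shift T n (V \<omega>))"
proof -
  note V' = random_fieldD[OF V]
  interpret M: prob_space M by (rule V'(1))
  interpret K: prob_space K by (rule K)
  interpret P: pair_prob_space M K ..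
  let ?N = "M \<Otimes>\<^sub>M K"
  let ?U = "\<lambda>(\<omega>, n). shift T n (V \<omega>)"
  have spK: "space K = rat_points T" using sets_eq_imp_space_eq[OF sets] by simp
  have kf: "kfield ?N ?U" by (rule kfield_random_shift[OF V'(3) sets])
  have kfc: "kfield (completion ?N) ?U"
    using kfield_compose[OF kf, of "\<lambda>x. x" "completion ?N"] measurable_completion[OF measurable_ident, of ?N]
    by (simp add: id_def)
  have "stoch_continuous T (completion ?N) (\<lambda>t x. kap t (?U x))"
    unfolding stoch_continuous_def
  proof (intro ballI allI impI)
    fix t and \<epsilon> :: real assume t: "t \<in> T" and \<epsilon>: "0 < \<epsilon>"
    let ?f = "\<lambda>s. measure (completion ?N) {x \<in> space (completion ?N). ennreal \<epsilon> < edistance (kap s (?U x)) (kap t (?U x))}"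
    let ?g = "\<lambda>s n. emeasure M {\<omega> \<in> space M. ennreal \<epsilon> < edistance (kap (s - n) (V \<omega>)) (kap (t - n) (V \<omega>))}"
    have eq: "ennreal (?f s) = (\<integral>\<^sup>+n. ?g s n \<partial>K)" if s: "s \<in> T" for s
    proof -
      note [measurable] = kap_measurable[OF kfield_measurable[OF kf] s] kap_measurable[OF kfield_measurable[OF kf] t]
      let ?A = "{x \<in> space ?N. ennreal \<epsilon> < edistance (kap s (?U x)) (kap t (?U x))}"
      have A: "?A \<in> sets ?N" by measurable
      have "?f s = measure ?N ?A"
        using A by (simp add: measure_def emeasure_completion)
      then have "ennreal (?f s) = emeasure ?N ?A" by (simp add: P.emeasure_eq_measure)
      also have "\<dots> = (\<integral>\<^sup>+n. emeasure M ((\<lambda>\<omega>. (\<omega>, n)) -` ?A) \<partial>K)"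
        by (rule P.emeasure_pair_measure_alt2[OF A])
      also have "\<dots> = (\<integral>\<^sup>+n. ?g s n \<partial>K)"
      proof (intro nn_integral_cong arg_cong2[where f=emeasure] refl)
        fix n assume "n \<in> space K"
        then have "n \<in> T" using spK rat_points_subset by auto
        then show "(\<lambda>\<omega>. (\<omega>, n)) -` ?A = {\<omega> \<in> space M. ennreal \<epsilon> < edistance (kap (s - n) (V \<omega>)) (kap (t - n) (V \<omega>))}"
          using \<open>n \<in> space K\<close> s t by (auto simp: space_pair_measure kap_shift)
      qed
      finally show ?thesis .
    qed
    have K_meas: "f \<in> borel_measurable K" for f :: "real^'l \<Rightarrow> ennreal"
      unfolding measurable_cong_sets[OF sets refl] by simp
    show "(?f \<longlongrightarrow> 0) (at t within T)"
      unfolding tendsto_at_iff_sequentially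
    proof (intro allI impI)
      fix s assume s: "\<forall>i. s i \<in> T - {t}" "s \<longlonglongrightarrow> t"
      have "(\<lambda>i. \<integral>\<^sup>+n. ?g (s i) n \<partial>K) \<longlonglongrightarrow> (\<integral>\<^sup>+n. 0 \<partial>K)"
      proof (rule nn_integral_dominated_convergence[where w = "\<lambda>_. 1"])
        show "AE n in K. (\<lambda>i. ?g (s i) n) \<longlonglongrightarrow> 0"
        proof (intro AE_I2)
          fix n assume "n \<in> space K"
          then have n: "n \<in> T" using spK rat_points_subset by auto
          have "((\<lambda>s. measure M {\<omega> \<in> space M. ennreal \<epsilon> < edistance (kap s (V \<omega>)) (kap (t - n) (V \<omega>))}) \<longlongrightarrow> 0)
              (at (t - n) within T)"
            using V'(4) T_diff[OF t n] \<epsilon> by (auto simp: stoch_continuous_def)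
          then have "((\<lambda>s. measure M {\<omega> \<in> space M. ennreal \<epsilon> < edistance (kap s (V \<omega>)) (kap (t - n) (V \<omega>))}) \<circ> (\<lambda>i. s i - n)) \<longlonglongrightarrow> 0"
            unfolding tendsto_at_iff_sequentially
            using s T_diff[OF _ n] tendsto_diff[OF s(2) tendsto_const[of n]] by auto
          then show "(\<lambda>i. ?g (s i) n) \<longlonglongrightarrow> 0"
            by (simp add: o_def M.emeasure_eq_measure ennreal_tendsto_0_iff)
        qed
      qed (auto intro!: K_meas simp: M.emeasure_le_1 K.emeasure_space_1)
      then have "(\<lambda>i. ennreal (?f (s i))) \<longlonglongrightarrow> 0" using s eq by simp
      then show "(?f \<circ> s) \<longlonglongrightarrow> 0" by (simp add: o_def ennreal_tendsto_0_iff)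
    qed
  qed
  moreover have "AE x in completion ?N. separable_path (\<lambda>t. kap t (?U x))"
  proof -
    have "AE \<omega> in distr ?N M fst. separable_path (\<lambda>t. kap t (V \<omega>))"
      unfolding K.distr_pair_fst by (rule V'(5))
    from AE_distrD[OF measurable_fst this]
    have "AE x in ?N. separable_path (\<lambda>t. kap t (V (fst x)))" .
    then have "AE x in ?N. separable_path (\<lambda>t. kap t (?U x))"
    proof (rule AE_mp, intro AE_I2 impI)
      fix x assume x: "x \<in> space ?N" and sp: "separable_path (\<lambda>t. kap t (V (fst x)))"
      then have n: "snd x \<in> rat_points T" by (auto simp: space_pair_measure spK)
      have "separable_path (\<lambda>t. kap (t - snd x) (V (fst x)))"
        by (rule separable_path_translate[OF sp n])
      also have "?this \<longleftrightarrow> separable_path (\<lambda>t. kap t (?U x))"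
        using rat_points_subset[OF n] by (intro separable_path_cong) (auto simp: kap_shift split_beta')
      finally show "separable_path (\<lambda>t. kap t (?U x))" .
    qed
    then show ?thesis by (rule AE_completion)
  qed
  ultimately show ?thesis
    unfolding random_field_iff using kfc P.prob_space_completion completion.complete_measure_axioms by blast
qed

section \<open>Occupation of open sets\<close>

lemma open_box: "open {x :: real^'l. \<forall>i. \<bar>x $ i\<bar> < c}"
proof -
  have "open {x :: real^'l. \<bar>x $ i\<bar> < c}" for i
    by (intro open_Collect_less continuous_intros)
  then have "open (\<Inter>i. {x :: real^'l. \<bar>x $ i\<bar> < c})" by (intro open_INT) auto
  also have "(\<Inter>i. {x :: real^'l. \<bar>x $ i\<bar> < c}) = {x. \<forall>i. \<bar>x $ i\<bar> < c}" by auto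
  finally show ?thesis .
qed

text \<open>
  Fubini controls almost every position only.  On a lattice this means every position; in the continuous
  case such positions still approach every point of the cube, also on its boundary, since the cube is the
  closure of its interior.
\<close>

lemma cube_points_AE_dense:
  assumes P: "AE s in index_measure T. P s" and t: "t \<in> T" "t \<in> cube c" and c: "0 < c"
  shows "\<exists>s. (\<forall>n. s n \<in> T) \<and> (\<forall>n. s n \<in> cube c) \<and> (\<forall>n. P (s n)) \<and> s \<longlonglongrightarrow> t"
proof (cases "T = UNIV")
  case False
  then have eq: "index_measure T = count_space T" by (simp add: index_measure_def)
  have "AE s in count_space T. P s" using P unfolding eq .
  then have "P t" using t by (simp add: AE_count_space)
  then show ?thesis using t by (intro exI[of _ "\<lambda>_. t"]) simp
next
  case True
  then have eq: "index_measure T = lebesgue" by (simp add: index_measure_def)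
  have "AE s in lebesgue. P s" using P unfolding eq .
  then obtain N where N: "N \<in> null_sets lebesgue" "{s. \<not> P s} \<subseteq> N"
    by (auto simp: eventually_ae_filter)
  have "\<exists>s\<in>cube c. P s \<and> dist t s < 1 / real (Suc n)" for n
  proof -
    let ?B = "{x. \<forall>i. \<bar>x $ i\<bar> < c} \<inter> ball t (1 / real (Suc n))"
    have "open ?B" by (intro open_Int open_box) auto
    moreover have "?B \<noteq> {}"
    proof -
      define d where "d = 1 / real (Suc n)"
      have d: "0 < d" "d \<le> 1" by (simp_all add: d_def)
      define e where "e = d / (norm t + 2)"
      have pos: "0 < norm t + 2" using norm_ge_zero[of t] by linarith
      have "d < norm t + 2" using d norm_ge_zero[of t] by linarith
      then have e: "0 < e" "e < 1" using d pos by (simp_all add: e_def)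
      have "e * (norm t + 2) = d" using pos by (simp add: e_def)
      then have et: "e * norm t < 1 / real (Suc n)" using e unfolding d_def[symmetric] by (simp add: algebra_simps)
      \<comment> \<open>moving t slightly towards the origin leads into the open cube\<close>
      have "(1 - e) *\<^sub>R t \<in> ?B"
      proof (intro IntI CollectI allI)
        fix i
        have "\<bar>(1 - e) * t $ i\<bar> \<le> (1 - e) * c"
          using t(2) e by (auto simp: cube_def abs_mult intro: mult_left_mono)
        also have "\<dots> < c" using e c by (simp add: algebra_simps)
        finally show "\<bar>((1 - e) *\<^sub>R t) $ i\<bar> < c" by simp
      next
        have "t - (1 - e) *\<^sub>R t = e *\<^sub>R t" by (simp add: algebra_simps)
        then show "(1 - e) *\<^sub>R t \<in> ball t (1 / real (Suc n))"
          using e et by (simp add: dist_norm del: of_nat_Suc)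
      qed
      then show ?thesis by blast
    qed
    ultimately have "\<not> negligible ?B" by (rule open_not_negligible)
    then have "\<not> ?B \<subseteq> N" using N by (meson negligible_iff_null_sets negligible_subset)
    then obtain s where s: "s \<in> ?B" "s \<notin> N" by blast
    then have "P s" using N(2) by blast
    then show ?thesis using s(1) by (auto simp: cube_def intro: less_imp_le)
  qed
  then obtain s where s: "\<And>n. s n \<in> cube c" "\<And>n. P (s n)" "\<And>n. dist t (s n) < 1 / real (Suc n)"
    by metis
  have "s \<longlonglongrightarrow> t"
  proof (rule tendsto_dist_iff[THEN iffD2], rule Lim_null_comparison)
    show "\<forall>\<^sub>F n in sequentially. norm (dist (s n) t) \<le> 1 / real (Suc n)"
      using s(3) by (intro always_eventually allI) (simp add: dist_commute less_imp_le del: of_nat_Suc)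
  qed (rule lim_1_over_n[THEN LIMSEQ_Suc])
  then show ?thesis using s True by (intro exI[of _ s]) simp
qed

lemma cube_sets[measurable]: "cube c \<in> sets (borel :: (real^'l) measure)"
proof -
  have "cube c = (\<Inter>i\<in>UNIV. {t :: real^'l. \<bar>t $ i\<bar> \<le> c})" by (auto simp: cube_def)
  also have "closed \<dots>" by (intro closed_INT ballI closed_Collect_le continuous_intros)
  finally show ?thesis by (rule borel_closed)
qed

lemma cube_indicator_measurable[measurable]:
  "indicator (cube c) \<in> borel_measurable (index_measure T)"
  using measurable_compose[OF index_measure_ident measurable_restrict_space1[OF borel_measurable_indicator[OF cube_sets]]] .

text \<open>
  On the event that the occupation measure vanishes, Fubini forbids values in \<open>A\<close> at almost every position,
  hence along a sequence converging to \<open>t\<close> on which the trajectory converges to its value at \<open>t\<close>.  Since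
  \<open>A\<close> is open, that value is not in \<open>A\<close> either.
\<close>

lemma occupation_pos:
  fixes M :: "'b measure"
  assumes V: "random_field T \<kappa> M V" and A: "open A" and t: "t \<in> T" "t \<in> cube c" and c: "0 < c"
  shows "AE \<omega> in M. kap t (V \<omega>) \<in> A \<longrightarrow>
    0 < (\<integral>\<^sup>+s. indicator (cube c) s * indicator A (kap s (V \<omega>)) \<partial>index_measure T)"
proof -
  note V' = random_fieldD[OF V]
  interpret M: prob_space M by (rule V'(1))
  interpret I: sigma_finite_measure "index_measure T" by (rule sigma_finite_index_measure)
  interpret P: pair_sigma_finite "index_measure T" M ..
  have [measurable]: "A \<in> sets borel" using A by simp
  have j[measurable]: "(\<lambda>x. kap (fst x) (V (snd x))) \<in> borel_measurable (index_measure T \<Otimes>\<^sub>M M)"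
    using kfield_index_measurable[OF V'(3)] by (simp add: split_beta')
  define x :: "real^'l \<Rightarrow> 'b \<Rightarrow> ennreal"
    where "x s \<omega> = indicator (cube c) s * indicator A (kap s (V \<omega>))" for s \<omega>
  define I where "I \<omega> = (\<integral>\<^sup>+s. x s \<omega> \<partial>index_measure T)" for \<omega>
  have x[measurable]: "(\<lambda>z. x (fst z) (snd z)) \<in> borel_measurable (index_measure T \<Otimes>\<^sub>M M)"
    unfolding x_def by measurable
  have x'[measurable]: "(\<lambda>z. x (snd z) (fst z)) \<in> borel_measurable (M \<Otimes>\<^sub>M index_measure T)"
    using measurable_compose[OF measurable_pair_swap' x] by (simp add: split_beta')
  have I[measurable]: "I \<in> borel_measurable M" unfolding I_def by measurable
  have J: "(\<lambda>z. indicator {0} (I (snd z)) * x (fst z) (snd z)) \<in> borel_measurable (index_measure T \<Otimes>\<^sub>M M)"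
    by measurable
  have "(\<integral>\<^sup>+s. \<integral>\<^sup>+\<omega>. indicator {0} (I \<omega>) * x s \<omega> \<partial>M \<partial>index_measure T)
      = (\<integral>\<^sup>+\<omega>. \<integral>\<^sup>+s. indicator {0} (I \<omega>) * x s \<omega> \<partial>index_measure T \<partial>M)"
    using P.Fubini[OF J] by simp
  also have "\<dots> = (\<integral>\<^sup>+\<omega>. indicator {0} (I \<omega>) * I \<omega> \<partial>M)"
    unfolding I_def[symmetric]
  proof (rule nn_integral_cong)
    fix \<omega> assume "\<omega> \<in> space M"
    from measurable_Pair1[OF x this] have "(\<lambda>s. x s \<omega>) \<in> borel_measurable (index_measure T)" by simp
    from nn_integral_cmult[OF this]
    show "(\<integral>\<^sup>+s. indicator {0} (I \<omega>) * x s \<omega> \<partial>index_measure T) = indicator {0} (I \<omega>) * I \<omega>"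
      by (simp add: I_def)
  qed
  also have "\<dots> = (\<integral>\<^sup>+\<omega>. 0 \<partial>M)"
    by (rule nn_integral_cong) (simp split: split_indicator)
  finally have 0: "(\<integral>\<^sup>+s. \<integral>\<^sup>+\<omega>. indicator {0} (I \<omega>) * x s \<omega> \<partial>M \<partial>index_measure T) = 0" by simp
  have "(\<lambda>s. \<integral>\<^sup>+\<omega>. indicator {0} (I \<omega>) * x s \<omega> \<partial>M) \<in> borel_measurable (index_measure T)" by measurable
  from nn_integral_0_iff_AE[OF this] 0
  have ae: "AE s in index_measure T. (\<integral>\<^sup>+\<omega>. indicator {0} (I \<omega>) * x s \<omega> \<partial>M) = 0" by (rule iffD1)
  from cube_points_AE_dense[OF this t c]
  obtain s where s: "\<And>n. s n \<in> T" "\<And>n. s n \<in> cube c"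
    "\<And>n. (\<integral>\<^sup>+\<omega>. indicator {0} (I \<omega>) * x (s n) \<omega> \<partial>M) = 0" "s \<longlonglongrightarrow> t"
    by (elim exE conjE) (rule that; simp)
  have "AE \<omega> in M. \<forall>n. kap (s n) (V \<omega>) \<in> A \<longrightarrow> I \<omega> \<noteq> 0"
    unfolding AE_all_countable
  proof
    fix n
    have [measurable]: "(\<lambda>\<omega>. kap (s n) (V \<omega>)) \<in> borel_measurable M"
      by (rule kap_measurable[OF V'(6) s(1)])
    have "(\<lambda>\<omega>. indicator {0} (I \<omega>) * x (s n) \<omega>) \<in> borel_measurable M" unfolding x_def by measurable
    from nn_integral_0_iff_AE[OF this] s(3)[of n]
    have "AE \<omega> in M. indicator {0} (I \<omega>) * x (s n) \<omega> = 0" by (rule iffD1)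
    then show "AE \<omega> in M. kap (s n) (V \<omega>) \<in> A \<longrightarrow> I \<omega> \<noteq> 0"
    proof eventually_elim
      case (elim \<omega>)
      then show ?case using s(2)[of n] by (auto simp: x_def)
    qed
  qed
  moreover from random_field_subsequence[OF V t(1) s(1) s(4)]
  obtain r where "AE \<omega> in M. (\<lambda>n. kap (s (r n)) (V \<omega>)) \<longlonglongrightarrow> kap t (V \<omega>)"
    by (elim exE conjE)
  ultimately show ?thesis
  proof eventually_elim
    case (elim \<omega>)
    show ?case
    proof
      assume "kap t (V \<omega>) \<in> A"
      from topological_tendstoD[OF elim(2) A this] obtain n where "kap (s (r n)) (V \<omega>) \<in> A"
        by (auto simp: eventually_sequentially)
      then have "I \<omega> \<noteq> 0" using elim(1) by blast
      from this[unfolded I_def x_def]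
      show "0 < (\<integral>\<^sup>+s. indicator (cube c) s * indicator A (kap s (V \<omega>)) \<partial>index_measure T)"
        by (simp only: zero_less_iff_neq_zero) simp
    qed
  qed
qed

end

section \<open>Integral maps depend on the law of the field only\<close>

lemma density_distr_eqI:
  assumes [measurable]: "a \<in> borel_measurable M" "b \<in> borel_measurable N" "V \<in> measurable M L" "W \<in> measurable N L"
    and eq: "\<And>H :: _ \<Rightarrow> ennreal. H \<in> borel_measurable L \<Longrightarrow>
      (\<integral>\<^sup>+\<omega>. a \<omega> * H (V \<omega>) \<partial>M) = (\<integral>\<^sup>+\<omega>. b \<omega> * H (W \<omega>) \<partial>N)"
  shows "distr (density M a) L V = distr (density N b) L W"
proof (rule measure_eqI)
  fix A assume "A \<in> sets (distr (density M a) L V)"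
  then have A[measurable]: "A \<in> sets L" by simp
  have "emeasure (distr (density M a) L V) A = (\<integral>\<^sup>+\<omega>. a \<omega> * indicator A (V \<omega>) \<partial>M)"
    by (simp add: emeasure_distr emeasure_density) (auto intro!: nn_integral_cong simp: indicator_def)
  also have "\<dots> = (\<integral>\<^sup>+\<omega>. b \<omega> * indicator A (W \<omega>) \<partial>N)"
    by (rule eq) simp
  also have "\<dots> = emeasure (distr (density N b) L W) A"
    by (simp add: emeasure_distr emeasure_density) (auto intro!: nn_integral_cong simp: indicator_def)
  finally show "emeasure (distr (density M a) L V) A = emeasure (distr (density N b) L W) A" .
qed simp

lemma finite_measure_density:
  "a \<in> borel_measurable M \<Longrightarrow> (\<integral>\<^sup>+\<omega>. a \<omega> \<partial>M) < \<infinity> \<Longrightarrow> finite_measure (density M a)"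
  by (rule finite_measureI) (auto simp: emeasure_density cong: nn_integral_cong)

context homogeneous_functional
begin

lemma kfield_integrand_measurable:
  assumes V: "kfield M V" and \<phi>: "(\<lambda>(t, x). \<phi> t x) \<in> borel_measurable (index_measure T \<Otimes>\<^sub>M borel)"
  shows "(\<lambda>(t, \<omega>). \<phi> t (kap t (V \<omega>))) \<in> borel_measurable (index_measure T \<Otimes>\<^sub>M M)"
proof -
  have "(\<lambda>x. (fst x, kap (fst x) (V (snd x)))) \<in> measurable (index_measure T \<Otimes>\<^sub>M M) (index_measure T \<Otimes>\<^sub>M borel)"
    using kfield_index_measurable[OF V] by (intro measurable_Pair measurable_fst) (simp add: split_beta')
  from measurable_compose[OF this \<phi>] show ?thesis by (simp add: split_beta')
qed

lemma path_integral_determined_by_law: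
  fixes \<phi> :: "real^'l \<Rightarrow> ennreal \<Rightarrow> ennreal"
  assumes V1: "finite_measure M\<^sub>1" "kfield M\<^sub>1 V\<^sub>1" and V2: "finite_measure M\<^sub>2" "kfield M\<^sub>2 V\<^sub>2"
    and law: "distr M\<^sub>1 S V\<^sub>1 = distr M\<^sub>2 S V\<^sub>2"
    and \<phi>: "(\<lambda>(t, x). \<phi> t x) \<in> borel_measurable (index_measure T \<Otimes>\<^sub>M borel)"
  shows "\<exists>G\<in>borel_measurable S.
      (AE \<omega> in M\<^sub>1. (\<integral>\<^sup>+t. \<phi> t (kap t (V\<^sub>1 \<omega>)) \<partial>index_measure T) = G (V\<^sub>1 \<omega>)) \<and>
      (AE \<omega> in M\<^sub>2. (\<integral>\<^sup>+t. \<phi> t (kap t (V\<^sub>2 \<omega>)) \<partial>index_measure T) = G (V\<^sub>2 \<omega>))"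
proof -
  have sec: "(\<lambda>f. \<phi> t (kap t f)) \<in> borel_measurable S" if "t \<in> space (index_measure T)" for t
  proof -
    have "(\<lambda>x. \<phi> t x) \<in> borel_measurable borel"
      using measurable_Pair2[OF \<phi> that] by simp
    from measurable_compose[OF kap_measurable_S this] that show ?thesis by simp
  qed
  show ?thesis
  proof (rule integral_functional_determined_by_law[where x = "\<lambda>t f. \<phi> t (kap t f)",
        OF V1(1) kfield_measurable[OF V1(2)] V2(1) kfield_measurable[OF V2(2)] law sigma_finite_index_measure sec
          kfield_integrand_measurable[OF V1(2) \<phi>] kfield_integrand_measurable[OF V2(2) \<phi>]])
    fix G assume "G \<in> borel_measurable S"
      "AE \<omega> in M\<^sub>1. (\<integral>\<^sup>+t. \<phi> t (kap t (V\<^sub>1 \<omega>)) \<partial>index_measure T) = G (V\<^sub>1 \<omega>)"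
      "AE \<omega> in M\<^sub>2. (\<integral>\<^sup>+t. \<phi> t (kap t (V\<^sub>2 \<omega>)) \<partial>index_measure T) = G (V\<^sub>2 \<omega>)"
    then show ?thesis by (intro bexI[of _ G] conjI)
  qed
qed

lemma kint_fun_measurable:
  assumes V: "kfield M V" and g[measurable]: "g \<in> borel_measurable (index_measure T)" and \<omega>: "\<omega> \<in> space M"
  shows "kint_fun T \<kappa> \<xi> g (V \<omega>) \<in> borel_measurable (index_measure T)"
proof -
  have [measurable]: "(\<lambda>t. kap t (V \<omega>)) \<in> borel_measurable (index_measure T)"
    using measurable_Pair1[OF kfield_index_measurable[OF V] \<omega>] by simp
  show ?thesis unfolding kint_fun_def kap_def[symmetric] by measurable
qed

lemma kint_determined_by_law:
  assumes V1: "finite_measure M\<^sub>1" "kfield M\<^sub>1 V\<^sub>1" and V2: "finite_measure M\<^sub>2" "kfield M\<^sub>2 V\<^sub>2"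
    and law: "distr M\<^sub>1 S V\<^sub>1 = distr M\<^sub>2 S V\<^sub>2" and g: "g \<in> weights T"
  shows "\<exists>G\<in>borel_measurable S. (AE \<omega> in M\<^sub>1. kint T \<kappa> \<xi> g (V\<^sub>1 \<omega>) = G (V\<^sub>1 \<omega>)) \<and>
      (AE \<omega> in M\<^sub>2. kint T \<kappa> \<xi> g (V\<^sub>2 \<omega>) = G (V\<^sub>2 \<omega>))"
proof -
  have [measurable]: "g \<in> borel_measurable (index_measure T)" using g by (simp add: weights_def)
  have "(\<lambda>(t, x). epowr x \<xi> * ennreal (g t)) \<in> borel_measurable (index_measure T \<Otimes>\<^sub>M borel)"
    by measurable
  from path_integral_determined_by_law[OF V1 V2 law this] show ?thesis
    unfolding kint_def kint_fun_def kap_def .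
qed

lemma int_map_determined_by_law:
  assumes V1: "finite_measure M\<^sub>1" "kfield M\<^sub>1 V\<^sub>1" and V2: "finite_measure M\<^sub>2" "kfield M\<^sub>2 V\<^sub>2"
    and law: "distr M\<^sub>1 S V\<^sub>1 = distr M\<^sub>2 S V\<^sub>2" and F: "F \<in> int_maps T \<kappa> \<beta>"
  shows "\<exists>G\<in>borel_measurable S. (AE \<omega> in M\<^sub>1. F (V\<^sub>1 \<omega>) = G (V\<^sub>1 \<omega>)) \<and> (AE \<omega> in M\<^sub>2. F (V\<^sub>2 \<omega>) = G (V\<^sub>2 \<omega>))"
proof -
  from F obtain \<Gamma> \<xi>\<^sub>0 \<xi>\<^sub>1 \<xi>\<^sub>2 \<xi>\<^sub>3 g\<^sub>1 g\<^sub>2 g\<^sub>3 A where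
    \<Gamma>: "\<Gamma> \<in> hom_maps T \<xi>\<^sub>0" and g: "g\<^sub>1 \<in> weights T" "g\<^sub>2 \<in> weights T" "g\<^sub>3 \<in> weights T"
    and A[measurable]: "A \<in> sets borel"
    and F_eq: "\<forall>f\<in>space S. F f =
           (if kint_fun T \<kappa> \<xi>\<^sub>1 g\<^sub>1 f \<in> borel_measurable (index_measure T) \<and>
               kint_fun T \<kappa> \<xi>\<^sub>2 g\<^sub>2 f \<in> borel_measurable (index_measure T) \<and>
               kint_fun T \<kappa> \<xi>\<^sub>3 g\<^sub>3 f \<in> borel_measurable (index_measure T)
            then \<Gamma> f * enn2ereal (kint T \<kappa> \<xi>\<^sub>1 g\<^sub>1 f) * indicator A (kint T \<kappa> \<xi>\<^sub>2 g\<^sub>2 f)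
                   / enn2ereal (kint T \<kappa> \<xi>\<^sub>3 g\<^sub>3 f)
            else 0)"
    unfolding int_maps_def by (elim CollectE conjE exE)
  have gm: "g\<^sub>1 \<in> borel_measurable (index_measure T)" "g\<^sub>2 \<in> borel_measurable (index_measure T)"
    "g\<^sub>3 \<in> borel_measurable (index_measure T)" using g by (simp_all add: weights_def)
  have [measurable]: "\<Gamma> \<in> borel_measurable S" using \<Gamma> by (simp add: hom_maps_def maps_def)
  note K = kint_determined_by_law[OF V1 V2 law]
  from K[OF g(1), of \<xi>\<^sub>1] obtain G1 where G1[measurable]: "G1 \<in> borel_measurable S"
    and a1: "AE \<omega> in M\<^sub>1. kint T \<kappa> \<xi>\<^sub>1 g\<^sub>1 (V\<^sub>1 \<omega>) = G1 (V\<^sub>1 \<omega>)" and b1: "AE \<omega> in M\<^sub>2. kint T \<kappa> \<xi>\<^sub>1 g\<^sub>1 (V\<^sub>2 \<omega>) = G1 (V\<^sub>2 \<omega>)"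
    by (elim bexE conjE)
  from K[OF g(2), of \<xi>\<^sub>2] obtain G2 where G2[measurable]: "G2 \<in> borel_measurable S"
    and a2: "AE \<omega> in M\<^sub>1. kint T \<kappa> \<xi>\<^sub>2 g\<^sub>2 (V\<^sub>1 \<omega>) = G2 (V\<^sub>1 \<omega>)" and b2: "AE \<omega> in M\<^sub>2. kint T \<kappa> \<xi>\<^sub>2 g\<^sub>2 (V\<^sub>2 \<omega>) = G2 (V\<^sub>2 \<omega>)"
    by (elim bexE conjE)
  from K[OF g(3), of \<xi>\<^sub>3] obtain G3 where G3[measurable]: "G3 \<in> borel_measurable S"
    and a3: "AE \<omega> in M\<^sub>1. kint T \<kappa> \<xi>\<^sub>3 g\<^sub>3 (V\<^sub>1 \<omega>) = G3 (V\<^sub>1 \<omega>)" and b3: "AE \<omega> in M\<^sub>2. kint T \<kappa> \<xi>\<^sub>3 g\<^sub>3 (V\<^sub>2 \<omega>) = G3 (V\<^sub>2 \<omega>)"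
    by (elim bexE conjE)
  define G where "G f = \<Gamma> f * enn2ereal (G1 f) * indicator A (G2 f) / enn2ereal (G3 f)" for f
  have F1: "F (V\<^sub>1 \<omega>) = \<Gamma> (V\<^sub>1 \<omega>) * enn2ereal (kint T \<kappa> \<xi>\<^sub>1 g\<^sub>1 (V\<^sub>1 \<omega>)) * indicator A (kint T \<kappa> \<xi>\<^sub>2 g\<^sub>2 (V\<^sub>1 \<omega>))
                   / enn2ereal (kint T \<kappa> \<xi>\<^sub>3 g\<^sub>3 (V\<^sub>1 \<omega>))" if "\<omega> \<in> space M\<^sub>1" for \<omega>
    using F_eq measurable_space[OF kfield_measurable[OF V1(2)] that] kint_fun_measurable[OF V1(2) _ that] gm by simp
  have F2: "F (V\<^sub>2 \<omega>) = \<Gamma> (V\<^sub>2 \<omega>) * enn2ereal (kint T \<kappa> \<xi>\<^sub>1 g\<^sub>1 (V\<^sub>2 \<omega>)) * indicator A (kint T \<kappa> \<xi>\<^sub>2 g\<^sub>2 (V\<^sub>2 \<omega>))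
                   / enn2ereal (kint T \<kappa> \<xi>\<^sub>3 g\<^sub>3 (V\<^sub>2 \<omega>))" if "\<omega> \<in> space M\<^sub>2" for \<omega>
    using F_eq measurable_space[OF kfield_measurable[OF V2(2)] that] kint_fun_measurable[OF V2(2) _ that] gm by simp
  show ?thesis
  proof (intro bexI conjI)
    show "G \<in> borel_measurable S" unfolding G_def by measurable
    show "AE \<omega> in M\<^sub>1. F (V\<^sub>1 \<omega>) = G (V\<^sub>1 \<omega>)"
      using a1 a2 a3 AE_space by eventually_elim (simp add: F1 G_def)
    show "AE \<omega> in M\<^sub>2. F (V\<^sub>2 \<omega>) = G (V\<^sub>2 \<omega>)"
      using b1 b2 b3 AE_space by eventually_elim (simp add: F2 G_def)
  qed
qed

lemma star_map_determined_by_law: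
  assumes V1: "finite_measure M\<^sub>1" "kfield M\<^sub>1 V\<^sub>1" and V2: "finite_measure M\<^sub>2" "kfield M\<^sub>2 V\<^sub>2"
    and law: "distr M\<^sub>1 S V\<^sub>1 = distr M\<^sub>2 S V\<^sub>2" and F: "F \<in> star_maps T \<kappa>"
  shows "\<exists>G\<in>borel_measurable S. (AE \<omega> in M\<^sub>1. F (V\<^sub>1 \<omega>) = G (V\<^sub>1 \<omega>)) \<and> (AE \<omega> in M\<^sub>2. F (V\<^sub>2 \<omega>) = G (V\<^sub>2 \<omega>))"
proof -
  from F obtain \<beta> F\<^sub>1 F\<^sub>2 where F1: "F\<^sub>1 \<in> int_maps T \<kappa> \<beta>" and F2: "F\<^sub>2 \<in> maps T" and F_eq: "F = (\<lambda>f. F\<^sub>1 f * F\<^sub>2 f)"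
    unfolding star_maps_def by blast
  have [measurable]: "F\<^sub>2 \<in> borel_measurable S" using F2 by (simp add: maps_def)
  from int_map_determined_by_law[OF V1 V2 law F1] obtain G where [measurable]: "G \<in> borel_measurable S"
    and a: "AE \<omega> in M\<^sub>1. F\<^sub>1 (V\<^sub>1 \<omega>) = G (V\<^sub>1 \<omega>)" and b: "AE \<omega> in M\<^sub>2. F\<^sub>1 (V\<^sub>2 \<omega>) = G (V\<^sub>2 \<omega>)"
    by (elim bexE conjE)
  show ?thesis
  proof (intro bexI conjI)
    show "(\<lambda>f. G f * F\<^sub>2 f) \<in> borel_measurable S" by measurable
    show "AE \<omega> in M\<^sub>1. F (V\<^sub>1 \<omega>) = G (V\<^sub>1 \<omega>) * F\<^sub>2 (V\<^sub>1 \<omega>)"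
      using a by eventually_elim (simp add: F_eq)
    show "AE \<omega> in M\<^sub>2. F (V\<^sub>2 \<omega>) = G (V\<^sub>2 \<omega>) * F\<^sub>2 (V\<^sub>2 \<omega>)"
      using b by eventually_elim (simp add: F_eq)
  qed
qed

end

section \<open>Pareto variables\<close>

lemma prob_space_pareto_law:
  assumes "0 < \<alpha>"
  shows "prob_space (density (pareto_intensity \<alpha>) (indicator {1<..}))"
  using assms by (intro prob_spaceI) (simp add: emeasure_density emeasure_pareto_intensity_greaterThan)

lemma pareto_AE:
  assumes "0 < \<alpha>" "prob_space M" "pareto \<alpha> M R"
  shows "AE \<omega> in M. 1 < R \<omega> \<and> R \<omega> < \<infinity>"
proof -
  interpret prob_space M by fact
  have [measurable]: "R \<in> borel_measurable M" using assms by (simp add: pareto_def)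
  have t: "prob {\<omega> \<in> space M. ennreal t < R \<omega>} = t powr (- \<alpha>)" if "1 \<le> t" for t
    using assms that by (simp add: pareto_def)
  have "{\<omega> \<in> space M. 1 < R \<omega>} \<in> events" by measurable
  from prob_eq_1[OF this] t[of 1] have "AE \<omega> in M. \<omega> \<in> {\<omega> \<in> space M. 1 < R \<omega>}" by simp
  then have "AE \<omega> in M. 1 < R \<omega>" by eventually_elim simp
  note one = this
  have "prob {\<omega> \<in> space M. R \<omega> = \<infinity>} = 0"
  proof (rule antisym[OF _ measure_nonneg], rule LIMSEQ_le_const)
    show "(\<lambda>n. real (Suc n) powr (- \<alpha>)) \<longlonglongrightarrow> 0"
      by (intro tendsto_neg_powr filterlim_compose[OF filterlim_real_sequentially filterlim_Suc]) (use assms in auto)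
    show "\<exists>N. \<forall>n\<ge>N. prob {\<omega> \<in> space M. R \<omega> = \<infinity>} \<le> real (Suc n) powr (- \<alpha>)"
    proof (intro exI allI impI)
      fix n
      have "prob {\<omega> \<in> space M. R \<omega> = \<infinity>} \<le> prob {\<omega> \<in> space M. ennreal (real (Suc n)) < R \<omega>}"
        by (intro finite_measure_mono) auto
      then show "prob {\<omega> \<in> space M. R \<omega> = \<infinity>} \<le> real (Suc n) powr (- \<alpha>)" by (subst (asm) t) auto
    qed
  qed
  moreover have "{\<omega> \<in> space M. R \<omega> = \<infinity>} \<in> events" by measurable
  ultimately have "AE \<omega> in M. \<omega> \<notin> {\<omega> \<in> space M. R \<omega> = \<infinity>}" using prob_eq_0 by simp
  with AE_space have "AE \<omega> in M. R \<omega> \<noteq> \<infinity>" by eventually_elim simp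
  with one show ?thesis by eventually_elim (simp add: less_top)
qed

lemma pareto_AE_enn2real:
  assumes "0 < \<alpha>" "prob_space M" "pareto \<alpha> M R"
  shows "AE \<omega> in M. 1 < enn2real (R \<omega>)"
  using pareto_AE[OF assms]
proof eventually_elim
  case (elim \<omega>)
  then show ?case by (cases "R \<omega>") (auto simp: ennreal_less_iff simp flip: ennreal_1)
qed

lemma pareto_distr:
  assumes \<alpha>: "0 < \<alpha>" and M: "prob_space M" and R: "pareto \<alpha> M R"
  shows "distr M borel (\<lambda>\<omega>. enn2real (R \<omega>)) = density (pareto_intensity \<alpha>) (indicator {1<..})"
proof -
  interpret M: prob_space M by fact
  interpret Q: prob_space "density (pareto_intensity \<alpha>) (indicator {1<..})" by (rule prob_space_pareto_law[OF \<alpha>])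
  have Rm[measurable]: "R \<in> borel_measurable M" using R by (simp add: pareto_def)
  interpret D: prob_space "distr M borel (\<lambda>\<omega>. enn2real (R \<omega>))" by (rule M.prob_space_distr) measurable
  note ae = pareto_AE[OF assms]
  show ?thesis
  proof (rule cdf_unique)
    show "real_distribution (distr M borel (\<lambda>\<omega>. enn2real (R \<omega>)))" by unfold_locales auto
    show "real_distribution (density (pareto_intensity \<alpha>) (indicator {1<..}))" by unfold_locales auto
    show "cdf (distr M borel (\<lambda>\<omega>. enn2real (R \<omega>))) = cdf (density (pareto_intensity \<alpha>) (indicator {1<..}))"
    proof
      fix x :: real
      let ?m = "max x 1"
      have c: "- {..x} = {x<..}" by auto
      have "D.prob {x<..} = measure M {\<omega> \<in> space M. x < enn2real (R \<omega>)}"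
        by (simp add: measure_distr vimage_def Int_def conj_commute)
      also have "\<dots> = measure M {\<omega> \<in> space M. ennreal ?m < R \<omega>}"
      proof (rule M.finite_measure_eq_AE)
        show "AE \<omega> in M. (\<omega> \<in> {\<omega> \<in> space M. x < enn2real (R \<omega>)}) \<longleftrightarrow> (\<omega> \<in> {\<omega> \<in> space M. ennreal ?m < R \<omega>})"
          using ae
        proof eventually_elim
          case (elim \<omega>)
          then obtain r where r: "R \<omega> = ennreal r" "1 < r" by (cases "R \<omega>") (auto simp: ennreal_less_iff ennreal_1[symmetric] simp del: ennreal_1)
          then show ?case by (auto simp: ennreal_less_iff max_def)
        qed
      qed measurable
      also have "\<dots> = ?m powr (- \<alpha>)" using R by (simp add: pareto_def)
      finally have 1: "D.prob {x<..} = ?m powr (- \<alpha>)" .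
      have "emeasure (density (pareto_intensity \<alpha>) (indicator {1<..})) {x<..} = (\<integral>\<^sup>+z. indicator {?m<..} z \<partial>pareto_intensity \<alpha>)"
        by (subst emeasure_density, simp, simp, rule nn_integral_cong) (auto simp: indicator_def)
      also have "\<dots> = ennreal (?m powr (- \<alpha>))"
        using emeasure_pareto_intensity_greaterThan[OF \<alpha>, of ?m] by simp
      finally have 2: "Q.prob {x<..} = ?m powr (- \<alpha>)" by (simp add: measure_def)
      show "cdf (distr M borel (\<lambda>\<omega>. enn2real (R \<omega>))) x = cdf (density (pareto_intensity \<alpha>) (indicator {1<..})) x"
        using 1 2 D.prob_compl[of "{..x}"] Q.prob_compl[of "{..x}"] c by (simp add: cdf_def Compl_eq_Diff_UNIV)
    qed
  qed
qed

lemma pareto_independent_integral: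
  assumes \<alpha>: "0 < \<alpha>" and M: "prob_space M" and R: "pareto \<alpha> M R" and ind: "independent_rv M borel R L X"
    and H[measurable]: "(\<lambda>(z, x). H z x) \<in> borel_measurable (borel \<Otimes>\<^sub>M L)"
  shows "(\<integral>\<^sup>+\<omega>. H (enn2real (R \<omega>)) (X \<omega>) \<partial>M)
      = (\<integral>\<^sup>+z. indicator {1<..} z * (\<integral>\<^sup>+\<omega>. H z (X \<omega>) \<partial>M) \<partial>pareto_intensity \<alpha>)"
proof -
  interpret M: prob_space M by fact
  have X[measurable]: "X \<in> measurable M L" and Rm[measurable]: "R \<in> borel_measurable M"
    using ind by (auto simp: independent_rv_def)
  let ?P = "density (pareto_intensity \<alpha>) (indicator {1<..})"
  let ?r = "\<lambda>\<omega>. enn2real (R \<omega>)"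
  interpret P: prob_space ?P by (rule prob_space_pareto_law[OF \<alpha>])
  interpret X: prob_space "distr M L X" by (rule M.prob_space_distr) measurable
  have sets_eq: "sets (?P \<Otimes>\<^sub>M distr M L X) = sets (borel \<Otimes>\<^sub>M L)"
    by (rule sets_pair_measure_cong) simp_all
  have Hm: "(\<lambda>p. H (fst p) (snd p)) \<in> borel_measurable (?P \<Otimes>\<^sub>M distr M L X)"
    using H unfolding measurable_cong_sets[OF sets_eq refl] by (simp add: split_beta')
  have eq: "?P \<Otimes>\<^sub>M distr M L X = distr M (borel \<Otimes>\<^sub>M L) (\<lambda>\<omega>. (?r \<omega>, X \<omega>))"
  proof (rule pair_measure_eqI[OF P.sigma_finite_measure_axioms X.sigma_finite_measure_axioms])
    show "sets (?P \<Otimes>\<^sub>M distr M L X) = sets (distr M (borel \<Otimes>\<^sub>M L) (\<lambda>\<omega>. (?r \<omega>, X \<omega>)))"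
      using sets_eq by simp
    fix A B assume "A \<in> sets ?P" "B \<in> sets (distr M L X)"
    then have A[measurable]: "A \<in> sets borel" and B[measurable]: "B \<in> sets L" by auto
    have "enn2real -` A \<in> sets borel"
      using measurable_sets[OF borel_measurable_enn2real[OF measurable_ident] A] by (simp add: id_def)
    then have 1: "R -` (enn2real -` A) \<inter> space M \<in> {R -` A \<inter> space M |A. A \<in> sets borel}"
      by (intro CollectI exI[of _ "enn2real -` A"] conjI refl)
    have 2: "X -` B \<inter> space M \<in> {X -` A \<inter> space M |A. A \<in> sets L}"
      by (intro CollectI exI[of _ B] conjI refl B)
    have "M.indep_set {R -` A \<inter> space M |A. A \<in> sets borel} {X -` A \<inter> space M |A. A \<in> sets L}"
      using ind by (simp add: independent_rv_def)
    from M.indep_setD[OF this 1 2]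
    have "M.prob ((R -` (enn2real -` A) \<inter> space M) \<inter> (X -` B \<inter> space M))
        = M.prob (R -` (enn2real -` A) \<inter> space M) * M.prob (X -` B \<inter> space M)" .
    moreover have "emeasure ?P A = M.prob (R -` (enn2real -` A) \<inter> space M)"
      by (subst pareto_distr[OF \<alpha> M R, symmetric]) (simp add: emeasure_distr M.emeasure_eq_measure vimage_def)
    moreover have "emeasure (distr M L X) B = M.prob (X -` B \<inter> space M)"
      by (simp add: emeasure_distr M.emeasure_eq_measure)
    moreover have "emeasure (distr M (borel \<Otimes>\<^sub>M L) (\<lambda>\<omega>. (?r \<omega>, X \<omega>))) (A \<times> B)
       = M.prob ((R -` (enn2real -` A) \<inter> space M) \<inter> (X -` B \<inter> space M))"
      by (subst emeasure_distr) (auto simp: M.emeasure_eq_measure intro!: arg_cong[where f=M.prob])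
    ultimately show "emeasure ?P A * emeasure (distr M L X) B = emeasure (distr M (borel \<Otimes>\<^sub>M L) (\<lambda>\<omega>. (?r \<omega>, X \<omega>))) (A \<times> B)"
      by (simp add: ennreal_mult)
  qed
  have "(\<integral>\<^sup>+\<omega>. H (?r \<omega>) (X \<omega>) \<partial>M) = (\<integral>\<^sup>+p. H (fst p) (snd p) \<partial>distr M (borel \<Otimes>\<^sub>M L) (\<lambda>\<omega>. (?r \<omega>, X \<omega>)))"
    by (subst nn_integral_distr) (auto simp: split_beta')
  also have "\<dots> = (\<integral>\<^sup>+p. H (fst p) (snd p) \<partial>(?P \<Otimes>\<^sub>M distr M L X))" by (simp only: eq)
  also have "\<dots> = (\<integral>\<^sup>+z. \<integral>\<^sup>+x. H z x \<partial>distr M L X \<partial>?P)"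
    using X.nn_integral_fst[OF Hm] by simp
  also have "\<dots> = (\<integral>\<^sup>+z. \<integral>\<^sup>+\<omega>. H z (X \<omega>) \<partial>M \<partial>?P)"
  proof (rule nn_integral_cong)
    fix z
    have "(\<lambda>x. H z x) \<in> borel_measurable (distr M L X)" using measurable_Pair2[OF H, of z] by simp
    from nn_integral_distr[OF X this] show "(\<integral>\<^sup>+x. H z x \<partial>distr M L X) = (\<integral>\<^sup>+\<omega>. H z (X \<omega>) \<partial>M)" .
  qed
  also have "\<dots> = (\<integral>\<^sup>+z. indicator {1<..} z * (\<integral>\<^sup>+\<omega>. H z (X \<omega>) \<partial>M) \<partial>pareto_intensity \<alpha>)"
  proof (rule nn_integral_density)
    have "(\<lambda>p. H (fst p) (X (snd p))) \<in> borel_measurable (borel \<Otimes>\<^sub>M M)"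
      using measurable_compose[OF _ H, of "\<lambda>p. (fst p, X (snd p))"] by simp
    from M.borel_measurable_nn_integral_fst[OF this]
    show "(\<lambda>z. \<integral>\<^sup>+\<omega>. H z (X \<omega>) \<partial>M) \<in> borel_measurable (pareto_intensity \<alpha>)" by simp
  qed simp
  finally show ?thesis .
qed

section \<open>Integrals of maps of both signs\<close>

lemma eintegral_eq_of_law:
  assumes [measurable]: "F \<in> borel_measurable L"
    and law: "\<And>H :: _ \<Rightarrow> ennreal. H \<in> borel_measurable L \<Longrightarrow>
      (\<integral>\<^sup>+\<omega>. a \<omega> * H (V \<omega>) \<partial>M) = (\<integral>\<^sup>+\<omega>. b \<omega> * H (W \<omega>) \<partial>N)"
  shows "eintegral M (\<lambda>\<omega>. enn2ereal (a \<omega>) * F (V \<omega>)) = eintegral N (\<lambda>\<omega>. enn2ereal (b \<omega>) * F (W \<omega>))"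
proof -
  have "(\<lambda>f. e2ennreal (F f)) \<in> borel_measurable L" "(\<lambda>f. e2ennreal (- F f)) \<in> borel_measurable L"
    by measurable
  from this[THEN law] show ?thesis by (simp only: eintegral_weighted)
qed

lemma nn_integral_eq_of_eq_expect:
  fixes f :: "'a \<Rightarrow> ennreal" and g :: "'b \<Rightarrow> ennreal"
  assumes [measurable]: "f \<in> borel_measurable M" "g \<in> borel_measurable N"
    and eq: "eq_expect M (\<lambda>\<omega>. enn2ereal (f \<omega>)) N (\<lambda>\<omega>. enn2ereal (g \<omega>))"
  shows "(\<integral>\<^sup>+\<omega>. f \<omega> \<partial>M) = (\<integral>\<^sup>+\<omega>. g \<omega> \<partial>N)"
proof -
  have "eintegral_exists M (\<lambda>\<omega>. enn2ereal (f \<omega>))" "eintegral_exists N (\<lambda>\<omega>. enn2ereal (g \<omega>))"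
    by (rule eintegral_exists_nonneg; simp)+
  with eq have "eintegral M (\<lambda>\<omega>. enn2ereal (f \<omega>)) = eintegral N (\<lambda>\<omega>. enn2ereal (g \<omega>))"
    by (simp add: eq_expect_def)
  then show ?thesis by (simp add: eintegral_nonneg enn2ereal_inject)
qed

text \<open>
  The Fubini identity for maps of both signs: since one of the two total masses is finite, the pointwise
  differences never cancel infinite amounts against each other.
\<close>

lemma eintegral_integral_difference:
  assumes [measurable]: "P \<in> borel_measurable M" "Q \<in> borel_measurable M"
    and fin: "AE z in M. P z < \<infinity> \<or> Q z < \<infinity>"
    and total: "(\<integral>\<^sup>+z. P z \<partial>M) < \<infinity> \<or> (\<integral>\<^sup>+z. Q z \<partial>M) < \<infinity>"
  shows "eintegral M (\<lambda>z. enn2ereal (P z) - enn2ereal (Q z))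
       = enn2ereal (\<integral>\<^sup>+z. P z \<partial>M) - enn2ereal (\<integral>\<^sup>+z. Q z \<partial>M)"
proof -
  have 1: "e2ennreal (enn2ereal p - enn2ereal q) = p - q" for p q
    by (simp add: minus_ennreal.abs_eq[symmetric] eq_onp_same_args)
  have 2: "e2ennreal (- (enn2ereal p - enn2ereal q)) = q - p" if "p < \<infinity> \<or> q < \<infinity>" for p q
  proof -
    have "- (enn2ereal p - enn2ereal q) = enn2ereal q - enn2ereal p"
      using that by (cases p; cases q) auto
    then show ?thesis by (simp add: 1)
  qed
  let ?d = "\<integral>\<^sup>+z. P z - Q z \<partial>M" and ?e = "\<integral>\<^sup>+z. Q z - P z \<partial>M"
  let ?p = "\<integral>\<^sup>+z. P z \<partial>M" and ?q = "\<integral>\<^sup>+z. Q z \<partial>M"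
  have "(\<integral>\<^sup>+z. e2ennreal (- (enn2ereal (P z) - enn2ereal (Q z))) \<partial>M) = ?e"
    by (rule nn_integral_cong_AE) (use fin in eventually_elim, auto intro: 2)
  then have eq: "eintegral M (\<lambda>z. enn2ereal (P z) - enn2ereal (Q z)) = enn2ereal ?d - enn2ereal ?e"
    by (simp add: eintegral_def 1)
  have "(\<integral>\<^sup>+z. (P z - Q z) + Q z \<partial>M) = (\<integral>\<^sup>+z. (Q z - P z) + P z \<partial>M)"
  proof (rule nn_integral_cong)
    have m: "u - v + v = max u v" for u v :: ennreal
      by (cases "v \<le> u") (auto simp: diff_add_cancel_ennreal max_def not_le diff_eq_0_iff_ennreal less_top[symmetric])
    fix z show "P z - Q z + Q z = Q z - P z + P z"
      unfolding m by (rule max.commute)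
  qed
  then have sum: "?d + ?q = ?e + ?p" by (simp add: nn_integral_add)
  have le: "?d \<le> ?p" "?e \<le> ?q" by (intro nn_integral_mono; simp add: diff_le_self_ennreal)+
  show ?thesis using total
  proof
    assume "?p < \<infinity>"
    with le(1) have "?d < \<infinity>" by (rule le_less_trans)
    then show ?thesis unfolding eq using \<open>?p < \<infinity>\<close> sum
      by (cases ?d; cases ?e; cases ?p; cases ?q) (auto simp: ennreal_plus[symmetric] simp del: ennreal_plus)
  next
    assume "?q < \<infinity>"
    with le(2) have "?e < \<infinity>" by (rule le_less_trans)
    then show ?thesis unfolding eq using \<open>?q < \<infinity>\<close> sum
      by (cases ?d; cases ?e; cases ?p; cases ?q) (auto simp: ennreal_plus[symmetric] simp del: ennreal_plus)
  qed
qed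

section \<open>Polar decomposition and the laws of shifted fields\<close>

context homogeneous_functional
begin

text \<open>
  The spectral identity for all measurable maps: they are made \<open>0\<close>-homogeneous by normalizing the path.
\<close>

definition shift_law :: "'m measure \<Rightarrow> ('m \<Rightarrow> real^'l \<Rightarrow> real^'d) \<Rightarrow> bool" where
  "shift_law M \<Theta> \<longleftrightarrow> (\<forall>H\<in>borel_measurable S. \<forall>h\<in>T.
     (\<integral>\<^sup>+\<omega>. kap h (\<Theta> \<omega>) * H (\<Theta> \<omega>) \<partial>M) =
     (\<integral>\<^sup>+\<omega>. indicator (- {0}) (kap (- h) (\<Theta> \<omega>)) *
        (H (normalize (shift T h (\<Theta> \<omega>)) (kap (- h) (\<Theta> \<omega>))) :: ennreal) \<partial>M))"

text \<open>
  The identity defining tail fields, for nonnegative maps; the positive and the negative part of any map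
  are such maps.
\<close>

definition tail_law :: "'m measure \<Rightarrow> ('m \<Rightarrow> real^'l \<Rightarrow> real^'d) \<Rightarrow> bool" where
  "tail_law M Y \<longleftrightarrow> (\<forall>H\<in>borel_measurable S. \<forall>h\<in>T. \<forall>x>0.
     (\<integral>\<^sup>+\<omega>. indicator {1<..} (\<kappa> (fscale T x (shift T h (Y \<omega>)))) * (H (fscale T x (shift T h (Y \<omega>))) :: ennreal) \<partial>M) =
     (\<integral>\<^sup>+\<omega>. ennreal (x powr \<alpha>) * indicator {1<..} (\<kappa> (fscale T (1 / x) (shift T (- h) (Y \<omega>)))) * H (Y \<omega>) \<partial>M))"

end

text \<open>
  A field \<open>Y = R\<Theta>\<close> with the law that it has if \<open>R\<close> is a Pareto variable independent of \<open>\<Theta>\<close>.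
\<close>

locale polar_field = homogeneous_functional T \<kappa> \<alpha> + prob_space M
  for T :: "(real^'l::finite) set"
    and \<kappa> :: "(real^'l \<Rightarrow> real^'d::finite) \<Rightarrow> ennreal"
    and \<alpha> :: real and M :: "'m measure" +
  fixes \<Theta> Y :: "'m \<Rightarrow> real^'l \<Rightarrow> real^'d" and R :: "'m \<Rightarrow> real"
  assumes \<Theta>_kfield: "kfield M \<Theta>" and \<kappa>_\<Theta>: "AE \<omega> in M. \<kappa> (\<Theta> \<omega>) = 1"
    and Y_kfield: "kfield M Y"
    and R_pos: "AE \<omega> in M. 0 < R \<omega>" and Y_eq: "AE \<omega> in M. Y \<omega> = fscale T (R \<omega>) (\<Theta> \<omega>)"
    and Y_law: "\<And>H :: _ \<Rightarrow> ennreal. H \<in> borel_measurable S \<Longrightarrow> (\<integral>\<^sup>+\<omega>. H (Y \<omega>) \<partial>M)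
      = (\<integral>\<^sup>+z. indicator {1<..} z * (\<integral>\<^sup>+\<omega>. H (fscale T z (\<Theta> \<omega>)) \<partial>M) \<partial>pareto_intensity \<alpha>)"
begin

lemma \<Theta>_S[measurable]: "\<Theta> \<in> measurable M S" and Y_S[measurable]: "Y \<in> measurable M S"
  using \<Theta>_kfield Y_kfield by (auto simp: kfield_def)

lemma \<Theta>_in_S: "\<omega> \<in> space M \<Longrightarrow> \<Theta> \<omega> \<in> space S"
  by (rule measurable_space[OF \<Theta>_S])

lemma zfield_measurable: "(\<lambda>p. fscale T (c * fst p) (\<Theta> (snd p))) \<in> measurable (borel \<Otimes>\<^sub>M M) S"
  by (rule fscale_measurable) measurable

lemma zfield_integral_measurable:
  assumes G: "G \<in> borel_measurable S"
  shows "(\<lambda>z. \<integral>\<^sup>+\<omega>. G (fscale T (c * z) (\<Theta> \<omega>)) \<partial>M) \<in> borel_measurable borel"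
  using borel_measurable_nn_integral_fst[OF measurable_compose[OF zfield_measurable G]] by simp

text \<open>
  The identity of the theorem between \<open>Y\<close> and \<open>\<Theta>\<close>, for nonnegative measurable maps.
\<close>

definition spectral_law :: bool where
  "spectral_law \<longleftrightarrow> (\<forall>H\<in>borel_measurable S. \<forall>h\<in>T.
     (\<integral>\<^sup>+z. \<integral>\<^sup>+\<omega>. indicator {1<..} (kap h (fscale T z (\<Theta> \<omega>))) * H (fscale T z (\<Theta> \<omega>)) \<partial>M \<partial>pareto_intensity \<alpha>) =
     (\<integral>\<^sup>+\<omega>. indicator (- {0}) (kap (- h) (Y \<omega>)) * (H (shift T h (Y \<omega>)) :: ennreal) \<partial>M))"

lemma shift_S: "h \<in> T \<Longrightarrow> shift T h \<in> measurable S S"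
  using shift_measurable[OF measurable_ident_sets] by simp

lemma fscale_S: "fscale T c \<in> measurable S S"
  using fscale_measurable[OF measurable_ident_sets, of S "\<lambda>_. c"] by simp

lemma \<kappa>_fscale_shift: "h \<in> T \<Longrightarrow> \<kappa> (fscale T x (shift T (- h) f)) = kap h (fscale T x f)"
  by (simp add: kap_def shift_fscale T_uminus)

lemma \<kappa>_fscale_shift': "h \<in> T \<Longrightarrow> \<kappa> (fscale T x (shift T h f)) = kap (- h) (fscale T x f)"
  by (simp add: kap_def shift_fscale T_uminus)

text \<open>
  The right-hand side of the tail identity, with the law of \<open>Y\<close> inserted and \<open>z/x\<close> as new variable.
\<close>

lemma tail_law_integral:
  assumes x: "0 < x" and h: "h \<in> T" and H[measurable]: "H \<in> borel_measurable S"
  shows "(\<integral>\<^sup>+\<omega>. ennreal (x powr \<alpha>) * indicator {1<..} (\<kappa> (fscale T (1 / x) (shift T (- h) (Y \<omega>)))) * H (fscale T (1 / x) (Y \<omega>)) \<partial>M)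
    = (\<integral>\<^sup>+z. indicator {1 / x<..} z * (\<integral>\<^sup>+\<omega>. indicator {1<..} (kap h (fscale T z (\<Theta> \<omega>))) * H (fscale T z (\<Theta> \<omega>)) \<partial>M) \<partial>pareto_intensity \<alpha>)"
proof -
  note [measurable] = kap_measurable_S[OF h] fscale_S[of "1 / x"]
  define f where "f w = indicator {1 / x<..} w * (\<integral>\<^sup>+\<omega>. indicator {1<..} (kap h (fscale T w (\<Theta> \<omega>))) * H (fscale T w (\<Theta> \<omega>)) \<partial>M)" for w
  have "(\<lambda>z. \<integral>\<^sup>+\<omega>. indicator {1<..} (kap h (fscale T (1 * z) (\<Theta> \<omega>))) * H (fscale T (1 * z) (\<Theta> \<omega>)) \<partial>M) \<in> borel_measurable borel"
    by (rule zfield_integral_measurable) measurable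
  then have f[measurable]: "f \<in> borel_measurable borel" unfolding f_def by simp
  let ?G = "\<lambda>g. indicator {1<..} (kap h (fscale T (1 / x) g)) * H (fscale T (1 / x) g)"
  have G: "?G \<in> borel_measurable S" by measurable
  have "(\<integral>\<^sup>+\<omega>. ennreal (x powr \<alpha>) * indicator {1<..} (\<kappa> (fscale T (1 / x) (shift T (- h) (Y \<omega>)))) * H (fscale T (1 / x) (Y \<omega>)) \<partial>M)
      = (\<integral>\<^sup>+\<omega>. ennreal (x powr \<alpha>) * ?G (Y \<omega>) \<partial>M)"
    by (simp add: \<kappa>_fscale_shift h mult.assoc)
  also have "\<dots> = ennreal (x powr \<alpha>) * (\<integral>\<^sup>+\<omega>. ?G (Y \<omega>) \<partial>M)"
    by (rule nn_integral_cmult) measurable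
  also have "(\<integral>\<^sup>+\<omega>. ?G (Y \<omega>) \<partial>M) = (\<integral>\<^sup>+z. f (1 / x * z) \<partial>pareto_intensity \<alpha>)"
    unfolding Y_law[OF G] f_def fscale_fscale using x
    by (intro nn_integral_cong) (simp add: indicator_def field_simps)
  also have "\<dots> = ennreal ((1 / x) powr \<alpha>) * (\<integral>\<^sup>+z. f z \<partial>pareto_intensity \<alpha>)"
    using x by (intro nn_integral_pareto_intensity_scale \<alpha>_pos f) simp
  finally show ?thesis
    using x by (simp add: f_def mult.assoc[symmetric] ennreal_mult[symmetric] powr_divide)
qed

text \<open>
  The tail identity with scale \<open>x\<close> describes the law of \<open>B\<^sup>hY\<close> on \<open>\<kappa>(B\<^sup>hY) > x\<^sup>-\<^sup>\<alpha>\<close>; now \<open>x \<rightarrow> \<infinity>\<close>.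
\<close>

lemma spectral_law_of_tail_law:
  assumes "tail_law M Y"
  shows spectral_law
  unfolding spectral_law_def
proof (intro ballI)
  fix H :: "(real^'l \<Rightarrow> real^'d) \<Rightarrow> ennreal" and h
  assume H[measurable]: "H \<in> borel_measurable S" and h: "h \<in> T"
  note [measurable] = kap_measurable_S[OF h] kap_measurable_S[OF T_uminus[OF h]] shift_S[OF h]
  define f where "f z = (\<integral>\<^sup>+\<omega>. indicator {1<..} (kap h (fscale T z (\<Theta> \<omega>))) * H (fscale T z (\<Theta> \<omega>)) \<partial>M)" for z
  have "(\<lambda>z. \<integral>\<^sup>+\<omega>. indicator {1<..} (kap h (fscale T (1 * z) (\<Theta> \<omega>))) * H (fscale T (1 * z) (\<Theta> \<omega>)) \<partial>M) \<in> borel_measurable borel"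
    by (rule zfield_integral_measurable) measurable
  then have f[measurable]: "f \<in> borel_measurable borel" unfolding f_def by simp
  have eq: "(\<integral>\<^sup>+\<omega>. indicator {1<..} (ennreal (x powr \<alpha>) * kap (- h) (Y \<omega>)) * H (shift T h (Y \<omega>)) \<partial>M)
      = (\<integral>\<^sup>+z. indicator {1 / x<..} z * f z \<partial>pareto_intensity \<alpha>)" if x: "0 < x" for x
  proof -
    have m: "(\<lambda>g. H (fscale T (1 / x) g)) \<in> borel_measurable S" using fscale_S[of "1 / x"] by measurable
    have "(\<integral>\<^sup>+\<omega>. indicator {1<..} (\<kappa> (fscale T x (shift T h (Y \<omega>)))) * H (fscale T (1 / x) (fscale T x (shift T h (Y \<omega>)))) \<partial>M)
       = (\<integral>\<^sup>+\<omega>. ennreal (x powr \<alpha>) * indicator {1<..} (\<kappa> (fscale T (1 / x) (shift T (- h) (Y \<omega>)))) * H (fscale T (1 / x) (Y \<omega>)) \<partial>M)"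
      by (rule assms[unfolded tail_law_def, rule_format, OF m h x])
    also have "\<dots> = (\<integral>\<^sup>+z. indicator {1 / x<..} z * f z \<partial>pareto_intensity \<alpha>)"
      unfolding f_def by (rule tail_law_integral[OF x h H])
    finally show ?thesis
      using x by (simp add: \<kappa>_fscale_shift' h kap_fscale T_uminus fscale_fscale fscale_one)
  qed
  define x where "x n = real (Suc n)" for n
  have x: "0 < x n" for n by (simp add: x_def)
  have "(\<integral>\<^sup>+z. f z \<partial>pareto_intensity \<alpha>) = (\<integral>\<^sup>+z. (SUP n. indicator {1 / x n<..} z * f z) \<partial>pareto_intensity \<alpha>)"
  proof (rule nn_integral_cong_AE, use AE_pareto_intensity_pos in eventually_elim)
    fix z :: real assume "0 < z"
    then obtain n where n: "1 / x n < z" unfolding x_def using nat_approx_posE by blast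
    show "f z = (SUP n. indicator {1 / x n<..} z * f z)"
      by (rule antisym[OF SUP_upper2[of n] SUP_least]) (use n in \<open>auto simp: indicator_def\<close>)
  qed
  also have "\<dots> = (SUP n. \<integral>\<^sup>+z. indicator {1 / x n<..} z * f z \<partial>pareto_intensity \<alpha>)"
  proof (rule nn_integral_monotone_convergence_SUP)
    have "1 / x n \<le> 1 / x m" if "m \<le> n" for m n using that by (simp add: x_def frac_le)
    then have "indicator {1 / x m<..} z \<le> (indicator {1 / x n<..} z :: ennreal)" if "m \<le> n" for m n z
      using le_less_trans[of "1 / x n" "1 / x m" z] that by (simp add: indicator_def)
    then show "incseq (\<lambda>n z. indicator {1 / x n<..} z * f z)"
      by (auto simp: incseq_def le_fun_def intro!: mult_right_mono)
  qed measurable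
  also have "\<dots> = (SUP n. \<integral>\<^sup>+\<omega>. indicator {1<..} (ennreal (x n powr \<alpha>) * kap (- h) (Y \<omega>)) * H (shift T h (Y \<omega>)) \<partial>M)"
    by (simp add: eq x)
  also have "\<dots> = (\<integral>\<^sup>+\<omega>. (SUP n. indicator {1<..} (ennreal (x n powr \<alpha>) * kap (- h) (Y \<omega>)) * H (shift T h (Y \<omega>))) \<partial>M)"
  proof (rule nn_integral_monotone_convergence_SUP[symmetric])
    have "ennreal (x m powr \<alpha>) * k \<le> ennreal (x n powr \<alpha>) * k" if "m \<le> n" for m n k
      using that \<alpha>_pos by (intro mult_right_mono ennreal_leI powr_mono2) (auto simp: x_def)
    then have "(indicator {1<..} (ennreal (x m powr \<alpha>) * k) :: ennreal) \<le> indicator {1<..} (ennreal (x n powr \<alpha>) * k)"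
      if "m \<le> n" for m n k using that by (auto simp: indicator_def dest: less_le_trans)
    then show "incseq (\<lambda>n \<omega>. indicator {1<..} (ennreal (x n powr \<alpha>) * kap (- h) (Y \<omega>)) * H (shift T h (Y \<omega>)))"
      by (auto simp: incseq_def le_fun_def intro!: mult_right_mono)
  qed measurable
  also have "\<dots> = (\<integral>\<^sup>+\<omega>. indicator (- {0}) (kap (- h) (Y \<omega>)) * H (shift T h (Y \<omega>)) \<partial>M)"
  proof (rule nn_integral_cong)
    fix \<omega>
    let ?k = "kap (- h) (Y \<omega>)"
    show "(SUP n. indicator {1<..} (ennreal (x n powr \<alpha>) * ?k) * H (shift T h (Y \<omega>))) = indicator (- {0}) ?k * H (shift T h (Y \<omega>))"
    proof (cases "?k = 0")
      case False
      have "\<exists>n. 1 < ennreal (x n powr \<alpha>) * ?k"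
      proof (cases ?k)
        case (real r)
        with False have r: "0 < r" by (auto simp: less_le)
        obtain n where n: "(1 / r) powr (1 / \<alpha>) < real n" using reals_Archimedean2 by blast
        have "1 / r = ((1 / r) powr (1 / \<alpha>)) powr \<alpha>" using r \<alpha>_pos by (simp add: powr_powr)
        also have "\<dots> < x n powr \<alpha>" using n \<alpha>_pos by (intro powr_less_mono2) (auto simp: x_def)
        finally have "1 < x n powr \<alpha> * r" using r by (simp add: field_simps)
        then show ?thesis using real r by (intro exI[of _ n]) (simp add: ennreal_mult[symmetric] ennreal_less_iff flip: ennreal_1)
      next
        case top
        then show ?thesis using less_imp_neq[OF x[of 0]] by (intro exI[of _ 0]) (auto simp: ennreal_mult_top)
      qed
      then obtain n where n: "1 < ennreal (x n powr \<alpha>) * ?k" ..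
      show ?thesis
        by (rule antisym[OF SUP_least SUP_upper2[of n]]) (use n False in \<open>auto simp: indicator_def\<close>)
    qed simp
  qed
  finally show "(\<integral>\<^sup>+z. \<integral>\<^sup>+\<omega>. indicator {1<..} (kap h (fscale T z (\<Theta> \<omega>))) * H (fscale T z (\<Theta> \<omega>)) \<partial>M \<partial>pareto_intensity \<alpha>) =
     (\<integral>\<^sup>+\<omega>. indicator (- {0}) (kap (- h) (Y \<omega>)) * H (shift T h (Y \<omega>)) \<partial>M)"
    by (simp add: f_def)
qed

lemma \<kappa>_zfield: "AE \<omega> in M. \<forall>z>0. \<kappa> (fscale T z (\<Theta> \<omega>)) = ennreal (z powr \<alpha>)"
  using \<kappa>_\<Theta> AE_space by eventually_elim (simp add: \<kappa>_fscale \<Theta>_in_S)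

text \<open>
  Restricting the test map to \<open>\<kappa>(xf) > 1\<close> cuts the intensity off at \<open>1/x\<close>, because \<open>\<kappa>(\<Theta>) = 1\<close>.
\<close>

lemma tail_law_of_spectral_law:
  assumes spectral_law
  shows "tail_law M Y"
  unfolding tail_law_def
proof (intro ballI allI impI)
  fix H :: "(real^'l \<Rightarrow> real^'d) \<Rightarrow> ennreal" and h and x :: real
  assume H[measurable]: "H \<in> borel_measurable S" and h: "h \<in> T" and x: "0 < x"
  note [measurable] = kap_measurable_S[OF h] kap_measurable_S[OF T_uminus[OF h]] shift_S[OF h] fscale_S[of x]
  let ?H = "\<lambda>g. indicator {1<..} (\<kappa> (fscale T x g)) * H (fscale T x g)"
  have Hm: "?H \<in> borel_measurable S" by measurable
  have "(\<integral>\<^sup>+\<omega>. indicator {1<..} (\<kappa> (fscale T x (shift T h (Y \<omega>)))) * H (fscale T x (shift T h (Y \<omega>))) \<partial>M)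
      = (\<integral>\<^sup>+\<omega>. indicator (- {0}) (kap (- h) (Y \<omega>)) * ?H (shift T h (Y \<omega>)) \<partial>M)"
    using x by (intro nn_integral_cong) (auto simp: \<kappa>_fscale_shift' h kap_fscale T_uminus indicator_def)
  also have "\<dots> = (\<integral>\<^sup>+z. \<integral>\<^sup>+\<omega>. indicator {1<..} (kap h (fscale T z (\<Theta> \<omega>))) * ?H (fscale T z (\<Theta> \<omega>)) \<partial>M \<partial>pareto_intensity \<alpha>)"
    by (rule assms[unfolded spectral_law_def, rule_format, OF Hm h, symmetric])
  also have "\<dots> = (\<integral>\<^sup>+z. indicator {1 / x<..} z * (\<integral>\<^sup>+\<omega>. indicator {1<..} (kap h (fscale T z (\<Theta> \<omega>))) * H (fscale T x (fscale T z (\<Theta> \<omega>))) \<partial>M) \<partial>pareto_intensity \<alpha>)"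
  proof (rule nn_integral_cong_AE, use AE_pareto_intensity_pos in eventually_elim)
    fix z :: real assume z: "0 < z"
    have iff: "1 < ennreal ((x * z) powr \<alpha>) \<longleftrightarrow> 1 / x < z"
    proof -
      have "1 < (x * z) powr \<alpha> \<longleftrightarrow> 1 < x * z"
        using x z by (intro one_less_powr_iff \<alpha>_pos) simp
      then show ?thesis using x by (simp add: ennreal_less_iff field_simps flip: ennreal_1)
    qed
    have "(\<integral>\<^sup>+\<omega>. indicator {1<..} (kap h (fscale T z (\<Theta> \<omega>))) * ?H (fscale T z (\<Theta> \<omega>)) \<partial>M)
       = (\<integral>\<^sup>+\<omega>. indicator {1 / x<..} z * (indicator {1<..} (kap h (fscale T z (\<Theta> \<omega>))) * H (fscale T x (fscale T z (\<Theta> \<omega>)))) \<partial>M)"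
    proof (rule nn_integral_cong_AE, use \<kappa>_zfield in eventually_elim)
      fix \<omega> assume a: "\<forall>z>0. \<kappa> (fscale T z (\<Theta> \<omega>)) = ennreal (z powr \<alpha>)"
      have "0 < x * z" using x z by simp
      with a have "\<kappa> (fscale T x (fscale T z (\<Theta> \<omega>))) = ennreal ((x * z) powr \<alpha>)"
        unfolding fscale_fscale by blast
      then show "indicator {1<..} (kap h (fscale T z (\<Theta> \<omega>))) * ?H (fscale T z (\<Theta> \<omega>))
        = indicator {1 / x<..} z * (indicator {1<..} (kap h (fscale T z (\<Theta> \<omega>))) * H (fscale T x (fscale T z (\<Theta> \<omega>))))"
        using iff by (simp add: indicator_def)
    qed
    also have "\<dots> = indicator {1 / x<..} z * (\<integral>\<^sup>+\<omega>. indicator {1<..} (kap h (fscale T z (\<Theta> \<omega>))) * H (fscale T x (fscale T z (\<Theta> \<omega>))) \<partial>M)"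
    proof (rule nn_integral_cmult)
      have [measurable]: "(\<lambda>\<omega>. fscale T z (\<Theta> \<omega>)) \<in> measurable M S" by (rule fscale_measurable) simp_all
      show "(\<lambda>\<omega>. indicator {1<..} (kap h (fscale T z (\<Theta> \<omega>))) * H (fscale T x (fscale T z (\<Theta> \<omega>)))) \<in> borel_measurable M"
        using h by measurable
    qed
    finally show "(\<integral>\<^sup>+\<omega>. indicator {1<..} (kap h (fscale T z (\<Theta> \<omega>))) * ?H (fscale T z (\<Theta> \<omega>)) \<partial>M)
       = indicator {1 / x<..} z * (\<integral>\<^sup>+\<omega>. indicator {1<..} (kap h (fscale T z (\<Theta> \<omega>))) * H (fscale T x (fscale T z (\<Theta> \<omega>))) \<partial>M)" .
  qed
  also have "\<dots> = (\<integral>\<^sup>+\<omega>. ennreal (x powr \<alpha>) * indicator {1<..} (\<kappa> (fscale T (1 / x) (shift T (- h) (Y \<omega>)))) * H (fscale T x (fscale T (1 / x) (Y \<omega>))) \<partial>M)"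
    by (rule tail_law_integral[OF x h, symmetric]) measurable
  also have "\<dots> = (\<integral>\<^sup>+\<omega>. ennreal (x powr \<alpha>) * indicator {1<..} (\<kappa> (fscale T (1 / x) (shift T (- h) (Y \<omega>)))) * H (Y \<omega>) \<partial>M)"
    using x measurable_space[OF Y_S] by (intro nn_integral_cong) (simp add: fscale_fscale fscale_one)
  finally show "(\<integral>\<^sup>+\<omega>. indicator {1<..} (\<kappa> (fscale T x (shift T h (Y \<omega>)))) * H (fscale T x (shift T h (Y \<omega>))) \<partial>M) =
     (\<integral>\<^sup>+\<omega>. ennreal (x powr \<alpha>) * indicator {1<..} (\<kappa> (fscale T (1 / x) (shift T (- h) (Y \<omega>)))) * H (Y \<omega>) \<partial>M)" .
qed

text \<open>
  For a test map of the normalized path, the integrand of the spectral law depends on \<open>z\<close> only through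
  \<open>k\<^sub>h(z\<Theta>) > 1\<close>, an event of mass \<open>k\<^sub>h(\<Theta>)\<close> under the Pareto intensity.
\<close>

lemma shift_law_of_spectral_law:
  assumes spectral_law
  shows "shift_law M \<Theta>"
  unfolding shift_law_def
proof (intro ballI)
  fix H :: "(real^'l \<Rightarrow> real^'d) \<Rightarrow> ennreal" and h
  assume H[measurable]: "H \<in> borel_measurable S" and h: "h \<in> T"
  note [measurable] = kap_measurable_S[OF h] kap_measurable_S[OF T_uminus[OF h]] shift_S[OF h]
  let ?H = "\<lambda>g. H (normalize g (\<kappa> g))"
  have nm: "(\<lambda>g. normalize g (\<kappa> g)) \<in> measurable S S"
    by (rule normalize_measurable[OF measurable_ident_sets]) auto
  from measurable_compose[OF this H] have Hm: "?H \<in> borel_measurable S" .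
  interpret P: sigma_finite_measure "pareto_intensity \<alpha>" by (rule sigma_finite_pareto_intensity)
  interpret PM: pair_sigma_finite "pareto_intensity \<alpha>" M ..
  have "(\<integral>\<^sup>+\<omega>. kap h (\<Theta> \<omega>) * H (\<Theta> \<omega>) \<partial>M)
      = (\<integral>\<^sup>+\<omega>. (\<integral>\<^sup>+z. indicator {1<..} (ennreal (z powr \<alpha>) * kap h (\<Theta> \<omega>)) * H (\<Theta> \<omega>) \<partial>pareto_intensity \<alpha>) \<partial>M)"
    by (intro nn_integral_cong, subst nn_integral_multc) (auto simp: pareto_intensity_threshold[OF \<alpha>_pos])
  also have "\<dots> = (\<integral>\<^sup>+z. (\<integral>\<^sup>+\<omega>. indicator {1<..} (ennreal (z powr \<alpha>) * kap h (\<Theta> \<omega>)) * H (\<Theta> \<omega>) \<partial>M) \<partial>pareto_intensity \<alpha>)"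
    by (rule PM.Fubini') measurable
  also have "\<dots> = (\<integral>\<^sup>+z. \<integral>\<^sup>+\<omega>. indicator {1<..} (kap h (fscale T z (\<Theta> \<omega>))) * ?H (fscale T z (\<Theta> \<omega>)) \<partial>M \<partial>pareto_intensity \<alpha>)"
  proof (rule nn_integral_cong_AE, use AE_pareto_intensity_pos in eventually_elim)
    fix z :: real assume z: "0 < z"
    show "(\<integral>\<^sup>+\<omega>. indicator {1<..} (ennreal (z powr \<alpha>) * kap h (\<Theta> \<omega>)) * H (\<Theta> \<omega>) \<partial>M)
       = (\<integral>\<^sup>+\<omega>. indicator {1<..} (kap h (fscale T z (\<Theta> \<omega>))) * ?H (fscale T z (\<Theta> \<omega>)) \<partial>M)"
    proof (rule nn_integral_cong_AE, use \<kappa>_zfield AE_space in eventually_elim)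
      fix \<omega> assume a: "\<forall>z>0. \<kappa> (fscale T z (\<Theta> \<omega>)) = ennreal (z powr \<alpha>)" and "\<omega> \<in> space M"
      then have "normalize (fscale T z (\<Theta> \<omega>)) (\<kappa> (fscale T z (\<Theta> \<omega>))) = \<Theta> \<omega>"
        using normalize_fscale[OF z, of "\<Theta> \<omega>" 1] z by (simp add: normalize_one \<Theta>_in_S)
      then show "indicator {1<..} (ennreal (z powr \<alpha>) * kap h (\<Theta> \<omega>)) * H (\<Theta> \<omega>)
        = indicator {1<..} (kap h (fscale T z (\<Theta> \<omega>))) * ?H (fscale T z (\<Theta> \<omega>))"
        using z h by (simp add: kap_fscale)
    qed
  qed
  also have "\<dots> = (\<integral>\<^sup>+\<omega>. indicator (- {0}) (kap (- h) (Y \<omega>)) * ?H (shift T h (Y \<omega>)) \<partial>M)"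
    by (rule assms[unfolded spectral_law_def, rule_format, OF Hm h])
  also have "\<dots> = (\<integral>\<^sup>+\<omega>. indicator (- {0}) (kap (- h) (\<Theta> \<omega>)) * H (normalize (shift T h (\<Theta> \<omega>)) (kap (- h) (\<Theta> \<omega>))) \<partial>M)"
  proof (rule nn_integral_cong_AE, use R_pos Y_eq in eventually_elim)
    fix \<omega> assume r: "0 < R \<omega>" "Y \<omega> = fscale T (R \<omega>) (\<Theta> \<omega>)"
    have "\<kappa> (shift T h (Y \<omega>)) = ennreal (R \<omega> powr \<alpha>) * kap (- h) (\<Theta> \<omega>)"
      using r h by (simp add: kap_def shift_fscale \<kappa>_fscale)
    moreover have "kap (- h) (Y \<omega>) = ennreal (R \<omega> powr \<alpha>) * kap (- h) (\<Theta> \<omega>)"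
      using r h by (simp add: kap_fscale T_uminus)
    ultimately show "indicator (- {0}) (kap (- h) (Y \<omega>)) * ?H (shift T h (Y \<omega>))
      = indicator (- {0}) (kap (- h) (\<Theta> \<omega>)) * H (normalize (shift T h (\<Theta> \<omega>)) (kap (- h) (\<Theta> \<omega>)))"
      using r h by (simp add: shift_fscale normalize_fscale indicator_def)
  qed
  finally show "(\<integral>\<^sup>+\<omega>. kap h (\<Theta> \<omega>) * H (\<Theta> \<omega>) \<partial>M) =
    (\<integral>\<^sup>+\<omega>. indicator (- {0}) (kap (- h) (\<Theta> \<omega>)) * H (normalize (shift T h (\<Theta> \<omega>)) (kap (- h) (\<Theta> \<omega>))) \<partial>M)" .
qed

end

section \<open>From laws to expectation identities\<close>

lemma nn_integral_restrict_pareto: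
  assumes "f \<in> borel_measurable borel"
  shows "(\<integral>\<^sup>+z. ennreal (\<alpha> * z powr (- \<alpha> - 1)) * f z \<partial>restrict_space lborel {0<..}) = (\<integral>\<^sup>+z. f z \<partial>pareto_intensity \<alpha>)"
  by (subst nn_integral_restrict_space, simp, subst nn_integral_pareto_intensity[OF assms])
     (auto intro!: nn_integral_cong simp: indicator_def)

lemma AE_restrict_pareto:
  assumes "0 < \<alpha>"
  shows "(AE z in restrict_space lborel {0<..}. P z) \<longleftrightarrow> (AE z in pareto_intensity \<alpha>. P z)"
proof -
  have 1: "(AE z in restrict_space lborel {0<..}. P z) \<longleftrightarrow> (AE z in lborel. z \<in> {0<..} \<longrightarrow> P z)"
    by (rule AE_restrict_space_iff) simp
  have 2: "(AE z in pareto_intensity \<alpha>. P z) \<longleftrightarrow>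
      (AE z in lborel. 0 < indicator {0<..} z * ennreal (\<alpha> * z powr (- \<alpha> - 1)) \<longrightarrow> P z)"
    unfolding pareto_intensity_def by (rule AE_density) simp
  have 3: "0 < indicator {0<..} z * ennreal (\<alpha> * z powr (- \<alpha> - 1)) \<longleftrightarrow> z \<in> {0<..}" for z :: real
    using assms by (auto simp: indicator_def)
  show ?thesis unfolding 1 2 3 ..
qed

context homogeneous_functional
begin

lemma enn2ereal_map: "H \<in> borel_measurable S \<Longrightarrow> (\<lambda>f. enn2ereal (H f)) \<in> maps T"
  by (simp add: maps_def)

lemma tail_law_of_eq_expect:
  assumes Y[measurable]: "Y \<in> measurable M S"
    and eq: "\<forall>\<Gamma>\<in>maps T. \<forall>h\<in>T. \<forall>x>0. eq_expect
        M (\<lambda>\<omega>. \<Gamma> (fscale T x (shift T h (Y \<omega>))) * indicator {1<..} (\<kappa> (fscale T x (shift T h (Y \<omega>)))))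
        M (\<lambda>\<omega>. ereal (x powr \<alpha>) *
                 (\<Gamma> (Y \<omega>) * indicator {1<..} (\<kappa> (fscale T (1 / x) (shift T (- h) (Y \<omega>))))))"
  shows "tail_law M Y"
  unfolding tail_law_def
proof (intro ballI allI impI)
  fix H :: "(real^'l \<Rightarrow> real^'d) \<Rightarrow> ennreal" and h and x :: real
  assume H[measurable]: "H \<in> borel_measurable S" and h: "h \<in> T" and x: "0 < x"
  have [measurable]: "(\<lambda>\<omega>. fscale T x (shift T h (Y \<omega>))) \<in> measurable M S"
    by (intro fscale_measurable shift_measurable Y h) simp
  have [measurable]: "(\<lambda>\<omega>. fscale T (1 / x) (shift T (- h) (Y \<omega>))) \<in> measurable M S"
    by (intro fscale_measurable shift_measurable Y T_uminus h) simp
  note e = eq[rule_format, OF enn2ereal_map[OF H] h x]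
  show "(\<integral>\<^sup>+\<omega>. indicator {1<..} (\<kappa> (fscale T x (shift T h (Y \<omega>)))) * H (fscale T x (shift T h (Y \<omega>))) \<partial>M) =
     (\<integral>\<^sup>+\<omega>. ennreal (x powr \<alpha>) * indicator {1<..} (\<kappa> (fscale T (1 / x) (shift T (- h) (Y \<omega>)))) * H (Y \<omega>) \<partial>M)"
  proof (rule nn_integral_eq_of_eq_expect)
    have r: "ereal (x powr \<alpha>) = enn2ereal (ennreal (x powr \<alpha>))" by simp
    show "eq_expect M (\<lambda>\<omega>. enn2ereal (indicator {1<..} (\<kappa> (fscale T x (shift T h (Y \<omega>)))) * H (fscale T x (shift T h (Y \<omega>)))))
      M (\<lambda>\<omega>. enn2ereal (ennreal (x powr \<alpha>) * indicator {1<..} (\<kappa> (fscale T (1 / x) (shift T (- h) (Y \<omega>)))) * H (Y \<omega>)))"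
      using e unfolding indicator_enn2ereal r times_ennreal.rep_eq[symmetric] by (simp only: mult.commute mult.left_commute)
  qed measurable
qed

lemma eq_expect_of_tail_law:
  assumes "tail_law M Y" and \<Gamma>: "\<Gamma> \<in> maps T" and h: "h \<in> T" and x: "0 < x"
  shows "eq_expect
        M (\<lambda>\<omega>. \<Gamma> (fscale T x (shift T h (Y \<omega>))) * indicator {1<..} (\<kappa> (fscale T x (shift T h (Y \<omega>)))))
        M (\<lambda>\<omega>. ereal (x powr \<alpha>) *
                 (\<Gamma> (Y \<omega>) * indicator {1<..} (\<kappa> (fscale T (1 / x) (shift T (- h) (Y \<omega>))))))"
proof -
  have \<Gamma>m: "\<Gamma> \<in> borel_measurable S" using \<Gamma> by (simp add: maps_def)
  have r: "ereal (x powr \<alpha>) = enn2ereal (ennreal (x powr \<alpha>))" by simp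
  have "eintegral M (\<lambda>\<omega>. enn2ereal (indicator {1<..} (\<kappa> (fscale T x (shift T h (Y \<omega>))))) * \<Gamma> (fscale T x (shift T h (Y \<omega>))))
    = eintegral M (\<lambda>\<omega>. enn2ereal (ennreal (x powr \<alpha>) * indicator {1<..} (\<kappa> (fscale T (1 / x) (shift T (- h) (Y \<omega>))))) * \<Gamma> (Y \<omega>))"
    by (rule eintegral_eq_of_law[OF \<Gamma>m]) (rule assms(1)[unfolded tail_law_def, rule_format, OF _ h x])
  then show ?thesis
    unfolding eq_expect_def indicator_enn2ereal r times_ennreal.rep_eq
    by (intro impI) (simp only: mult_ac simp_thms)
qed

lemma kap_expectation_le_1:
  assumes M: "prob_space M" and \<Theta>: "shift_law M \<Theta>" and h: "h \<in> T"
  shows "(\<integral>\<^sup>+\<omega>. kap h (\<Theta> \<omega>) \<partial>M) \<le> 1"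
proof -
  interpret prob_space M by fact
  have "(\<integral>\<^sup>+\<omega>. kap h (\<Theta> \<omega>) \<partial>M) = (\<integral>\<^sup>+\<omega>. indicator (- {0}) (kap (- h) (\<Theta> \<omega>)) \<partial>M)"
    using \<Theta>[unfolded shift_law_def, rule_format, of "\<lambda>_. 1" h] h by simp
  also have "\<dots> \<le> (\<integral>\<^sup>+\<omega>. 1 \<partial>M)" by (intro nn_integral_mono) (simp add: indicator_def)
  finally show ?thesis by (simp add: emeasure_space_1)
qed

lemma kap_AE_finite:
  assumes M: "prob_space M" and m: "\<Theta> \<in> measurable M S" and \<Theta>: "shift_law M \<Theta>" and h: "h \<in> T"
  shows "AE \<omega> in M. kap h (\<Theta> \<omega>) < \<infinity>"
proof -
  have "(\<integral>\<^sup>+\<omega>. kap h (\<Theta> \<omega>) \<partial>M) \<noteq> \<infinity>"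
    using le_less_trans[OF kap_expectation_le_1[OF M \<Theta> h], of \<infinity>] by auto
  from nn_integral_noteq_infinite[OF kap_measurable[OF m h] this] show ?thesis
    by eventually_elim (simp add: less_top)
qed

text \<open>
  Normalizing by \<open>k\<^sub>-\<^sub>h(\<Theta>)\<close> does not change a \<open>0\<close>-homogeneous map where this value is positive and finite.
\<close>

lemma spectral_eq_expect:
  assumes M: "prob_space M" and kf: "kfield M \<Theta>" and sl: "shift_law M \<Theta>"
    and \<Gamma>: "\<Gamma> \<in> int_maps T \<kappa> 0" and h: "h \<in> T"
  shows "eq_expect M (\<lambda>\<omega>. enn2ereal (\<kappa> (shift T (- h) (\<Theta> \<omega>))) * \<Gamma> (\<Theta> \<omega>))
        M (\<lambda>\<omega>. indicator (- {0}) (\<kappa> (shift T h (\<Theta> \<omega>))) * \<Gamma> (shift T h (\<Theta> \<omega>)))"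
proof -
  interpret prob_space M by fact
  note m = kfield_measurable[OF kf]
  define a where "a \<omega> = kap h (\<Theta> \<omega>)" for \<omega>
  define b where "b \<omega> = (indicator (- {0}) (kap (- h) (\<Theta> \<omega>)) :: ennreal)" for \<omega>
  define W where "W \<omega> = normalize (shift T h (\<Theta> \<omega>)) (kap (- h) (\<Theta> \<omega>))" for \<omega>
  have km[measurable]: "(\<lambda>\<omega>. kap (- h) (\<Theta> \<omega>)) \<in> borel_measurable M" by (rule kap_measurable[OF m T_uminus[OF h]])
  have a[measurable]: "a \<in> borel_measurable M" unfolding a_def by (rule kap_measurable[OF m h])
  have b[measurable]: "b \<in> borel_measurable M" unfolding b_def by measurable
  have kW: "kfield M W"
    unfolding W_def by (rule kfield_fdiv[OF kfield_shift[OF kf h]]) measurable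
  have law: "(\<integral>\<^sup>+\<omega>. a \<omega> * H (\<Theta> \<omega>) \<partial>M) = (\<integral>\<^sup>+\<omega>. b \<omega> * H (W \<omega>) \<partial>M)"
    if "H \<in> borel_measurable S" for H :: "_ \<Rightarrow> ennreal"
    unfolding a_def b_def W_def by (rule sl[unfolded shift_law_def, rule_format, OF that h])
  have fa: "finite_measure (density M a)"
    using kap_expectation_le_1[OF M sl h] unfolding a_def[symmetric]
    by (intro finite_measure_density a) (auto intro: le_less_trans)
  have fb: "finite_measure (density M b)"
  proof (rule finite_measure_density[OF b])
    have "(\<integral>\<^sup>+\<omega>. b \<omega> \<partial>M) \<le> (\<integral>\<^sup>+\<omega>. 1 \<partial>M)" by (intro nn_integral_mono) (simp add: b_def indicator_def)
    then show "(\<integral>\<^sup>+\<omega>. b \<omega> \<partial>M) < \<infinity>" by (auto intro: le_less_trans simp: emeasure_space_1)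
  qed
  have "distr (density M a) S \<Theta> = distr (density M b) S W"
    by (rule density_distr_eqI[OF a b m kfield_measurable[OF kW] law])
  from int_map_determined_by_law[OF fa kfield_density[OF kf] fb kfield_density[OF kW] this \<Gamma>]
  obtain G where G: "G \<in> borel_measurable S"
    and G1: "AE \<omega> in density M a. \<Gamma> (\<Theta> \<omega>) = G (\<Theta> \<omega>)" and G2: "AE \<omega> in density M b. \<Gamma> (W \<omega>) = G (W \<omega>)"
    by (elim bexE conjE)
  have hom: "homogeneous T 0 \<Gamma>" using \<Gamma> by (simp add: int_maps_def)
  have "AE \<omega> in M. enn2ereal (\<kappa> (shift T (- h) (\<Theta> \<omega>))) * \<Gamma> (\<Theta> \<omega>) = enn2ereal (a \<omega>) * G (\<Theta> \<omega>)"
    using G1[unfolded AE_density[OF a]]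
  proof eventually_elim
    case (elim \<omega>)
    then show ?case by (cases "a \<omega> = 0") (auto simp: a_def kap_def zero_less_iff_neq_zero zero_ennreal.rep_eq)
  qed
  from eintegral_cong_AE[OF this]
  have 1: "eintegral M (\<lambda>\<omega>. enn2ereal (\<kappa> (shift T (- h) (\<Theta> \<omega>))) * \<Gamma> (\<Theta> \<omega>)) = eintegral M (\<lambda>\<omega>. enn2ereal (a \<omega>) * G (\<Theta> \<omega>))" .
  have "AE \<omega> in M. indicator (- {0}) (\<kappa> (shift T h (\<Theta> \<omega>))) * \<Gamma> (shift T h (\<Theta> \<omega>)) = enn2ereal (b \<omega>) * G (W \<omega>)"
    using G2[unfolded AE_density[OF b]] kap_AE_finite[OF M m sl T_uminus[OF h]]
  proof eventually_elim
    case (elim \<omega>)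
    show ?case
    proof (cases "kap (- h) (\<Theta> \<omega>) = 0")
      case True
      then show ?thesis by (simp add: b_def kap_def zero_ennreal.rep_eq)
    next
      case False
      then have pos: "0 < kap (- h) (\<Theta> \<omega>)" by (simp add: zero_less_iff_neq_zero)
      obtain c where c: "0 < c" "\<And>f. normalize f (kap (- h) (\<Theta> \<omega>)) = fscale T c f"
        by (rule normalize_eq_fscale[OF pos elim(2)]) blast
      have "\<Gamma> (W \<omega>) = \<Gamma> (shift T h (\<Theta> \<omega>))"
        using hom c(1) unfolding W_def c(2) homogeneous_def by (simp add: one_ereal_def[symmetric])
      moreover have "b \<omega> = 1" using False by (simp add: b_def)
      moreover have "\<kappa> (shift T h (\<Theta> \<omega>)) \<noteq> 0" using False by (simp add: kap_def)
      ultimately show ?thesis using elim(1) by (simp add: one_ennreal.rep_eq)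
    qed
  qed
  from eintegral_cong_AE[OF this]
  have 2: "eintegral M (\<lambda>\<omega>. indicator (- {0}) (\<kappa> (shift T h (\<Theta> \<omega>))) * \<Gamma> (shift T h (\<Theta> \<omega>))) = eintegral M (\<lambda>\<omega>. enn2ereal (b \<omega>) * G (W \<omega>))" .
  show ?thesis unfolding eq_expect_def 1 2
    using eintegral_eq_of_law[where a = a and b = b and V = \<Theta> and W = W, OF G law] by simp
qed

text \<open>
  Such a weight makes the constant one an integral map, as a quotient of two equal integrals.
\<close>

lemma positive_weight_exists:
  shows "\<exists>g\<in>weights T. (\<integral>\<^sup>+t. ennreal (g t) \<partial>index_measure T) \<noteq> 0 \<and> (\<integral>\<^sup>+t. ennreal (g t) \<partial>index_measure T) < \<infinity>"
proof -
  interpret I: sigma_finite_measure "index_measure T" by (rule sigma_finite_index_measure)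
  obtain h where h: "h \<in> borel_measurable (index_measure T)" "integral\<^sup>N (index_measure T) h \<noteq> \<infinity>"
    "\<forall>x\<in>space (index_measure T). 0 < h x \<and> h x < \<infinity>"
    using I.Ex_finite_integrable_function by blast
  define g where "g t = min 1 (enn2real (h t))" for t
  have gm[measurable]: "g \<in> borel_measurable (index_measure T)"
    unfolding g_def using h(1) by measurable
  have gpos: "0 < g t" if "t \<in> T" for t
    using h(3) that by (auto simp: g_def enn2real_positive_iff)
  have gle: "ennreal (g t) \<le> h t" if "t \<in> T" for t
  proof -
    have "h t < \<infinity>" using h(3) that by simp
    then obtain r where "h t = ennreal r" "0 \<le> r" by (cases "h t") auto
    then show ?thesis by (simp add: g_def ennreal_leI)
  qed
  have "(\<integral>\<^sup>+t. ennreal (g t) \<partial>index_measure T) \<le> integral\<^sup>N (index_measure T) h"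
    by (rule nn_integral_mono) (simp add: gle)
  then have fin: "(\<integral>\<^sup>+t. ennreal (g t) \<partial>index_measure T) < \<infinity>"
    using h(2) by (auto simp: less_top[symmetric] top_unique)
  have nz: "(\<integral>\<^sup>+t. ennreal (g t) \<partial>index_measure T) \<noteq> 0"
  proof
    assume "(\<integral>\<^sup>+t. ennreal (g t) \<partial>index_measure T) = 0"
    then have "AE t in index_measure T. ennreal (g t) = 0" by (subst (asm) nn_integral_0_iff_AE) auto
    with AE_space have "AE t in index_measure T. False"
      by eventually_elim (use gpos in force)
    from cube_points_AE_dense[OF this T_zero, of 1] show False by (simp add: cube_def)
  qed
  have ae: "T = UNIV \<longrightarrow> (AE t in lebesgue. 0 < g t)" using gpos by simp
  have "g \<in> weights T"
    unfolding weights_def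
    by (intro CollectI conjI gm ae ballI allI impI exI[of _ 1]) (auto simp: gpos less_imp_le, simp add: g_def)
  then show ?thesis using nz fin by blast
qed

text \<open>
  So the identity for star maps contains an identity of laws.
\<close>

lemma nonneg_star_map:
  assumes H: "H \<in> borel_measurable S"
  shows "(\<lambda>f. enn2ereal (H f)) \<in> star_maps T \<kappa>"
proof -
  obtain g where g: "g \<in> weights T" "(\<integral>\<^sup>+t. ennreal (g t) \<partial>index_measure T) \<noteq> 0"
    "(\<integral>\<^sup>+t. ennreal (g t) \<partial>index_measure T) < \<infinity>" using positive_weight_exists by blast
  have gm: "g \<in> borel_measurable (index_measure T)" using g by (simp add: weights_def)
  have kf: "kint_fun T \<kappa> 0 g f = (\<lambda>t. ennreal (g t))" for f by (simp add: kint_fun_def epowr_def)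
  have k: "kint T \<kappa> 0 g f = (\<integral>\<^sup>+t. ennreal (g t) \<partial>index_measure T)" for f by (simp add: kint_def kf)
  obtain r where r: "(\<integral>\<^sup>+t. ennreal (g t) \<partial>index_measure T) = ennreal r" "0 < r"
    using g(2,3) by (cases "\<integral>\<^sup>+t. ennreal (g t) \<partial>index_measure T") (auto simp: less_le)
  have one_hom: "(\<lambda>_ :: real^'l \<Rightarrow> real^'d. 1) \<in> hom_maps T 0"
    by (simp add: hom_maps_def maps_def homogeneous_def one_ereal_def)
  have "(\<lambda>_. 1) \<in> int_maps T \<kappa> 0"
    unfolding int_maps_def
  proof (intro CollectI conjI)
    show "homogeneous T 0 (\<lambda>_ :: real^'l \<Rightarrow> real^'d. 1)" using one_hom by (simp add: hom_maps_def)
    show "\<exists>\<Gamma> \<xi>\<^sub>0 \<xi>\<^sub>1 \<xi>\<^sub>2 \<xi>\<^sub>3 g\<^sub>1 g\<^sub>2 g\<^sub>3 A.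
        \<Gamma> \<in> hom_maps T \<xi>\<^sub>0 \<and> g\<^sub>1 \<in> weights T \<and> g\<^sub>2 \<in> weights T \<and> g\<^sub>3 \<in> weights T \<and> A \<in> sets borel \<and>
        (\<forall>f\<in>space (path_space T). 1 =
           (if kint_fun T \<kappa> \<xi>\<^sub>1 g\<^sub>1 f \<in> borel_measurable (index_measure T) \<and>
               kint_fun T \<kappa> \<xi>\<^sub>2 g\<^sub>2 f \<in> borel_measurable (index_measure T) \<and>
               kint_fun T \<kappa> \<xi>\<^sub>3 g\<^sub>3 f \<in> borel_measurable (index_measure T)
            then \<Gamma> f * enn2ereal (kint T \<kappa> \<xi>\<^sub>1 g\<^sub>1 f) * indicator A (kint T \<kappa> \<xi>\<^sub>2 g\<^sub>2 f)
                   / enn2ereal (kint T \<kappa> \<xi>\<^sub>3 g\<^sub>3 f)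
            else 0))"
    proof (intro exI conjI ballI)
      fix f :: "real^'l \<Rightarrow> real^'d"
      show "1 =
           (if kint_fun T \<kappa> 0 g f \<in> borel_measurable (index_measure T) \<and>
               kint_fun T \<kappa> 0 g f \<in> borel_measurable (index_measure T) \<and>
               kint_fun T \<kappa> 0 g f \<in> borel_measurable (index_measure T)
            then 1 * enn2ereal (kint T \<kappa> 0 g f) * indicator UNIV (kint T \<kappa> 0 g f)
                   / enn2ereal (kint T \<kappa> 0 g f)
            else 0)"
        using gm r by (simp add: kf k one_ereal_def)
    qed (use one_hom g(1) in auto)
  qed
  moreover have "(\<lambda>f. enn2ereal (H f)) \<in> maps T" by (rule enn2ereal_map[OF H])
  ultimately show ?thesis unfolding star_maps_def
    by (intro CollectI exI[of _ 0] conjI bexI[of _ "\<lambda>_. 1"] bexI[of _ "\<lambda>f. enn2ereal (H f)"]) auto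
qed

end

context polar_field
begin

text \<open>
  Both sides integrate \<open>\<Gamma>\<close> over fields with the same finite law on the path space, so that \<open>\<Gamma>\<close> may be
  replaced by a measurable map \<open>G\<close>.
\<close>

lemma tail_spectral_identity_of_spectral_law:
  assumes sp: spectral_law
  shows "tail_spectral_identity T \<kappa> \<alpha> M \<Theta> Y"
  unfolding tail_spectral_identity_def Let_def
proof (intro ballI impI)
  fix \<Gamma> h assume \<Gamma>: "\<Gamma> \<in> star_maps T \<kappa>" and h: "h \<in> T"
  let ?X = "\<lambda>z \<omega>. \<Gamma> (fscale T z (\<Theta> \<omega>)) * indicator {1<..} (\<kappa> (fscale T z (shift T (- h) (\<Theta> \<omega>))))"
  assume "AE z in restrict_space lborel {0<..}. eintegral_exists M (?X z)"
  then have ex: "AE z in pareto_intensity \<alpha>. eintegral_exists M (?X z)"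
    unfolding AE_restrict_pareto[OF \<alpha>_pos] .
  let ?P = "pareto_intensity \<alpha> \<Otimes>\<^sub>M M"
  interpret P: sigma_finite_measure "pareto_intensity \<alpha>" by (rule sigma_finite_pareto_intensity)
  interpret PM: pair_sigma_finite "pareto_intensity \<alpha>" M ..
  \<comment> \<open>scales below 0 are a null set; cutting them off keeps V jointly measurable\<close>
  define V where "V p = fscale T (max (fst p) 0) (\<Theta> (snd p))" for p
  define W where "W \<omega> = shift T h (Y \<omega>)" for \<omega>
  define a where "a p = (indicator {1<..} (kap h (V p)) :: ennreal)" for p
  define b where "b \<omega> = (indicator (- {0}) (kap (- h) (Y \<omega>)) :: ennreal)" for \<omega>
  have kV: "kfield ?P V"
    unfolding V_def by (rule kfield_fscale[OF kfield_compose[OF \<Theta>_kfield measurable_snd]]) auto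
  have kW: "kfield M W" unfolding W_def by (rule kfield_shift[OF Y_kfield h])
  note Vm[measurable] = kfield_measurable[OF kV]
  have [measurable]: "(\<lambda>p. kap h (V p)) \<in> borel_measurable ?P" by (rule kap_measurable[OF Vm h])
  have a[measurable]: "a \<in> borel_measurable ?P" unfolding a_def by measurable
  have [measurable]: "(\<lambda>\<omega>. kap (- h) (Y \<omega>)) \<in> borel_measurable M" by (rule kap_measurable[OF Y_S T_uminus[OF h]])
  have b[measurable]: "b \<in> borel_measurable M" unfolding b_def by measurable
  have iter: "(\<integral>\<^sup>+p. a p * H (V p) \<partial>?P) = (\<integral>\<^sup>+z. \<integral>\<^sup>+\<omega>. a (z, \<omega>) * H (V (z, \<omega>)) \<partial>M \<partial>pareto_intensity \<alpha>)"
    if [measurable]: "H \<in> borel_measurable S" for H :: "_ \<Rightarrow> ennreal"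
    by (rule nn_integral_fst[symmetric]) measurable
  have law: "(\<integral>\<^sup>+p. a p * H (V p) \<partial>?P) = (\<integral>\<^sup>+\<omega>. b \<omega> * H (W \<omega>) \<partial>M)"
    if H: "H \<in> borel_measurable S" for H :: "_ \<Rightarrow> ennreal"
  proof -
    have "(\<integral>\<^sup>+p. a p * H (V p) \<partial>?P)
      = (\<integral>\<^sup>+z. \<integral>\<^sup>+\<omega>. indicator {1<..} (kap h (fscale T z (\<Theta> \<omega>))) * H (fscale T z (\<Theta> \<omega>)) \<partial>M \<partial>pareto_intensity \<alpha>)"
      unfolding iter[OF H]
      by (rule nn_integral_cong_AE, use AE_pareto_intensity_pos in eventually_elim) (simp add: a_def V_def max_def)
    then show ?thesis
      unfolding b_def W_def using sp[unfolded spectral_law_def, rule_format, OF H h] by simp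
  qed
  have b_int: "(\<integral>\<^sup>+\<omega>. b \<omega> \<partial>M) < \<infinity>"
  proof -
    have "(\<integral>\<^sup>+\<omega>. b \<omega> \<partial>M) \<le> (\<integral>\<^sup>+\<omega>. 1 \<partial>M)" by (intro nn_integral_mono) (simp add: b_def indicator_def)
    then show ?thesis by (auto intro: le_less_trans simp: emeasure_space_1)
  qed
  have fb: "finite_measure (density M b)" by (rule finite_measure_density[OF b b_int])
  have fa: "finite_measure (density ?P a)"
    using law[of "\<lambda>_. 1"] b_int by (intro finite_measure_density[OF a]) simp
  have "distr (density ?P a) S V = distr (density M b) S W"
    by (rule density_distr_eqI[OF a b Vm kfield_measurable[OF kW] law])
  from star_map_determined_by_law[OF fa kfield_density[OF kV] fb kfield_density[OF kW] this \<Gamma>]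
  obtain G where G[measurable]: "G \<in> borel_measurable S"
    and G1: "AE p in density ?P a. \<Gamma> (V p) = G (V p)" and G2: "AE \<omega> in density M b. \<Gamma> (W \<omega>) = G (W \<omega>)"
    by (elim bexE conjE)
  define F where "F z = (\<integral>\<^sup>+\<omega>. a (z, \<omega>) * e2ennreal (G (V (z, \<omega>))) \<partial>M)" for z
  define F' where "F' z = (\<integral>\<^sup>+\<omega>. a (z, \<omega>) * e2ennreal (- G (V (z, \<omega>))) \<partial>M)" for z
  have Gp: "(\<lambda>f. e2ennreal (G f)) \<in> borel_measurable S" and Gn: "(\<lambda>f. e2ennreal (- G f)) \<in> borel_measurable S"
    by measurable
  have Fm: "F \<in> borel_measurable borel" "F' \<in> borel_measurable borel"
    unfolding F_def F'_def
    using borel_measurable_nn_integral_fst[of "\<lambda>p. a p * e2ennreal (G (V p))" "pareto_intensity \<alpha>"]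
      borel_measurable_nn_integral_fst[of "\<lambda>p. a p * e2ennreal (- G (V p))" "pareto_intensity \<alpha>"]
    by simp_all
  have "AE z in pareto_intensity \<alpha>. AE \<omega> in M. 0 < a (z, \<omega>) \<longrightarrow> \<Gamma> (V (z, \<omega>)) = G (V (z, \<omega>))"
    using PM.AE_pair[OF G1[unfolded AE_density[OF a]]] .
  with AE_pareto_intensity_pos[of \<alpha>]
  have X_eq: "AE z in pareto_intensity \<alpha>. AE \<omega> in M. ?X z \<omega> = enn2ereal (a (z, \<omega>)) * G (V (z, \<omega>))"
  proof eventually_elim
    case (elim z)
    from elim(2) show ?case
    proof eventually_elim
      case e: (elim \<omega>)
      have v: "V (z, \<omega>) = fscale T z (\<Theta> \<omega>)" using elim(1) by (simp add: V_def)
      have "(indicator {1<..} (\<kappa> (fscale T z (shift T (- h) (\<Theta> \<omega>)))) :: ereal) = enn2ereal (a (z, \<omega>))"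
        by (simp add: a_def indicator_enn2ereal[symmetric] v \<kappa>_fscale_shift h)
      then show ?case using e v
        by (cases "a (z, \<omega>) = 0") (auto simp: zero_less_iff_neq_zero zero_ennreal.rep_eq mult.commute)
    qed
  qed
  have pos_neg: "AE z in pareto_intensity \<alpha>. (\<integral>\<^sup>+\<omega>. e2ennreal (?X z \<omega>) \<partial>M) = F z \<and> (\<integral>\<^sup>+\<omega>. e2ennreal (- ?X z \<omega>) \<partial>M) = F' z"
    using X_eq
  proof eventually_elim
    case (elim z)
    have "(\<integral>\<^sup>+\<omega>. e2ennreal (?X z \<omega>) \<partial>M) = F z" unfolding F_def
      by (rule nn_integral_cong_AE, use elim in eventually_elim) (simp only: e2ennreal_enn2ereal_times)
    moreover have "(\<integral>\<^sup>+\<omega>. e2ennreal (- ?X z \<omega>) \<partial>M) = F' z" unfolding F'_def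
      by (rule nn_integral_cong_AE, use elim in eventually_elim) (simp only: e2ennreal_uminus_enn2ereal_times)
    ultimately show ?case ..
  qed
  have fin: "AE z in pareto_intensity \<alpha>. F z < \<infinity> \<or> F' z < \<infinity>"
    using ex pos_neg by eventually_elim (simp add: eintegral_exists_def)
  have tot: "(\<integral>\<^sup>+z. F z \<partial>pareto_intensity \<alpha>) = (\<integral>\<^sup>+\<omega>. b \<omega> * e2ennreal (G (W \<omega>)) \<partial>M)"
    "(\<integral>\<^sup>+z. F' z \<partial>pareto_intensity \<alpha>) = (\<integral>\<^sup>+\<omega>. b \<omega> * e2ennreal (- G (W \<omega>)) \<partial>M)"
    unfolding F_def F'_def iter[OF Gp, symmetric] iter[OF Gn, symmetric] by (rule law[OF Gp], rule law[OF Gn])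
  let ?R = "\<lambda>\<omega>. \<Gamma> (shift T h (Y \<omega>)) * indicator (- {0}) (\<kappa> (shift T h (Y \<omega>)))"
  let ?L = "\<lambda>z. eintegral M (?X z) * ereal (\<alpha> * z powr (- \<alpha> - 1))"
  have R_eq: "AE \<omega> in M. ?R \<omega> = enn2ereal (b \<omega>) * G (W \<omega>)"
    using G2[unfolded AE_density[OF b]]
  proof eventually_elim
    case (elim \<omega>)
    have "(indicator (- {0}) (\<kappa> (shift T h (Y \<omega>))) :: ereal) = enn2ereal (b \<omega>)"
      by (simp add: b_def indicator_enn2ereal[symmetric] kap_def)
    then show ?case using elim
      by (cases "b \<omega> = 0") (auto simp: zero_less_iff_neq_zero zero_ennreal.rep_eq mult.commute W_def)
  qed
  have R: "(\<integral>\<^sup>+\<omega>. e2ennreal (?R \<omega>) \<partial>M) = (\<integral>\<^sup>+\<omega>. b \<omega> * e2ennreal (G (W \<omega>)) \<partial>M)"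
    "(\<integral>\<^sup>+\<omega>. e2ennreal (- ?R \<omega>) \<partial>M) = (\<integral>\<^sup>+\<omega>. b \<omega> * e2ennreal (- G (W \<omega>)) \<partial>M)"
    by (rule nn_integral_cong_AE, use R_eq in eventually_elim, simp only: e2ennreal_enn2ereal_times e2ennreal_uminus_enn2ereal_times)+
  show "eq_expect (restrict_space lborel {0<..}) ?L M ?R"
    unfolding eq_expect_def
  proof (intro impI, elim conjE)
    assume "eintegral_exists M ?R"
    then have total: "(\<integral>\<^sup>+z. F z \<partial>pareto_intensity \<alpha>) < \<infinity> \<or> (\<integral>\<^sup>+z. F' z \<partial>pareto_intensity \<alpha>) < \<infinity>"
      unfolding eintegral_exists_def R tot by blast
    let ?D = "\<lambda>z. enn2ereal (F z) - enn2ereal (F' z)"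
    have Dm: "(\<lambda>z. e2ennreal (?D z)) \<in> borel_measurable borel" "(\<lambda>z. e2ennreal (- ?D z)) \<in> borel_measurable borel"
      using Fm by measurable
    have "AE z in restrict_space lborel {0<..}. ?L z = enn2ereal (ennreal (\<alpha> * z powr (- \<alpha> - 1))) * ?D z"
      unfolding AE_restrict_pareto[OF \<alpha>_pos] using pos_neg
    proof eventually_elim
      case (elim z)
      then have "eintegral M (?X z) = ?D z" by (simp add: eintegral_def)
      then show ?case using \<alpha>_pos by (simp add: mult.commute)
    qed
    from eintegral_cong_AE[OF this]
    have "eintegral (restrict_space lborel {0<..}) ?L
      = eintegral (restrict_space lborel {0<..}) (\<lambda>z. enn2ereal (ennreal (\<alpha> * z powr (- \<alpha> - 1))) * ?D z)" .
    also have "\<dots> = eintegral (pareto_intensity \<alpha>) ?D"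
      unfolding eintegral_weighted nn_integral_restrict_pareto[OF Dm(1)] nn_integral_restrict_pareto[OF Dm(2)]
      by (simp add: eintegral_def)
    also have "\<dots> = enn2ereal (\<integral>\<^sup>+z. F z \<partial>pareto_intensity \<alpha>) - enn2ereal (\<integral>\<^sup>+z. F' z \<partial>pareto_intensity \<alpha>)"
      using Fm by (intro eintegral_integral_difference fin total) simp_all
    also have "\<dots> = eintegral M ?R" unfolding tot R[symmetric] eintegral_def ..
    finally show "eintegral (restrict_space lborel {0<..}) ?L = eintegral M ?R" .
  qed
qed

lemma spectral_law_of_tail_spectral_identity:
  assumes "tail_spectral_identity T \<kappa> \<alpha> M \<Theta> Y"
  shows spectral_law
  unfolding spectral_law_def
proof (intro ballI)
  fix H :: "(real^'l \<Rightarrow> real^'d) \<Rightarrow> ennreal" and h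
  assume H[measurable]: "H \<in> borel_measurable S" and h: "h \<in> T"
  note [measurable] = kap_measurable_S[OF h] kap_measurable_S[OF T_uminus[OF h]] shift_S[OF h]
  let ?X = "\<lambda>z \<omega>. enn2ereal (H (fscale T z (\<Theta> \<omega>))) * indicator {1<..} (\<kappa> (fscale T z (shift T (- h) (\<Theta> \<omega>))))"
  let ?x = "\<lambda>z \<omega>. indicator {1<..} (kap h (fscale T z (\<Theta> \<omega>))) * H (fscale T z (\<Theta> \<omega>))"
  define F where "F z = (\<integral>\<^sup>+\<omega>. ?x z \<omega> \<partial>M)" for z
  have X: "?X z \<omega> = enn2ereal (?x z \<omega>)" for z \<omega>
    by (simp add: indicator_enn2ereal times_ennreal.rep_eq[symmetric] \<kappa>_fscale_shift h mult.commute)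
  have L: "eintegral M (?X z) = enn2ereal (F z)" for z
    unfolding X F_def by (subst eintegral_nonneg) simp_all
  have xm: "?x z \<in> borel_measurable M" for z
  proof -
    have [measurable]: "(\<lambda>\<omega>. fscale T z (\<Theta> \<omega>)) \<in> measurable M S" by (rule fscale_measurable) simp_all
    show ?thesis by measurable
  qed
  have Fm: "F \<in> borel_measurable borel"
    unfolding F_def using zfield_integral_measurable[of "\<lambda>f. indicator {1<..} (kap h f) * H f" 1] by simp
  have ex: "AE z in restrict_space lborel {0<..}. eintegral_exists M (?X z)"
    unfolding X by (intro always_eventually allI eintegral_exists_nonneg) (use xm in simp_all)
  have "eq_expect (restrict_space lborel {0<..}) (\<lambda>z. eintegral M (?X z) * ereal (\<alpha> * z powr (- \<alpha> - 1)))
        M (\<lambda>\<omega>. enn2ereal (H (shift T h (Y \<omega>))) * indicator (- {0}) (\<kappa> (shift T h (Y \<omega>))))"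
    using assms[unfolded tail_spectral_identity_def Let_def, rule_format, OF nonneg_star_map[OF H] h ex] .
  also have "(\<lambda>z. eintegral M (?X z) * ereal (\<alpha> * z powr (- \<alpha> - 1))) = (\<lambda>z. enn2ereal (ennreal (\<alpha> * z powr (- \<alpha> - 1)) * F z))"
    using \<alpha>_pos by (simp add: L times_ennreal.rep_eq mult.commute)
  also have "(\<lambda>\<omega>. enn2ereal (H (shift T h (Y \<omega>))) * indicator (- {0}) (\<kappa> (shift T h (Y \<omega>))))
     = (\<lambda>\<omega>. enn2ereal (indicator (- {0}) (kap (- h) (Y \<omega>)) * H (shift T h (Y \<omega>))))"
    by (simp add: indicator_enn2ereal times_ennreal.rep_eq[symmetric] kap_def mult.commute)
  finally have e: "eq_expect (restrict_space lborel {0<..}) (\<lambda>z. enn2ereal (ennreal (\<alpha> * z powr (- \<alpha> - 1)) * F z))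
     M (\<lambda>\<omega>. enn2ereal (indicator (- {0}) (kap (- h) (Y \<omega>)) * H (shift T h (Y \<omega>))))" .
  have m: "(\<lambda>z. ennreal (\<alpha> * z powr (- \<alpha> - 1)) * F z) \<in> borel_measurable (restrict_space lborel {0<..})"
    using Fm by (intro measurable_restrict_space1) measurable
  have "(\<integral>\<^sup>+z. ennreal (\<alpha> * z powr (- \<alpha> - 1)) * F z \<partial>restrict_space lborel {0<..})
      = (\<integral>\<^sup>+\<omega>. indicator (- {0}) (kap (- h) (Y \<omega>)) * H (shift T h (Y \<omega>)) \<partial>M)"
    by (rule nn_integral_eq_of_eq_expect[OF m _ e]) measurable
  from this[unfolded nn_integral_restrict_pareto[OF Fm]]
  show "(\<integral>\<^sup>+z. \<integral>\<^sup>+\<omega>. ?x z \<omega> \<partial>M \<partial>pareto_intensity \<alpha>) =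
     (\<integral>\<^sup>+\<omega>. indicator (- {0}) (kap (- h) (Y \<omega>)) * H (shift T h (Y \<omega>)) \<partial>M)"
    unfolding F_def .
qed

end

section \<open>Mixing the shifts of a spectral field\<close>

text \<open>
  The index of the shift is drawn from the density \<open>p\<close> on the rational points.
\<close>

locale mixed_field = homogeneous_functional T \<kappa> \<alpha> + prob_space M
  for T :: "(real^'l::finite) set"
    and \<kappa> :: "(real^'l \<Rightarrow> real^'d::finite) \<Rightarrow> ennreal"
    and \<alpha> :: real and M :: "'m measure" +
  fixes \<Theta> :: "'m \<Rightarrow> real^'l \<Rightarrow> real^'d" and p :: "real^'l \<Rightarrow> real"
  assumes \<Theta>_field: "random_field T \<kappa> M \<Theta>" and \<kappa>_\<Theta>: "AE \<omega> in M. \<kappa> (\<Theta> \<omega>) = 1"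
    and \<Theta>_shift: "shift_law M \<Theta>"
    and p_pos: "p \<in> pos_summable T"
    and p_prob: "prob_space (density (count_space (rat_points T)) (\<lambda>r. ennreal (p r)))"
begin

abbreviation K :: "(real^'l) measure" where "K \<equiv> density (count_space (rat_points T)) (\<lambda>r. ennreal (p r))"

definition D :: "real^'l \<Rightarrow> (real^'l \<Rightarrow> real^'d) \<Rightarrow> ennreal" where
  "D h f = (\<integral>\<^sup>+r. kap (r - h) f * ennreal (p r) \<partial>count_space (rat_points T))"

definition Z :: "'m \<times> (real^'l) \<Rightarrow> real^'l \<Rightarrow> real^'d" where
  "Z = (\<lambda>(\<omega>, n). normalize (shift T n (\<Theta> \<omega>)) (D n (\<Theta> \<omega>)))"

text \<open>
  Random fields live on complete probability spaces.
\<close>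

definition N :: "('m \<times> (real^'l)) measure" where
  "N = completion (M \<Otimes>\<^sub>M K)"

lemma \<Theta>_kfield: "kfield M \<Theta>" and \<Theta>_S[measurable]: "\<Theta> \<in> measurable M S"
  using random_fieldD[OF \<Theta>_field] by auto

lemma \<Theta>_in_S: "\<omega> \<in> space M \<Longrightarrow> \<Theta> \<omega> \<in> space S"
  by (rule measurable_space[OF \<Theta>_S])

lemma kap_0_\<Theta>: "AE \<omega> in M. kap 0 (\<Theta> \<omega>) = 1"
  using \<kappa>_\<Theta> AE_space by eventually_elim (simp add: kap_zero \<Theta>_in_S)

lemma sets_K: "sets K = sets (count_space (rat_points T))" by simp

sublocale K: prob_space K by (rule p_prob)

sublocale MK: pair_prob_space M K ..

lemma MK_measurable:
  assumes "\<And>n. n \<in> rat_points T \<Longrightarrow> f n \<in> measurable M L"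
  shows "(\<lambda>x. f (snd x) (fst x)) \<in> measurable (M \<Otimes>\<^sub>M K) L"
proof (rule measurable_compose_countable'[where g = snd, OF _ _ countable_rat_points])
  show "snd \<in> measurable (M \<Otimes>\<^sub>M K) (count_space (rat_points T))"
    using measurable_snd[of M K] unfolding measurable_cong_sets[OF refl sets_K] .
  show "(\<lambda>x. f n (fst x)) \<in> measurable (M \<Otimes>\<^sub>M K) L" if "n \<in> rat_points T" for n
    by (rule measurable_compose[OF measurable_fst assms[OF that]])
qed

lemma D_measurable:
  assumes h: "h \<in> T"
  shows "D h \<in> borel_measurable S"
proof -
  interpret C: sigma_finite_measure "count_space (rat_points T)"
    by (rule sigma_finite_measure_count_space_countable[OF countable_rat_points])
  have "(\<lambda>x. kap (snd x - h) (fst x) * ennreal (p (snd x))) \<in> borel_measurable (S \<Otimes>\<^sub>M count_space (rat_points T))"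
  proof (rule measurable_compose_countable'[where g = snd, OF _ _ countable_rat_points])
    fix r assume "r \<in> rat_points T"
    then have "r - h \<in> T" using T_diff[OF rat_points_subset h] by blast
    from kap_measurable_S[OF this]
    show "(\<lambda>x. kap (r - h) (fst x) * ennreal (p r)) \<in> borel_measurable (S \<Otimes>\<^sub>M count_space (rat_points T))" by measurable
  qed measurable
  from C.borel_measurable_nn_integral_fst[OF this] show ?thesis
    by (simp add: D_def[abs_def])
qed

lemma D_\<Theta>_measurable: "h \<in> T \<Longrightarrow> (\<lambda>\<omega>. D h (\<Theta> \<omega>)) \<in> borel_measurable M"
  by (rule measurable_compose[OF \<Theta>_S D_measurable])

text \<open>
  The values of \<open>\<Theta>\<close> at fixed positions have mean at most one, and \<open>p\<close> is summable.
\<close>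

lemma D_AE_finite:
  assumes h: "h \<in> T"
  shows "AE \<omega> in M. D h (\<Theta> \<omega>) < \<infinity>"
proof -
  interpret C: sigma_finite_measure "count_space (rat_points T)"
    by (rule sigma_finite_measure_count_space_countable[OF countable_rat_points])
  interpret CM: pair_sigma_finite M "count_space (rat_points T)" ..
  have km: "(\<lambda>\<omega>. kap (r - h) (\<Theta> \<omega>) * ennreal (p r)) \<in> borel_measurable M" if "r \<in> rat_points T" for r
    using kap_measurable[OF \<Theta>_S T_diff[OF rat_points_subset[OF that] h]] by measurable
  have m: "(\<lambda>x. kap (snd x - h) (\<Theta> (fst x)) * ennreal (p (snd x))) \<in> borel_measurable (M \<Otimes>\<^sub>M count_space (rat_points T))"
    by (rule measurable_compose_countable'[where g = snd, OF measurable_compose[OF measurable_fst km] measurable_snd countable_rat_points])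
  have "(\<integral>\<^sup>+\<omega>. D h (\<Theta> \<omega>) \<partial>M) = (\<integral>\<^sup>+r. \<integral>\<^sup>+\<omega>. kap (r - h) (\<Theta> \<omega>) * ennreal (p r) \<partial>M \<partial>count_space (rat_points T))"
    unfolding D_def using CM.Fubini[OF m] by simp
  also have "\<dots> \<le> (\<integral>\<^sup>+r. ennreal (p r) \<partial>count_space (rat_points T))"
  proof (rule nn_integral_mono)
    fix r assume "r \<in> space (count_space (rat_points T))"
    then have r: "r \<in> rat_points T" by simp
    have rh: "r - h \<in> T" by (rule T_diff[OF rat_points_subset[OF r] h])
    have "(\<integral>\<^sup>+\<omega>. kap (r - h) (\<Theta> \<omega>) * ennreal (p r) \<partial>M) = (\<integral>\<^sup>+\<omega>. kap (r - h) (\<Theta> \<omega>) \<partial>M) * ennreal (p r)"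
      by (rule nn_integral_multc[OF kap_measurable[OF \<Theta>_S rh]])
    also have "\<dots> \<le> 1 * ennreal (p r)"
      by (intro mult_right_mono kap_expectation_le_1[OF prob_space_axioms \<Theta>_shift rh]) simp
    finally show "(\<integral>\<^sup>+\<omega>. kap (r - h) (\<Theta> \<omega>) * ennreal (p r) \<partial>M) \<le> ennreal (p r)" by simp
  qed
  also have "\<dots> < \<infinity>" using p_pos by (simp add: pos_summable_def)
  finally have "(\<integral>\<^sup>+\<omega>. D h (\<Theta> \<omega>) \<partial>M) \<noteq> \<infinity>" by simp
  from nn_integral_noteq_infinite[OF D_\<Theta>_measurable[OF h] this] show ?thesis
    by eventually_elim (simp add: less_top)
qed

lemma D_ge: "r \<in> rat_points T \<Longrightarrow> kap (r - h) f * ennreal (p r) \<le> D h f"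
  unfolding D_def by (rule nn_integral_ge_point)

text \<open>
  For irrational \<open>h\<close> no summand is known to be positive; but \<open>k\<^sub>r\<^sub>-\<^sub>h(\<Theta>)\<close> comes close to \<open>k\<^sub>0(\<Theta>) = 1\<close> along
  rational \<open>r \<rightarrow> h\<close>, by stochastic continuity.
\<close>

lemma D_AE_pos:
  assumes h: "h \<in> T"
  shows "AE \<omega> in M. 0 < D h (\<Theta> \<omega>)"
proof -
  obtain s where s: "\<And>n. s n \<in> rat_points T" "s \<longlonglongrightarrow> h" using rat_points_dense[OF h] by blast
  have s1: "\<And>n. s n - h \<in> T" by (rule T_diff[OF rat_points_subset[OF s(1)] h])
  have s2: "(\<lambda>n. s n - h) \<longlonglongrightarrow> 0" using tendsto_diff[OF s(2) tendsto_const[of h]] by simp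
  from random_field_subsequence[OF \<Theta>_field T_zero s1 s2]
  obtain r where "AE \<omega> in M. (\<lambda>n. kap (s (r n) - h) (\<Theta> \<omega>)) \<longlonglongrightarrow> kap 0 (\<Theta> \<omega>)" by (elim exE conjE)
  with kap_0_\<Theta> show ?thesis
  proof eventually_elim
    case (elim \<omega>)
    have "0 < kap 0 (\<Theta> \<omega>)" using elim(1) by simp
    from order_tendstoD(1)[OF elim(2) this] obtain n where n: "0 < kap (s (r n) - h) (\<Theta> \<omega>)"
      by (auto simp: eventually_sequentially)
    have "0 < p (s (r n))" using p_pos s(1) by (simp add: pos_summable_def)
    then have "0 < kap (s (r n) - h) (\<Theta> \<omega>) * ennreal (p (s (r n)))" using n by (simp add: ennreal_zero_less_mult_iff)
    also have "\<dots> \<le> D h (\<Theta> \<omega>)" by (rule D_ge[OF s(1)])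
    finally show ?case .
  qed
qed

lemma D_AE_all: "AE \<omega> in M. \<forall>n\<in>rat_points T. 0 < D n (\<Theta> \<omega>) \<and> D n (\<Theta> \<omega>) < \<infinity>"
proof (rule AE_ball_countable[THEN iffD2, OF countable_rat_points], intro ballI)
  fix n assume "n \<in> rat_points T"
  then have n: "n \<in> T" by (rule rat_points_subset)
  show "AE \<omega> in M. 0 < D n (\<Theta> \<omega>) \<and> D n (\<Theta> \<omega>) < \<infinity>"
    using D_AE_pos[OF n] D_AE_finite[OF n] by eventually_elim simp
qed

lemma D_joint_measurable: "(\<lambda>x. D (snd x) (\<Theta> (fst x))) \<in> borel_measurable (M \<Otimes>\<^sub>M K)"
  by (rule MK_measurable) (rule D_\<Theta>_measurable[OF rat_points_subset])

lemma AE_MK_of_AE_M: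
  assumes "AE \<omega> in M. \<forall>n\<in>rat_points T. P (\<omega>, n)"
  shows "AE x in M \<Otimes>\<^sub>M K. P x"
proof -
  have "AE \<omega> in distr (M \<Otimes>\<^sub>M K) M fst. \<forall>n\<in>rat_points T. P (\<omega>, n)"
    unfolding K.distr_pair_fst by (rule assms)
  from AE_distrD[OF measurable_fst this] AE_space
  show ?thesis
  proof eventually_elim
    case (elim x)
    then show ?case by (cases x) (auto simp: space_pair_measure)
  qed
qed

lemma D_AE_N: "AE (\<omega>, n) in M \<Otimes>\<^sub>M K. 0 < D n (\<Theta> \<omega>) \<and> D n (\<Theta> \<omega>) < \<infinity> \<and> n \<in> rat_points T"
  using D_AE_all by (intro AE_MK_of_AE_M) (auto elim: AE_mp)

lemma measurable_N: "f \<in> measurable (M \<Otimes>\<^sub>M K) L \<Longrightarrow> f \<in> measurable N L"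
  unfolding N_def by (rule measurable_completion)

lemma AE_N: "(AE x in M \<Otimes>\<^sub>M K. P x) \<Longrightarrow> (AE x in N. P x)"
  unfolding N_def by (rule AE_completion)

lemma prob_space_N: "prob_space N"
  unfolding N_def by (rule MK.prob_space_completion)

lemma Z_random_field: "random_field T \<kappa> N Z"
proof -
  have U: "random_field T \<kappa> N (\<lambda>(\<omega>, n). shift T n (\<Theta> \<omega>))"
    unfolding N_def by (rule random_field_random_shift[OF \<Theta>_field sets_K p_prob])
  let ?c = "\<lambda>x. 1 / enn2real (epowr (D (snd x) (\<Theta> (fst x))) (1 / \<alpha>))"
  have c: "?c \<in> borel_measurable N"
    by (rule measurable_N) (use D_joint_measurable in measurable)
  have "AE x in N. 0 < ?c x"
  proof (rule AE_N, use D_AE_N in eventually_elim)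
    fix x assume a: "case x of (\<omega>, n) \<Rightarrow> 0 < D n (\<Theta> \<omega>) \<and> D n (\<Theta> \<omega>) < \<infinity> \<and> n \<in> rat_points T"
    then have "0 < D (snd x) (\<Theta> (fst x))" "D (snd x) (\<Theta> (fst x)) < \<infinity>" by (auto simp: split_beta')
    from epowr_pos_finite[OF this, of "1 / \<alpha>"] show "0 < ?c x"
      by (simp add: enn2real_positive_iff)
  qed
  from random_field_fscale[OF U c _ this]
  have "random_field T \<kappa> N (\<lambda>x. fscale T (?c x) (case x of (\<omega>, n) \<Rightarrow> shift T n (\<Theta> \<omega>)))" by simp
  also have "(\<lambda>x. fscale T (?c x) (case x of (\<omega>, n) \<Rightarrow> shift T n (\<Theta> \<omega>))) = Z"
    by (simp add: fun_eq_iff Z_def fdiv_def split_beta')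
  finally show ?thesis .
qed

lemma Z_measurable: "Z \<in> measurable N S"
  by (rule random_fieldD(6)[OF Z_random_field])

lemma Z_pointwise:
  assumes n: "n \<in> rat_points T" and D: "0 < D n (\<Theta> \<omega>)" "D n (\<Theta> \<omega>) < \<infinity>" and t: "t \<in> T"
  shows "kap t (Z (\<omega>, n)) = kap (t - n) (\<Theta> \<omega>) / D n (\<Theta> \<omega>)"
    and "normalize (Z (\<omega>, n)) (kap t (Z (\<omega>, n))) = normalize (shift T n (\<Theta> \<omega>)) (kap (t - n) (\<Theta> \<omega>))"
proof -
  have nT: "n \<in> T" by (rule rat_points_subset[OF n])
  obtain c where c: "0 < c" "ennreal (c powr \<alpha>) * D n (\<Theta> \<omega>) = 1" "\<And>f. normalize f (D n (\<Theta> \<omega>)) = fscale T c f"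
    by (rule normalize_eq_fscale[OF D]) blast
  have z: "Z (\<omega>, n) = fscale T c (shift T n (\<Theta> \<omega>))" by (simp add: Z_def c(3))
  have k: "kap t (Z (\<omega>, n)) = ennreal (c powr \<alpha>) * kap (t - n) (\<Theta> \<omega>)"
    using c(1) t nT by (simp add: z kap_fscale kap_shift)
  have "kap (t - n) (\<Theta> \<omega>) = ennreal (c powr \<alpha>) * kap (t - n) (\<Theta> \<omega>) * D n (\<Theta> \<omega>)"
    using c(2) by (metis mult.assoc mult.commute mult_1)
  then have "kap (t - n) (\<Theta> \<omega>) / D n (\<Theta> \<omega>) = (ennreal (c powr \<alpha>) * kap (t - n) (\<Theta> \<omega>)) * D n (\<Theta> \<omega>) / D n (\<Theta> \<omega>)" by simp
  also have "\<dots> = ennreal (c powr \<alpha>) * kap (t - n) (\<Theta> \<omega>)"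
    using D by (intro ennreal_mult_divide_eq) (auto simp: zero_less_iff_neq_zero)
  finally show "kap t (Z (\<omega>, n)) = kap (t - n) (\<Theta> \<omega>) / D n (\<Theta> \<omega>)" using k by simp
  show "normalize (Z (\<omega>, n)) (kap t (Z (\<omega>, n))) = normalize (shift T n (\<Theta> \<omega>)) (kap (t - n) (\<Theta> \<omega>))"
    unfolding k unfolding z by (rule normalize_fscale[OF c(1)])
qed

text \<open>
  The spectral identity moves the base point from \<open>n\<close> to \<open>h\<close>.  The normalizing factor enters the denominator
  \<open>D\<close> and is absorbed into the weight \<open>k\<^sub>n\<^sub>-\<^sub>h(\<Theta>)\<close>.
\<close>

lemma shifted_integral:
  assumes h: "h \<in> T" and n: "n \<in> rat_points T" and H[measurable]: "H \<in> borel_measurable S"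
  shows "(\<integral>\<^sup>+\<omega>. kap h (Z (\<omega>, n)) * H (normalize (Z (\<omega>, n)) (kap h (Z (\<omega>, n)))) \<partial>M)
       = (\<integral>\<^sup>+\<omega>. kap (n - h) (\<Theta> \<omega>) * (H (shift T h (\<Theta> \<omega>)) / D h (\<Theta> \<omega>)) \<partial>M)"
proof -
  have nT: "n \<in> T" by (rule rat_points_subset[OF n])
  have hn: "h - n \<in> T" and nh: "n - h \<in> T" by (rule T_diff[OF h nT], rule T_diff[OF nT h])
  note [measurable] = kap_measurable_S[OF hn] D_measurable[OF nT] shift_measurable[OF measurable_ident_sets[OF refl] nT]
  define G where "G f = H (normalize (shift T n f) (kap (h - n) f)) / D n f" for f
  have [measurable]: "(\<lambda>f. normalize (shift T n f) (kap (h - n) f)) \<in> measurable S S"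
    by (rule normalize_measurable) measurable
  have G: "G \<in> borel_measurable S" unfolding G_def by measurable
  have "(\<integral>\<^sup>+\<omega>. kap h (Z (\<omega>, n)) * H (normalize (Z (\<omega>, n)) (kap h (Z (\<omega>, n)))) \<partial>M)
      = (\<integral>\<^sup>+\<omega>. kap (h - n) (\<Theta> \<omega>) * G (\<Theta> \<omega>) \<partial>M)"
  proof (rule nn_integral_cong_AE, use D_AE_all in eventually_elim)
    fix \<omega> assume "\<forall>n\<in>rat_points T. 0 < D n (\<Theta> \<omega>) \<and> D n (\<Theta> \<omega>) < \<infinity>"
    with n have "0 < D n (\<Theta> \<omega>)" "D n (\<Theta> \<omega>) < \<infinity>" by auto
    from Z_pointwise[OF n this h]
    show "kap h (Z (\<omega>, n)) * H (normalize (Z (\<omega>, n)) (kap h (Z (\<omega>, n)))) = kap (h - n) (\<Theta> \<omega>) * G (\<Theta> \<omega>)"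
      by (simp add: G_def divide_ennreal_def mult_ac)
  qed
  also have "\<dots> = (\<integral>\<^sup>+\<omega>. indicator (- {0}) (kap (- (h - n)) (\<Theta> \<omega>)) *
      G (normalize (shift T (h - n) (\<Theta> \<omega>)) (kap (- (h - n)) (\<Theta> \<omega>))) \<partial>M)"
    by (rule \<Theta>_shift[unfolded shift_law_def, rule_format, OF G hn])
  also have "\<dots> = (\<integral>\<^sup>+\<omega>. kap (n - h) (\<Theta> \<omega>) * (H (shift T h (\<Theta> \<omega>)) / D h (\<Theta> \<omega>)) \<partial>M)"
  proof (rule nn_integral_cong_AE, use kap_0_\<Theta> kap_AE_finite[OF prob_space_axioms \<Theta>_S \<Theta>_shift nh] D_AE_pos[OF h] D_AE_finite[OF h] in eventually_elim)
    fix \<omega> assume one: "kap 0 (\<Theta> \<omega>) = 1" and fin: "kap (n - h) (\<Theta> \<omega>) < \<infinity>"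
      and Dh: "0 < D h (\<Theta> \<omega>)" "D h (\<Theta> \<omega>) < \<infinity>"
    have e: "- (h - n) = n - h" by simp
    show "indicator (- {0}) (kap (- (h - n)) (\<Theta> \<omega>)) * G (normalize (shift T (h - n) (\<Theta> \<omega>)) (kap (- (h - n)) (\<Theta> \<omega>)))
       = kap (n - h) (\<Theta> \<omega>) * (H (shift T h (\<Theta> \<omega>)) / D h (\<Theta> \<omega>))"
    proof (cases "kap (n - h) (\<Theta> \<omega>) = 0")
      case True then show ?thesis unfolding e by simp
    next
      case False
      then have pos: "0 < kap (n - h) (\<Theta> \<omega>)" by (simp add: zero_less_iff_neq_zero)
      obtain c where c: "0 < c" "ennreal (c powr \<alpha>) * kap (n - h) (\<Theta> \<omega>) = 1"
        "\<And>f. normalize f (kap (n - h) (\<Theta> \<omega>)) = fscale T c f"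
        by (rule normalize_eq_fscale[OF pos fin]) blast
      let ?g = "shift T (h - n) (\<Theta> \<omega>)"
      have 1: "shift T n (fscale T c ?g) = fscale T c (shift T h (\<Theta> \<omega>))"
        using nT hn by (simp add: shift_fscale shift_shift)
      have 2: "kap (h - n) (fscale T c ?g) = ennreal (c powr \<alpha>) * 1"
        using c(1) hn one by (simp add: kap_fscale kap_shift)
      have 3: "D n (fscale T c ?g) = ennreal (c powr \<alpha>) * D h (\<Theta> \<omega>)"
      proof -
        have "D n (fscale T c ?g) = (\<integral>\<^sup>+r. ennreal (c powr \<alpha>) * (kap (r - h) (\<Theta> \<omega>) * ennreal (p r)) \<partial>count_space (rat_points T))"
          unfolding D_def
        proof (rule nn_integral_cong)
          fix r assume "r \<in> space (count_space (rat_points T))"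
          then have "r - n \<in> T" using T_diff[OF rat_points_subset nT] by simp
          moreover have "r - n - (h - n) = r - h" by simp
          ultimately show "kap (r - n) (fscale T c ?g) * ennreal (p r) = ennreal (c powr \<alpha>) * (kap (r - h) (\<Theta> \<omega>) * ennreal (p r))"
            using c(1) hn by (simp add: kap_fscale kap_shift mult.assoc)
        qed
        also have "\<dots> = ennreal (c powr \<alpha>) * D h (\<Theta> \<omega>)" unfolding D_def by (rule nn_integral_cmult) simp
        finally show ?thesis .
      qed
      have "G (fscale T c ?g) = H (shift T h (\<Theta> \<omega>)) / (ennreal (c powr \<alpha>) * D h (\<Theta> \<omega>))"
        unfolding G_def 1 2 3 normalize_fscale[OF c(1)] by (simp add: normalize_one)
      also have "\<dots> = kap (n - h) (\<Theta> \<omega>) * (H (shift T h (\<Theta> \<omega>)) / D h (\<Theta> \<omega>))"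
      proof -
        let ?e = "ennreal (c powr \<alpha>)" and ?k = "kap (n - h) (\<Theta> \<omega>)" and ?H = "H (shift T h (\<Theta> \<omega>))"
        have e0: "?e \<noteq> 0" "?e \<noteq> \<infinity>" using c(1) by auto
        have "?k * (?H / D h (\<Theta> \<omega>)) = ?k * ?H / D h (\<Theta> \<omega>)" by (simp add: ennreal_times_divide)
        also have "\<dots> = ?k * ?H * ?e / (D h (\<Theta> \<omega>) * ?e)" using e0 by (rule divide_mult_eq[symmetric])
        also have "?k * ?H * ?e = ?H" using c(2) by (simp add: mult_ac) (metis mult.assoc mult.commute mult_1)
        finally show ?thesis by (simp add: mult.commute)
      qed
      finally show ?thesis unfolding e c(3) using False by simp
    qed
  qed
  finally show ?thesis .
qed

lemma nn_integral_N:
  assumes "f \<in> borel_measurable (M \<Otimes>\<^sub>M K)"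
  shows "(\<integral>\<^sup>+x. f x \<partial>N) = (\<integral>\<^sup>+n. \<integral>\<^sup>+\<omega>. f (\<omega>, n) \<partial>M \<partial>K)"
  unfolding N_def nn_integral_completion by (rule MK.nn_integral_snd[symmetric]) (use assms in simp)

lemma Z_MK_measurable: "Z \<in> measurable (M \<Otimes>\<^sub>M K) S"
proof -
  have "(\<lambda>x. (\<lambda>n \<omega>. normalize (shift T n (\<Theta> \<omega>)) (D n (\<Theta> \<omega>))) (snd x) (fst x)) \<in> measurable (M \<Otimes>\<^sub>M K) S"
    by (rule MK_measurable)
       (intro normalize_measurable shift_measurable \<Theta>_S rat_points_subset D_\<Theta>_measurable)
  then show ?thesis by (simp add: Z_def split_beta')
qed

text \<open>
  Summing the shifted integrals over \<open>n\<close> with weights \<open>p(n)\<close> produces the factor \<open>D\<^sub>h\<close>, which cancels.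
\<close>

lemma Z_identity:
  assumes h: "h \<in> T" and H[measurable]: "H \<in> borel_measurable S"
  shows "(\<integral>\<^sup>+x. kap h (Z x) * H (normalize (Z x) (kap h (Z x))) \<partial>N) = (\<integral>\<^sup>+\<omega>. H (shift T h (\<Theta> \<omega>)) \<partial>M)"
proof -
  note [measurable] = Z_MK_measurable kap_measurable[OF Z_MK_measurable h] D_\<Theta>_measurable[OF h] shift_measurable[OF \<Theta>_S h]
  have [measurable]: "(\<lambda>x. normalize (Z x) (kap h (Z x))) \<in> measurable (M \<Otimes>\<^sub>M K) S"
    by (rule normalize_measurable) measurable
  let ?q = "\<lambda>\<omega>. H (shift T h (\<Theta> \<omega>)) / D h (\<Theta> \<omega>)"
  have q[measurable]: "?q \<in> borel_measurable M" by measurable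
  have km: "(\<lambda>\<omega>. kap (n - h) (\<Theta> \<omega>) * ?q \<omega>) \<in> borel_measurable M" if "n \<in> rat_points T" for n
    using kap_measurable[OF \<Theta>_S T_diff[OF rat_points_subset[OF that] h]] by measurable
  have m: "(\<lambda>x. kap (snd x - h) (\<Theta> (fst x)) * ?q (fst x)) \<in> borel_measurable (M \<Otimes>\<^sub>M K)"
    by (rule MK_measurable[where f = "\<lambda>n \<omega>. kap (n - h) (\<Theta> \<omega>) * ?q \<omega>", OF km])
  have "(\<integral>\<^sup>+x. kap h (Z x) * H (normalize (Z x) (kap h (Z x))) \<partial>N)
      = (\<integral>\<^sup>+n. \<integral>\<^sup>+\<omega>. kap h (Z (\<omega>, n)) * H (normalize (Z (\<omega>, n)) (kap h (Z (\<omega>, n)))) \<partial>M \<partial>K)"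
    by (rule nn_integral_N) measurable
  also have "\<dots> = (\<integral>\<^sup>+n. \<integral>\<^sup>+\<omega>. kap (n - h) (\<Theta> \<omega>) * ?q \<omega> \<partial>M \<partial>K)"
    by (rule nn_integral_cong) (rule shifted_integral[OF h _ H], simp)
  also have "\<dots> = (\<integral>\<^sup>+\<omega>. \<integral>\<^sup>+n. kap (n - h) (\<Theta> \<omega>) * ?q \<omega> \<partial>K \<partial>M)"
    using MK.Fubini[OF m] by simp
  also have "\<dots> = (\<integral>\<^sup>+\<omega>. H (shift T h (\<Theta> \<omega>)) \<partial>M)"
  proof (rule nn_integral_cong_AE, use D_AE_pos[OF h] D_AE_finite[OF h] in eventually_elim)
    fix \<omega> assume D: "0 < D h (\<Theta> \<omega>)" "D h (\<Theta> \<omega>) < \<infinity>"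
    have "(\<integral>\<^sup>+n. kap (n - h) (\<Theta> \<omega>) * ?q \<omega> \<partial>K) = (\<integral>\<^sup>+n. ennreal (p n) * (kap (n - h) (\<Theta> \<omega>) * ?q \<omega>) \<partial>count_space (rat_points T))"
      by (rule nn_integral_density) simp_all
    also have "\<dots> = (\<integral>\<^sup>+n. kap (n - h) (\<Theta> \<omega>) * ennreal (p n) * ?q \<omega> \<partial>count_space (rat_points T))"
      by (simp only: mult_ac)
    also have "\<dots> = D h (\<Theta> \<omega>) * ?q \<omega>" unfolding D_def by (rule nn_integral_multc) simp
    also have "\<dots> = H (shift T h (\<Theta> \<omega>)) * D h (\<Theta> \<omega>) / D h (\<Theta> \<omega>)" by (simp add: ennreal_times_divide mult.commute)
    also have "\<dots> = H (shift T h (\<Theta> \<omega>))"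
      using D by (intro ennreal_mult_divide_eq) (auto simp: zero_less_iff_neq_zero)
    finally show "(\<integral>\<^sup>+n. kap (n - h) (\<Theta> \<omega>) * ?q \<omega> \<partial>K) = H (shift T h (\<Theta> \<omega>))" .
  qed
  finally show ?thesis .
qed

lemma kap_Z_integral: "h \<in> T \<Longrightarrow> (\<integral>\<^sup>+x. kap h (Z x) \<partial>N) = 1"
  using Z_identity[of h "\<lambda>_. 1"] by (simp add: emeasure_space_1)

lemma kap_Z_AE_finite: "AE x in N. \<forall>r\<in>rat_points T. kap r (Z x) \<noteq> \<infinity>"
proof (rule AE_ball_countable[THEN iffD2, OF countable_rat_points], intro ballI)
  fix r assume "r \<in> rat_points T"
  then have r: "r \<in> T" by (rule rat_points_subset)
  show "AE x in N. kap r (Z x) \<noteq> \<infinity>"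
    by (rule nn_integral_noteq_infinite[OF kap_measurable[OF Z_measurable r]]) (simp add: kap_Z_integral[OF r])
qed

definition local_sup :: "real \<Rightarrow> 'm \<times> (real^'l) \<Rightarrow> ennreal" where
  "local_sup c x = (SUP s\<in>cube c \<inter> rat_points T. kap s (Z x))"

lemma local_sup_measurable: "local_sup c \<in> borel_measurable N"
proof -
  have "(\<lambda>x. SUP s\<in>cube c \<inter> rat_points T. kap s (Z x)) \<in> borel_measurable N"
    by (rule borel_measurable_SUP)
       (auto intro: countable_subset[OF _ countable_rat_points] kap_measurable[OF Z_measurable] rat_points_subset)
  then show ?thesis by (simp add: local_sup_def[abs_def])
qed

text \<open>
  The quotient in condition (J) is the local supremum of the mixed field.
\<close>

lemma J_integral:
  "(\<integral>\<^sup>+(n, \<omega>). (SUP s\<in>cube c \<inter> rat_points T. \<kappa> (shift T (n - s) (\<Theta> \<omega>)))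
       / (\<integral>\<^sup>+r. \<kappa> (shift T (n - r) (\<Theta> \<omega>)) * ennreal (p r) \<partial>count_space (rat_points T)) \<partial>(K \<Otimes>\<^sub>M M))
    = (\<integral>\<^sup>+x. local_sup c x \<partial>N)"
proof -
  have kap_eq: "\<kappa> (shift T (n - s) f) = kap (s - n) f" for n s f by (simp add: kap_def)
  interpret KM: pair_prob_space K M ..
  let ?f = "\<lambda>n \<omega>. (SUP s\<in>cube c \<inter> rat_points T. kap (s - n) (\<Theta> \<omega>)) / D n (\<Theta> \<omega>)"
  have fm: "?f n \<in> borel_measurable M" if "n \<in> rat_points T" for n
  proof -
    have "(\<lambda>\<omega>. SUP s\<in>cube c \<inter> rat_points T. kap (s - n) (\<Theta> \<omega>)) \<in> borel_measurable M"
      by (rule borel_measurable_SUP)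
         (auto intro: countable_subset[OF _ countable_rat_points] kap_measurable[OF \<Theta>_S] rat_points_subset T_diff that)
    then show ?thesis using D_\<Theta>_measurable[OF rat_points_subset[OF that]] by measurable
  qed
  from MK_measurable[OF fm] have m: "(\<lambda>x. ?f (snd x) (fst x)) \<in> borel_measurable (M \<Otimes>\<^sub>M K)" .
  from measurable_compose[OF measurable_pair_swap' m]
  have m': "(\<lambda>y. ?f (fst y) (snd y)) \<in> borel_measurable (K \<Otimes>\<^sub>M M)" by (simp add: split_beta')
  have "(\<integral>\<^sup>+y. ?f (fst y) (snd y) \<partial>(K \<Otimes>\<^sub>M M)) = (\<integral>\<^sup>+n. \<integral>\<^sup>+\<omega>. ?f n \<omega> \<partial>M \<partial>K)"
    using nn_integral_fst[OF m'] by simp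
  also have "\<dots> = (\<integral>\<^sup>+x. ?f (snd x) (fst x) \<partial>N)"
    unfolding nn_integral_N[OF m] by simp
  also have "\<dots> = (\<integral>\<^sup>+x. local_sup c x \<partial>N)"
  proof (rule nn_integral_cong_AE, rule AE_N, use D_AE_N in eventually_elim)
    fix x assume "case x of (\<omega>, n) \<Rightarrow> 0 < D n (\<Theta> \<omega>) \<and> D n (\<Theta> \<omega>) < \<infinity> \<and> n \<in> rat_points T"
    then obtain \<omega> n where x: "x = (\<omega>, n)" and n: "n \<in> rat_points T" and D: "0 < D n (\<Theta> \<omega>)" "D n (\<Theta> \<omega>) < \<infinity>"
      by (cases x) auto
    show "?f (snd x) (fst x) = local_sup c x"
      unfolding local_sup_def x fst_conv snd_conv SUP_divide_ennreal
      by (intro SUP_cong refl) (simp add: Z_pointwise(1)[OF n D] rat_points_subset)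
  qed
  finally show ?thesis unfolding kap_eq D_def by (simp add: split_beta')
qed

lemma Z_somewhere_pos: "AE x in N. \<exists>r\<in>rat_points T. 0 < kap r (Z x)"
proof (rule AE_N, rule AE_MK_of_AE_M, use D_AE_all kap_0_\<Theta> in eventually_elim)
  fix \<omega> assume D: "\<forall>n\<in>rat_points T. 0 < D n (\<Theta> \<omega>) \<and> D n (\<Theta> \<omega>) < \<infinity>" and one: "kap 0 (\<Theta> \<omega>) = 1"
  show "\<forall>n\<in>rat_points T. \<exists>r\<in>rat_points T. 0 < kap r (Z (\<omega>, n))"
  proof
    fix n assume n: "n \<in> rat_points T"
    then have Dn: "0 < D n (\<Theta> \<omega>)" "D n (\<Theta> \<omega>) < \<infinity>" using D by auto
    have "0 < kap n (Z (\<omega>, n))"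
      using Z_pointwise(1)[OF n Dn rat_points_subset[OF n]] one Dn by (simp add: ennreal_zero_less_divide)
    then show "\<exists>r\<in>rat_points T. 0 < kap r (Z (\<omega>, n))" using n by blast
  qed
qed

end

context homogeneous_functional
begin

lemma separable_path_le:
  assumes "separable_path x" "t \<in> T" "open U" "t \<in> U" and le: "\<And>s. s \<in> U \<Longrightarrow> s \<in> rat_points T \<Longrightarrow> x s \<le> b"
  shows "x t \<le> b"
proof -
  have "closure (x ` (U \<inter> rat_points T)) \<subseteq> {..b}"
    by (rule closure_minimal) (use le in auto)
  with separable_pathD[OF assms(1-4)] show ?thesis by auto
qed

text \<open>
  The cube is enlarged because a point on its boundary need not be approached by rational points inside it.
\<close>

lemma separable_path_cube_le:
  assumes "separable_path x" "t \<in> T" "t \<in> cube c"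
  shows "x t \<le> (SUP s\<in>cube (c + 1) \<inter> rat_points T. x s)"
proof (rule separable_path_le[OF assms(1,2) open_box[of "c + 1"]])
  show "t \<in> {x. \<forall>i. \<bar>x $ i\<bar> < c + 1}" using assms(3) by (auto simp: cube_def intro: le_less_trans)
  show "x s \<le> (SUP s\<in>cube (c + 1) \<inter> rat_points T. x s)"
    if "s \<in> {x. \<forall>i. \<bar>x $ i\<bar> < c + 1}" "s \<in> rat_points T" for s
    using that by (intro SUP_upper) (auto simp: cube_def less_imp_le)
qed

lemma cube_diff: "s \<in> cube c \<Longrightarrow> s - h \<in> cube (c + norm h)"
  unfolding cube_def
proof safe
  fix i assume "\<forall>i. \<bar>s $ i\<bar> \<le> c"
  then have "\<bar>s $ i\<bar> \<le> c" "\<bar>h $ i\<bar> \<le> norm h" by (auto simp: component_le_norm_cart)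
  then show "\<bar>(s - h) $ i\<bar> \<le> c + norm h" by simp
qed

end

context mixed_field
begin

lemma AE_cube_le_local_sup: "AE x in N. \<forall>t\<in>T \<inter> cube c. kap t (Z x) \<le> local_sup (c + 1) x"
  using random_fieldD(5)[OF Z_random_field]
proof eventually_elim
  case (elim x)
  then show ?case unfolding local_sup_def using separable_path_cube_le by blast
qed

text \<open>
  The right-hand side does not involve \<open>h\<close>: this is the shift-invariance of the class.
\<close>

lemma Z_shift_identity:
  assumes h: "h \<in> T" and s: "s \<in> T" and H[measurable]: "H \<in> borel_measurable S"
  shows "(\<integral>\<^sup>+x. kap s (shift T h (Z x)) * H (normalize (shift T h (Z x)) (kap s (shift T h (Z x)))) \<partial>N)
     = (\<integral>\<^sup>+\<omega>. H (shift T s (\<Theta> \<omega>)) \<partial>M)"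
proof -
  have sh: "s - h \<in> T" by (rule T_diff[OF s h])
  have "(\<lambda>f. H (shift T h f)) \<in> borel_measurable S"
    using measurable_compose[OF shift_measurable[OF measurable_ident_sets[OF refl] h] H] by simp
  from Z_identity[OF sh this] show ?thesis
    using h s sh by (simp add: kap_shift shift_fdiv shift_shift)
qed

lemma shifted_positive_finite:
  assumes fin: "\<And>c. 0 < c \<Longrightarrow> (\<integral>\<^sup>+x. local_sup c x \<partial>N) < \<infinity>" and h: "h \<in> T"
  shows "positive_finite T \<kappa> N (\<lambda>x. shift T h (Z x))"
  unfolding positive_finite_def kap_def[symmetric]
proof (intro conjI allI impI)
  have W: "random_field T \<kappa> N (\<lambda>x. shift T h (Z x))" by (rule random_field_shift[OF Z_random_field h])
  show "AE x in N. 0 < (SUP t\<in>rat_points T. kap t (shift T h (Z x)))"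
    using random_fieldD(5)[OF W] Z_somewhere_pos
  proof eventually_elim
    case (elim x)
    then obtain r where r: "r \<in> rat_points T" "0 < kap r (Z x)" by blast
    have rh: "r + h \<in> T" by (rule T_add[OF rat_points_subset[OF r(1)] h])
    have "0 < kap (r + h) (shift T h (Z x))" using r rh h by (simp add: kap_shift)
    also have "\<dots> \<le> (SUP t\<in>rat_points T. kap t (shift T h (Z x)))"
      by (rule separable_path_le[OF elim(1) rh open_UNIV UNIV_I]) (rule SUP_upper)
    finally show ?case .
  qed
next
  fix c :: real assume c: "0 < c"
  have "(\<integral>\<^sup>+x. (SUP t\<in>cube c \<inter> rat_points T. kap t (shift T h (Z x))) \<partial>N) \<le> (\<integral>\<^sup>+x. local_sup (c + norm h + 1) x \<partial>N)"
  proof (rule nn_integral_mono_AE, use AE_cube_le_local_sup[of "c + norm h"] in eventually_elim)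
    fix x assume a: "\<forall>t\<in>T \<inter> cube (c + norm h). kap t (Z x) \<le> local_sup (c + norm h + 1) x"
    show "(SUP t\<in>cube c \<inter> rat_points T. kap t (shift T h (Z x))) \<le> local_sup (c + norm h + 1) x"
    proof (rule SUP_least)
      fix t assume "t \<in> cube c \<inter> rat_points T"
      then have t: "t \<in> T" "t - h \<in> T \<inter> cube (c + norm h)"
        using rat_points_subset T_diff[OF _ h] cube_diff by auto
      then show "kap t (shift T h (Z x)) \<le> local_sup (c + norm h + 1) x"
        using a by (simp add: kap_shift[OF t(1) h])
    qed
  qed
  also have "\<dots> < \<infinity>" using c by (intro fin) (simp add: add_pos_nonneg)
  finally show "(\<integral>\<^sup>+x. (SUP t\<in>cube c \<inter> rat_points T. kap t (shift T h (Z x))) \<partial>N) < \<infinity>" .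
qed

lemma shift_0_Z: "shift T 0 (Z x) = Z x"
  by (rule shift_zero) (simp add: Z_def split_beta')

lemma Z_generates_class:
  assumes fin: "\<And>c. 0 < c \<Longrightarrow> (\<integral>\<^sup>+x. local_sup c x \<partial>N) < \<infinity>"
  shows "generates_class T \<kappa> N Z"
proof -
  have "positive_finite T \<kappa> N Z"
    using shifted_positive_finite[OF fin T_zero] by (simp add: shift_0_Z)
  moreover have "(\<integral>\<^sup>+x. \<kappa> (Z x) \<partial>N) = 1"
    using kap_Z_integral[OF T_zero] by (simp add: kap_def shift_0_Z)
  ultimately show ?thesis by (simp add: generates_class_def Z_random_field)
qed

lemma shifted_in_class:
  assumes fin: "\<And>c. 0 < c \<Longrightarrow> (\<integral>\<^sup>+x. local_sup c x \<partial>N) < \<infinity>" and h: "h \<in> T"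
  shows "(N, \<lambda>x. shift T h (Z x)) \<in> field_class T \<kappa> \<alpha> N Z"
  unfolding field_class_def mem_Collect_eq prod.case
proof (intro conjI ballI)
  show "random_field T \<kappa> N (\<lambda>x. shift T h (Z x))" by (rule random_field_shift[OF Z_random_field h])
  show "positive_finite T \<kappa> N (\<lambda>x. shift T h (Z x))" by (rule shifted_positive_finite[OF fin h])
  fix F :: "(real^'l \<Rightarrow> real^'d) \<Rightarrow> ereal" and s
  assume F: "F \<in> maps T" and s: "s \<in> T"
  have Fm: "F \<in> borel_measurable S" using F by (simp add: maps_def)
  have "eintegral N (\<lambda>x. enn2ereal (kap s (shift T h (Z x))) * F (normalize (shift T h (Z x)) (kap s (shift T h (Z x)))))
      = eintegral N (\<lambda>x. enn2ereal (kap s (Z x)) * F (normalize (Z x) (kap s (Z x))))"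
    by (rule eintegral_eq_of_law[where a = "\<lambda>x. kap s (shift T h (Z x))" and b = "\<lambda>x. kap s (Z x)"
          and V = "\<lambda>x. normalize (shift T h (Z x)) (kap s (shift T h (Z x)))"
          and W = "\<lambda>x. normalize (Z x) (kap s (Z x))", OF Fm])
       (simp only: Z_shift_identity[OF h s] Z_identity[OF s])
  then show "eq_expect N (\<lambda>\<omega>. enn2ereal (\<kappa> (shift T (- s) (shift T h (Z \<omega>)))) *
                F (fdiv T (shift T h (Z \<omega>)) (epowr (\<kappa> (shift T (- s) (shift T h (Z \<omega>)))) (1 / \<alpha>))))
        N (\<lambda>\<omega>. enn2ereal (\<kappa> (shift T (- s) (Z \<omega>))) *
                F (fdiv T (Z \<omega>) (epowr (\<kappa> (shift T (- s) (Z \<omega>))) (1 / \<alpha>))))"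
    by (simp add: eq_expect_def kap_def)
qed

lemma Z_shift_invariant_class:
  assumes fin: "\<And>c. 0 < c \<Longrightarrow> (\<integral>\<^sup>+x. local_sup c x \<partial>N) < \<infinity>"
  shows "shift_invariant_class T \<kappa> \<alpha> N Z"
proof -
  have "(N, Z) \<in> field_class T \<kappa> \<alpha> N Z"
    using shifted_in_class[OF fin T_zero] by (simp add: shift_0_Z)
  then show ?thesis unfolding shift_invariant_class_def using shifted_in_class[OF fin] by blast
qed

lemma Z_local_field_law: "local_field_law T \<kappa> \<alpha> N Z = distr M S \<Theta>"
proof -
  have k: "\<kappa> (Z x) = kap 0 (Z x)" for x by (simp add: kap_def shift_0_Z)
  have [measurable]: "(\<lambda>x. \<kappa> (Z x)) \<in> borel_measurable N"
    by (rule measurable_compose[OF Z_measurable \<kappa>_measurable])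
  have nm: "(\<lambda>x. normalize (Z x) (\<kappa> (Z x))) \<in> measurable N S"
    by (rule normalize_measurable[OF Z_measurable]) measurable
  have one: "(\<integral>\<^sup>+x. \<kappa> (Z x) \<partial>N) = 1" using kap_Z_integral[OF T_zero] by (simp add: k)
  have "distr (density N (\<lambda>x. \<kappa> (Z x))) S (\<lambda>x. normalize (Z x) (\<kappa> (Z x))) = distr (density M (\<lambda>_. 1)) S \<Theta>"
  proof (rule density_distr_eqI[OF _ _ nm \<Theta>_S])
    fix H :: "(real^'l \<Rightarrow> real^'d) \<Rightarrow> ennreal" assume H: "H \<in> borel_measurable S"
    show "(\<integral>\<^sup>+x. \<kappa> (Z x) * H (normalize (Z x) (\<kappa> (Z x))) \<partial>N) = (\<integral>\<^sup>+\<omega>. 1 * H (\<Theta> \<omega>) \<partial>M)"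
      using Z_identity[OF T_zero H] shift_zero[OF \<Theta>_in_S] by (simp add: k cong: nn_integral_cong)
  qed measurable
  moreover have "x / 1 = x" for x :: ennreal by (simp add: divide_ennreal_def)
  ultimately show ?thesis by (simp add: local_field_law_def one density_1)
qed

end

section \<open>Exceedances\<close>

locale exceedance_field = mixed_field T \<kappa> \<alpha> M \<Theta> p + polar: polar_field T \<kappa> \<alpha> M \<Theta> Y R
  for T :: "(real^'l::finite) set"
    and \<kappa> :: "(real^'l \<Rightarrow> real^'d::finite) \<Rightarrow> ennreal"
    and \<alpha> :: real and M :: "'m measure" and \<Theta> p Y R
begin

abbreviation \<rho> :: "real measure" where "\<rho> \<equiv> pareto_intensity \<alpha>"

text \<open>
  Negative scales form a null set; they are cut off because the functional is homogeneous for positive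
  factors only.
\<close>

definition \<zeta> :: "real \<times> ('m \<times> (real^'l)) \<Rightarrow> real^'l \<Rightarrow> real^'d" where
  "\<zeta> q = fscale T (max (fst q) 0) (Z (snd q))"

sublocale N: prob_space N by (rule prob_space_N)

sublocale \<rho>: sigma_finite_measure \<rho> by (rule sigma_finite_pareto_intensity)

sublocale \<mu>: sigma_finite_measure "index_measure T" by (rule sigma_finite_index_measure)

sublocale \<rho>N: pair_sigma_finite \<rho> N ..

lemma \<zeta>_kfield: "kfield (\<rho> \<Otimes>\<^sub>M N) \<zeta>"
  unfolding \<zeta>_def
  by (rule kfield_fscale[OF kfield_compose[OF random_fieldD(3)[OF Z_random_field] measurable_snd]]) auto

lemma kap_\<zeta>: "0 < z \<Longrightarrow> t \<in> T \<Longrightarrow> kap t (\<zeta> (z, x)) = ennreal (z powr \<alpha>) * kap t (Z x)"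
  by (simp add: \<zeta>_def max_def kap_fscale)

text \<open>
  Where \<open>k\<^sub>t(Z) = v\<close> with \<open>0 < v < \<infinity>\<close>, the substitution \<open>w = z v\<^sup>1\<^sup>/\<^sup>\<alpha>\<close> makes the threshold \<open>w > 1\<close>, turns \<open>zZ\<close>
  into \<open>w\<close> times the normalized path and contributes the factor \<open>v\<close>, so that the identity for \<open>Z\<close> applies.
\<close>

lemma exceedance_law:
  assumes t: "t \<in> T" and H[measurable]: "H \<in> borel_measurable S"
  shows "(\<integral>\<^sup>+q. indicator {1<..} (kap t (\<zeta> q)) * H (\<zeta> q) \<partial>(\<rho> \<Otimes>\<^sub>M N)) = (\<integral>\<^sup>+\<omega>. H (shift T t (Y \<omega>)) \<partial>M)"
proof -
  note [measurable] = kfield_measurable[OF \<zeta>_kfield] kap_measurable[OF kfield_measurable[OF \<zeta>_kfield] t]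
  have sc: "(\<lambda>x. fscale T (snd x) (fst x)) \<in> measurable (S \<Otimes>\<^sub>M \<rho>) S"
    by (rule fscale_measurable) auto
  define H' where "H' f = (\<integral>\<^sup>+w. indicator {1<..} w * H (fscale T w f) \<partial>\<rho>)" for f
  have H'm: "H' \<in> borel_measurable S"
    unfolding H'_def using \<rho>.borel_measurable_nn_integral_fst[of "\<lambda>x. indicator {1<..} (snd x) * H (fscale T (snd x) (fst x))" S]
      sc by simp
  have "(\<integral>\<^sup>+q. indicator {1<..} (kap t (\<zeta> q)) * H (\<zeta> q) \<partial>(\<rho> \<Otimes>\<^sub>M N))
     = (\<integral>\<^sup>+x. \<integral>\<^sup>+z. indicator {1<..} (kap t (\<zeta> (z, x))) * H (\<zeta> (z, x)) \<partial>\<rho> \<partial>N)"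
    by (rule \<rho>N.nn_integral_snd[symmetric]) measurable
  also have "\<dots> = (\<integral>\<^sup>+x. kap t (Z x) * H' (normalize (Z x) (kap t (Z x))) \<partial>N)"
  proof (rule nn_integral_cong_AE)
    have "AE x in N. kap t (Z x) \<noteq> \<infinity>"
      by (rule nn_integral_noteq_infinite[OF kap_measurable[OF Z_measurable t]]) (simp add: kap_Z_integral[OF t])
    then show "AE x in N. (\<integral>\<^sup>+z. indicator {1<..} (kap t (\<zeta> (z, x))) * H (\<zeta> (z, x)) \<partial>\<rho>)
        = kap t (Z x) * H' (normalize (Z x) (kap t (Z x)))"
    proof eventually_elim
      case (elim x)
      show ?case
      proof (cases "kap t (Z x) = 0")
        case True
        have "(\<integral>\<^sup>+z. indicator {1<..} (kap t (\<zeta> (z, x))) * H (\<zeta> (z, x)) \<partial>\<rho>) = (\<integral>\<^sup>+z. 0 \<partial>\<rho>)"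
          by (rule nn_integral_cong_AE, use AE_pareto_intensity_pos in eventually_elim) (simp add: kap_\<zeta> t True)
        then show ?thesis by (simp add: True)
      next
        case False
        then have k: "0 < kap t (Z x)" "kap t (Z x) < \<infinity>" using elim by (auto simp: zero_less_iff_neq_zero less_top)
        obtain c where c: "0 < c" "ennreal (c powr \<alpha>) * kap t (Z x) = 1"
          "\<And>f. normalize f (kap t (Z x)) = fscale T c f" "kap t (Z x) = ennreal (enn2real (kap t (Z x)))"
          by (rule normalize_eq_fscale[OF k]) blast
        define f where "f w = indicator {1<..} w * H (fscale T w (fscale T c (Z x)))" for w
        have fm: "f \<in> borel_measurable borel"
        proof -
          have "(\<lambda>w. fscale T w (fscale T c (Z x))) \<in> measurable borel S"
            by (rule fscale_measurable) auto
          then show ?thesis unfolding f_def by measurable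
        qed
        have k_eq: "kap t (Z x) = ennreal ((1 / c) powr \<alpha>)"
        proof -
          have "c powr \<alpha> * enn2real (kap t (Z x)) = 1"
            using c(2) by (subst (asm) c(4)) (simp add: ennreal_mult[symmetric] flip: ennreal_1)
          then have "enn2real (kap t (Z x)) = 1 / c powr \<alpha>" using c(1) by (simp add: field_simps)
          then have "enn2real (kap t (Z x)) = (1 / c) powr \<alpha>" using c(1) by (simp add: powr_divide)
          then show ?thesis using c(4) by simp
        qed
        have "(\<integral>\<^sup>+z. indicator {1<..} (kap t (\<zeta> (z, x))) * H (\<zeta> (z, x)) \<partial>\<rho>) = (\<integral>\<^sup>+z. f (1 / c * z) \<partial>\<rho>)"
        proof (rule nn_integral_cong_AE, use AE_pareto_intensity_pos in eventually_elim)
          fix z :: real assume z: "0 < z"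
          have "kap t (\<zeta> (z, x)) = ennreal ((1 / c * z) powr \<alpha>)"
            using z c(1) by (simp add: kap_\<zeta> t k_eq ennreal_mult[symmetric] powr_mult[symmetric])
          moreover have "1 < ennreal ((1 / c * z) powr \<alpha>) \<longleftrightarrow> 1 < 1 / c * z"
          proof -
            have "0 \<le> 1 / c * z" using z c(1) by simp
            then have "1 < (1 / c * z) powr \<alpha> \<longleftrightarrow> 1 < 1 / c * z"
              by (intro one_less_powr_iff \<alpha>_pos)
            then show ?thesis by (simp add: ennreal_less_iff flip: ennreal_1)
          qed
          moreover have "\<zeta> (z, x) = fscale T (1 / c * z) (fscale T c (Z x))"
            using z c(1) by (simp add: \<zeta>_def max_def fscale_fscale)
          ultimately show "indicator {1<..} (kap t (\<zeta> (z, x))) * H (\<zeta> (z, x)) = f (1 / c * z)"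
            by (simp add: f_def indicator_def)
        qed
        also have "\<dots> = ennreal ((1 / c) powr \<alpha>) * (\<integral>\<^sup>+z. f z \<partial>\<rho>)"
          using c(1) by (intro nn_integral_pareto_intensity_scale \<alpha>_pos fm) simp
        finally show ?thesis unfolding H'_def c(3) f_def by (simp add: k_eq)
      qed
    qed
  qed
  also have "\<dots> = (\<integral>\<^sup>+\<omega>. H' (shift T t (\<Theta> \<omega>)) \<partial>M)" by (rule Z_identity[OF t H'm])
  also have "\<dots> = (\<integral>\<^sup>+w. \<integral>\<^sup>+\<omega>. indicator {1<..} w * H (fscale T w (shift T t (\<Theta> \<omega>))) \<partial>M \<partial>\<rho>)"
  proof -
    interpret M\<rho>: pair_sigma_finite M \<rho> ..
    have [measurable]: "(\<lambda>x. fscale T (snd x) (shift T t (\<Theta> (fst x)))) \<in> measurable (M \<Otimes>\<^sub>M \<rho>) S"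
      by (rule fscale_measurable) (auto intro!: shift_measurable[OF _ t])
    have "(\<lambda>x. indicator {1<..} (snd x) * H (fscale T (snd x) (shift T t (\<Theta> (fst x))))) \<in> borel_measurable (M \<Otimes>\<^sub>M \<rho>)"
      by measurable
    from M\<rho>.Fubini[OF this] show ?thesis unfolding H'_def by simp
  qed
  also have "\<dots> = (\<integral>\<^sup>+w. indicator {1<..} w * (\<integral>\<^sup>+\<omega>. H (shift T t (fscale T w (\<Theta> \<omega>))) \<partial>M) \<partial>\<rho>)"
  proof (rule nn_integral_cong)
    fix w
    have [measurable]: "(\<lambda>\<omega>. fscale T w (shift T t (\<Theta> \<omega>))) \<in> measurable M S"
      by (rule fscale_measurable) (auto intro!: shift_measurable[OF _ t])
    have "(\<lambda>\<omega>. H (fscale T w (shift T t (\<Theta> \<omega>)))) \<in> borel_measurable M" by measurable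
    from nn_integral_cmult[OF this]
    show "(\<integral>\<^sup>+\<omega>. indicator {1<..} w * H (fscale T w (shift T t (\<Theta> \<omega>))) \<partial>M) = indicator {1<..} w * (\<integral>\<^sup>+\<omega>. H (shift T t (fscale T w (\<Theta> \<omega>))) \<partial>M)"
      by (simp add: shift_fscale t)
  qed
  also have "\<dots> = (\<integral>\<^sup>+\<omega>. H (shift T t (Y \<omega>)) \<partial>M)"
    using polar.Y_law[of "\<lambda>f. H (shift T t f)"] measurable_compose[OF polar.shift_S[OF t] H] by simp
  finally show ?thesis .
qed

definition exceedance_size :: "real \<Rightarrow> real \<Rightarrow> (real^'l \<Rightarrow> real^'d) \<Rightarrow> ennreal" where
  "exceedance_size c \<tau> f = (\<integral>\<^sup>+s. indicator (cube c) s * (epowr (kap s f) \<tau> * indicator {1<..} (kap s f)) \<partial>index_measure T)"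

lemma \<zeta>_joint: "(\<lambda>x. kap (fst x) (\<zeta> (snd x))) \<in> borel_measurable (index_measure T \<Otimes>\<^sub>M (\<rho> \<Otimes>\<^sub>M N))"
  using kfield_index_measurable[OF \<zeta>_kfield] by (simp add: split_beta')

lemma exceedance_size_measurable: "(\<lambda>q. exceedance_size c \<tau> (\<zeta> q)) \<in> borel_measurable (\<rho> \<Otimes>\<^sub>M N)"
proof -
  have "(\<lambda>x. kap (snd x) (\<zeta> (fst x))) \<in> borel_measurable ((\<rho> \<Otimes>\<^sub>M N) \<Otimes>\<^sub>M index_measure T)"
    using measurable_compose[OF measurable_pair_swap' \<zeta>_joint] by (simp add: split_beta')
  then have "(\<lambda>x. indicator (cube c) (snd x) * (epowr (kap (snd x) (\<zeta> (fst x))) \<tau> * indicator {1<..} (kap (snd x) (\<zeta> (fst x)))) :: ennreal)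
     \<in> borel_measurable ((\<rho> \<Otimes>\<^sub>M N) \<Otimes>\<^sub>M index_measure T)" by measurable
  from \<mu>.borel_measurable_nn_integral_fst[OF this] show ?thesis by (simp add: exceedance_size_def)
qed

text \<open>
  Replacing \<open>\<Theta>\<close> by \<open>Y\<close> in the powers multiplies the denominator by the \<open>\<tau>\<close>-th power of
  \<open>\<kappa>(Y) = k\<^sub>t(B\<^sup>tY)\<close>.
\<close>

lemma exceedance_denominator:
  assumes t: "t \<in> T"
  shows "AE \<omega> in M. 1 / (\<integral>\<^sup>+s\<in>cube c. epowr (\<kappa> (shift T (t - s) (\<Theta> \<omega>))) \<tau> * indicator {1<..} (\<kappa> (shift T (t - s) (Y \<omega>))) \<partial>index_measure T)
     = epowr (kap t (shift T t (Y \<omega>))) \<tau> / exceedance_size c \<tau> (shift T t (Y \<omega>))"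
  using polar.R_pos polar.Y_eq \<kappa>_\<Theta> AE_space
proof eventually_elim
  case (elim \<omega>)
  let ?r = "R \<omega> powr \<alpha>" and ?\<mu> = "index_measure T"
  have kY: "kap u (Y \<omega>) = ennreal ?r * kap u (\<Theta> \<omega>)" if "u \<in> T" for u
    using elim that by (simp add: kap_fscale)
  have r: "0 < ?r" using elim by simp
  have "kap t (shift T t (Y \<omega>)) = ennreal ?r"
    using t elim kY[OF T_zero] by (simp add: kap_shift kap_zero \<Theta>_in_S)
  then have e: "epowr (kap t (shift T t (Y \<omega>))) \<tau> = ennreal (?r powr \<tau>)" by (simp only: epowr_ennreal[OF r])
  let ?g = "\<lambda>s. epowr (\<kappa> (shift T (t - s) (\<Theta> \<omega>))) \<tau> * indicator {1<..} (\<kappa> (shift T (t - s) (Y \<omega>))) * indicator (cube c) s"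
  have g: "?g s = epowr (kap s (shift T t (\<Theta> \<omega>))) \<tau> * indicator {1<..} (kap s (shift T t (Y \<omega>))) * indicator (cube c) s"
    if "s \<in> T" for s using that t by (simp add: kap_def shift_shift T_uminus)
  have sec: "(\<lambda>s. kap s (shift T t (\<Theta> \<omega>))) \<in> borel_measurable ?\<mu>" "(\<lambda>s. kap s (shift T t (Y \<omega>))) \<in> borel_measurable ?\<mu>"
    using measurable_Pair1[OF kfield_index_measurable[OF kfield_shift[OF \<Theta>_kfield t]] elim(4)]
      measurable_Pair1[OF kfield_index_measurable[OF kfield_shift[OF polar.Y_kfield t]] elim(4)] by simp_all
  have "?g \<in> borel_measurable ?\<mu> \<longleftrightarrow> (\<lambda>s. epowr (kap s (shift T t (\<Theta> \<omega>))) \<tau> * indicator {1<..} (kap s (shift T t (Y \<omega>))) * indicator (cube c) s) \<in> borel_measurable ?\<mu>"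
    by (rule measurable_cong) (simp only: space_index_measure g)
  also have "\<dots>" using sec by measurable
  finally have gm: "?g \<in> borel_measurable ?\<mu>" .
  have "exceedance_size c \<tau> (shift T t (Y \<omega>)) = (\<integral>\<^sup>+s. ennreal (?r powr \<tau>) * ?g s \<partial>?\<mu>)"
    unfolding exceedance_size_def
  proof (rule nn_integral_cong)
    fix s assume "s \<in> space ?\<mu>"
    then have s: "s \<in> T" by simp
    have "epowr (kap s (shift T t (Y \<omega>))) \<tau> = ennreal (?r powr \<tau>) * epowr (kap s (shift T t (\<Theta> \<omega>))) \<tau>"
      using s t kY[OF T_diff[OF s t]] by (simp add: kap_shift epowr_mult[OF r])
    then show "indicator (cube c) s * (epowr (kap s (shift T t (Y \<omega>))) \<tau> * indicator {1<..} (kap s (shift T t (Y \<omega>)))) = ennreal (?r powr \<tau>) * ?g s"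
      unfolding g[OF s] by (simp add: mult_ac)
  qed
  also have "\<dots> = ennreal (?r powr \<tau>) * (\<integral>\<^sup>+s. ?g s \<partial>?\<mu>)" by (rule nn_integral_cmult[OF gm])
  finally have s: "exceedance_size c \<tau> (shift T t (Y \<omega>)) = ennreal (?r powr \<tau>) * (\<integral>\<^sup>+s. ?g s \<partial>?\<mu>)" .
  have nz: "ennreal (?r powr \<tau>) \<noteq> 0" "ennreal (?r powr \<tau>) \<noteq> \<infinity>" using r by auto
  from divide_mult_eq[OF nz, of 1 "\<integral>\<^sup>+s. ?g s \<partial>?\<mu>"]
  show ?case unfolding e s by (simp add: mult.commute)
qed

text \<open>
  The exceedance size is a path integral, so the identity of laws applies to it only through its measurable
  version \<open>G\<close>.
\<close>

lemma exceedance_expectation: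
  assumes t: "t \<in> T"
  shows "(\<integral>\<^sup>+\<omega>. 1 / (\<integral>\<^sup>+s\<in>cube c. epowr (\<kappa> (shift T (t - s) (\<Theta> \<omega>))) \<tau> * indicator {1<..} (\<kappa> (shift T (t - s) (Y \<omega>))) \<partial>index_measure T) \<partial>M)
     = (\<integral>\<^sup>+q. indicator {1<..} (kap t (\<zeta> q)) * (epowr (kap t (\<zeta> q)) \<tau> / exceedance_size c \<tau> (\<zeta> q)) \<partial>(\<rho> \<Otimes>\<^sub>M N))"
proof -
  let ?a = "\<lambda>q. indicator {1<..} (kap t (\<zeta> q)) :: ennreal"
  let ?W = "\<lambda>\<omega>. shift T t (Y \<omega>)"
  note \<zeta>m = kfield_measurable[OF \<zeta>_kfield]
  have a: "?a \<in> borel_measurable (\<rho> \<Otimes>\<^sub>M N)" using kap_measurable[OF \<zeta>m t] by measurable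
  have kW: "kfield M ?W" by (rule kfield_shift[OF polar.Y_kfield t])
  have one: "(\<lambda>_. 1 :: ennreal) \<in> borel_measurable M" by simp
  have law: "(\<integral>\<^sup>+q. ?a q * H (\<zeta> q) \<partial>(\<rho> \<Otimes>\<^sub>M N)) = (\<integral>\<^sup>+\<omega>. 1 * H (?W \<omega>) \<partial>M)"
    if "H \<in> borel_measurable S" for H :: "_ \<Rightarrow> ennreal"
    using exceedance_law[OF t that] by simp
  have d: "distr (density (\<rho> \<Otimes>\<^sub>M N) ?a) S \<zeta> = distr M S ?W"
    using density_distr_eqI[OF a one \<zeta>m kfield_measurable[OF kW] law] by (simp add: density_1)
  have fa: "finite_measure (density (\<rho> \<Otimes>\<^sub>M N) ?a)"
    using law[of "\<lambda>_. 1"] by (intro finite_measure_density[OF a]) (simp add: emeasure_space_1)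
  have \<phi>: "(\<lambda>(s, x). indicator (cube c) s * (epowr x \<tau> * indicator {1<..} x) :: ennreal) \<in> borel_measurable (index_measure T \<Otimes>\<^sub>M borel)"
    by measurable
  from path_integral_determined_by_law[OF fa kfield_density[OF \<zeta>_kfield] finite_measure_axioms kW d \<phi>]
  obtain G where G[measurable]: "G \<in> borel_measurable S"
    and G1: "AE q in density (\<rho> \<Otimes>\<^sub>M N) ?a. exceedance_size c \<tau> (\<zeta> q) = G (\<zeta> q)"
    and G2: "AE \<omega> in M. exceedance_size c \<tau> (?W \<omega>) = G (?W \<omega>)"
    unfolding exceedance_size_def by (elim bexE conjE)
  note [measurable] = kap_measurable_S[OF t]
  have "(\<integral>\<^sup>+\<omega>. 1 / (\<integral>\<^sup>+s\<in>cube c. epowr (\<kappa> (shift T (t - s) (\<Theta> \<omega>))) \<tau> * indicator {1<..} (\<kappa> (shift T (t - s) (Y \<omega>))) \<partial>index_measure T) \<partial>M)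
     = (\<integral>\<^sup>+\<omega>. epowr (kap t (?W \<omega>)) \<tau> / G (?W \<omega>) \<partial>M)"
    by (rule nn_integral_cong_AE, use exceedance_denominator[OF t, of \<tau> c] G2 in eventually_elim) simp
  also have "\<dots> = (\<integral>\<^sup>+q. ?a q * (epowr (kap t (\<zeta> q)) \<tau> / G (\<zeta> q)) \<partial>(\<rho> \<Otimes>\<^sub>M N))"
  proof -
    have "(\<lambda>f. epowr (kap t f) \<tau> / G f) \<in> borel_measurable S" by measurable
    from law[OF this] show ?thesis by simp
  qed
  also have "\<dots> = (\<integral>\<^sup>+q. ?a q * (epowr (kap t (\<zeta> q)) \<tau> / exceedance_size c \<tau> (\<zeta> q)) \<partial>(\<rho> \<Otimes>\<^sub>M N))"
  proof (rule nn_integral_cong_AE, use G1[unfolded AE_density[OF a]] in eventually_elim)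
    fix q assume "0 < ?a q \<longrightarrow> exceedance_size c \<tau> (\<zeta> q) = G (\<zeta> q)"
    then show "?a q * (epowr (kap t (\<zeta> q)) \<tau> / G (\<zeta> q)) = ?a q * (epowr (kap t (\<zeta> q)) \<tau> / exceedance_size c \<tau> (\<zeta> q))"
      by (cases "?a q = 0") (auto simp: zero_less_iff_neq_zero)
  qed
  finally show ?thesis .
qed

text \<open>
  Integrating the numerators \<open>k\<^sub>t(zZ)\<^sup>\<tau>\<close> over the exceedance positions \<open>t\<close> reproduces the denominator.
\<close>

lemma exceedance_integral:
  "(\<integral>\<^sup>+t\<in>cube c. (\<integral>\<^sup>+\<omega>. 1 / (\<integral>\<^sup>+s\<in>cube c. epowr (\<kappa> (shift T (t - s) (\<Theta> \<omega>))) \<tau> * indicator {1<..} (\<kappa> (shift T (t - s) (Y \<omega>)))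
           \<partial>index_measure T) \<partial>M) \<partial>index_measure T)
    = (\<integral>\<^sup>+z. \<integral>\<^sup>+x. exceedance_size c \<tau> (\<zeta> (z, x)) / exceedance_size c \<tau> (\<zeta> (z, x)) \<partial>N \<partial>\<rho>)"
proof -
  let ?P = "\<rho> \<Otimes>\<^sub>M N" and ?\<mu> = "index_measure T"
  let ?I = "\<lambda>q. exceedance_size c \<tau> (\<zeta> q)"
  interpret P: sigma_finite_measure ?P
    by (rule sigma_finite_pair_measure[OF \<rho>.sigma_finite_measure_axioms N.sigma_finite_measure_axioms])
  interpret \<mu>P: pair_sigma_finite ?\<mu> ?P ..
  note [measurable] = \<zeta>_joint exceedance_size_measurable[of c \<tau>]
  let ?f = "\<lambda>t q. indicator (cube c) t * (epowr (kap t (\<zeta> q)) \<tau> * indicator {1<..} (kap t (\<zeta> q))) :: ennreal"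
  have fm[measurable]: "(\<lambda>x. ?f (fst x) (snd x)) \<in> borel_measurable (?\<mu> \<Otimes>\<^sub>M ?P)" by measurable
  have m: "(\<lambda>x. ?f (fst x) (snd x) / ?I (snd x)) \<in> borel_measurable (?\<mu> \<Otimes>\<^sub>M ?P)" by measurable
  have "(\<integral>\<^sup>+t\<in>cube c. (\<integral>\<^sup>+\<omega>. 1 / (\<integral>\<^sup>+s\<in>cube c. epowr (\<kappa> (shift T (t - s) (\<Theta> \<omega>))) \<tau> * indicator {1<..} (\<kappa> (shift T (t - s) (Y \<omega>)))
           \<partial>?\<mu>) \<partial>M) \<partial>?\<mu>) = (\<integral>\<^sup>+t. \<integral>\<^sup>+q. ?f t q / ?I q \<partial>?P \<partial>?\<mu>)"
  proof (rule nn_integral_cong)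
    fix t assume "t \<in> space ?\<mu>"
    then have t: "t \<in> T" by simp
    have "(\<lambda>q. indicator {1<..} (kap t (\<zeta> q)) * (epowr (kap t (\<zeta> q)) \<tau> / ?I q)) \<in> borel_measurable ?P"
      using kap_measurable[OF kfield_measurable[OF \<zeta>_kfield] t] by measurable
    from nn_integral_multc[OF this, of "indicator (cube c) t", symmetric]
    show "(\<integral>\<^sup>+\<omega>. 1 / (\<integral>\<^sup>+s\<in>cube c. epowr (\<kappa> (shift T (t - s) (\<Theta> \<omega>))) \<tau> * indicator {1<..} (\<kappa> (shift T (t - s) (Y \<omega>)))
           \<partial>?\<mu>) \<partial>M) * indicator (cube c) t = (\<integral>\<^sup>+q. ?f t q / ?I q \<partial>?P)"
      unfolding exceedance_expectation[OF t] by (simp add: divide_ennreal_def mult_ac)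
  qed
  also have "\<dots> = (\<integral>\<^sup>+q. \<integral>\<^sup>+t. ?f t q / ?I q \<partial>?\<mu> \<partial>?P)"
    using \<mu>P.Fubini[OF m] by simp
  also have "\<dots> = (\<integral>\<^sup>+q. ?I q / ?I q \<partial>?P)"
  proof (rule nn_integral_cong)
    fix q assume "q \<in> space ?P"
    from measurable_Pair1[OF fm this] have "(\<lambda>t. ?f t q) \<in> borel_measurable ?\<mu>" by simp
    from nn_integral_multc[OF this, of "inverse (?I q)"]
    show "(\<integral>\<^sup>+t. ?f t q / ?I q \<partial>?\<mu>) = ?I q / ?I q"
      by (simp add: divide_ennreal_def exceedance_size_def)
  qed
  also have "\<dots> = (\<integral>\<^sup>+z. \<integral>\<^sup>+x. ?I (z, x) / ?I (z, x) \<partial>N \<partial>\<rho>)"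
    by (rule N.nn_integral_fst[symmetric]) measurable
  finally show ?thesis .
qed

lemma local_sup_integral:
  "(\<integral>\<^sup>+x. local_sup c x \<partial>N) = (\<integral>\<^sup>+z. \<integral>\<^sup>+x. indicator {1<..} (ennreal (z powr \<alpha>) * local_sup c x) \<partial>N \<partial>\<rho>)"
proof -
  note [measurable] = local_sup_measurable[of c]
  have "(\<lambda>y. indicator {1<..} (ennreal (fst y powr \<alpha>) * local_sup c (snd y)) :: ennreal) \<in> borel_measurable (\<rho> \<Otimes>\<^sub>M N)"
    by measurable
  from \<rho>N.Fubini[OF this] show ?thesis by (simp add: pareto_intensity_threshold[OF \<alpha>_pos])
qed

text \<open>
  The quotient \<open>I/I\<close> is at most one, and it vanishes if no value in the cube exceeds the threshold.
\<close>

lemma exceedance_condition_of_finite_sup: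
  assumes fin: "\<And>c. 0 < c \<Longrightarrow> (\<integral>\<^sup>+x. local_sup c x \<partial>N) < \<infinity>"
  shows "exceedance_condition T \<kappa> M \<Theta> Y \<tau>"
  unfolding exceedance_condition_def exceedance_integral
proof (intro allI impI)
  fix c :: real assume c: "0 < c"
  let ?I = "\<lambda>z x. exceedance_size c \<tau> (\<zeta> (z, x))"
  have "(\<integral>\<^sup>+z. \<integral>\<^sup>+x. ?I z x / ?I z x \<partial>N \<partial>\<rho>) \<le> (\<integral>\<^sup>+z. \<integral>\<^sup>+x. indicator {1<..} (ennreal (z powr \<alpha>) * local_sup (c + 1) x) \<partial>N \<partial>\<rho>)"
  proof (rule nn_integral_mono_AE, use AE_pareto_intensity_pos in eventually_elim)
    fix z :: real assume z: "0 < z"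
    show "(\<integral>\<^sup>+x. ?I z x / ?I z x \<partial>N) \<le> (\<integral>\<^sup>+x. indicator {1<..} (ennreal (z powr \<alpha>) * local_sup (c + 1) x) \<partial>N)"
    proof (rule nn_integral_mono_AE, use AE_cube_le_local_sup[of c] in eventually_elim)
      fix x assume le: "\<forall>t\<in>T \<inter> cube c. kap t (Z x) \<le> local_sup (c + 1) x"
      show "?I z x / ?I z x \<le> indicator {1<..} (ennreal (z powr \<alpha>) * local_sup (c + 1) x)"
      proof (cases "1 < ennreal (z powr \<alpha>) * local_sup (c + 1) x")
        case True
        have "i / i \<le> 1" for i :: ennreal
          by (cases "i = 0"; cases "i = \<infinity>") (auto simp: less_top[symmetric])
        then show ?thesis using True by simp
      next
        case False
        have "?I z x = (\<integral>\<^sup>+s. 0 \<partial>index_measure T)"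
          unfolding exceedance_size_def
        proof (rule nn_integral_cong)
          fix s assume "s \<in> space (index_measure T)"
          then have s: "s \<in> T" by simp
          show "indicator (cube c) s * (epowr (kap s (\<zeta> (z, x))) \<tau> * indicator {1<..} (kap s (\<zeta> (z, x)))) = 0"
          proof (cases "s \<in> cube c")
            case True
            have "kap s (\<zeta> (z, x)) \<le> ennreal (z powr \<alpha>) * local_sup (c + 1) x"
              using le True s z by (simp add: kap_\<zeta> mult_left_mono)
            also have "\<dots> \<le> 1" using False by (simp add: not_less)
            finally show ?thesis by (simp add: indicator_def not_less)
          qed simp
        qed
        then show ?thesis by simp
      qed
    qed
  qed
  also have "\<dots> = (\<integral>\<^sup>+x. local_sup (c + 1) x \<partial>N)" by (rule local_sup_integral[symmetric])
  also have "\<dots> < \<infinity>" using c by (intro fin) simp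
  finally show "(\<integral>\<^sup>+z. \<integral>\<^sup>+x. ?I z x / ?I z x \<partial>N \<partial>\<rho>) < \<infinity>" .
qed

end

context homogeneous_functional
begin

lemma cube_index_measure_finite: "(\<integral>\<^sup>+s. indicator (cube c) s \<partial>index_measure T) < \<infinity>"
proof (cases "T = UNIV")
  case True
  have "cube c \<subseteq> cbox (\<chi> i. - c) (\<chi> i. c)"
  proof
    fix x assume "x \<in> cube c"
    then have "- c \<le> x $ i \<and> x $ i \<le> c" for i by (auto simp: cube_def abs_le_iff minus_le_iff)
    then show "x \<in> cbox (\<chi> i. - c) (\<chi> i. c)" by (simp add: mem_box_cart)
  qed
  then have "bounded (cube c :: (real^'l) set)" by (rule bounded_subset[OF bounded_cbox])
  then have "emeasure lborel (cube c :: (real^'l) set) < \<infinity>" by (rule emeasure_bounded_finite)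
  then show ?thesis using True by (simp add: index_measure_def nn_integral_completion)
next
  case False
  then have Z: "\<forall>t\<in>T. \<forall>i. t $ i \<in> \<int>" using index_group by (auto simp: index_group_def)
  let ?A = "of_int ` {- \<lceil>c\<rceil>..\<lceil>c\<rceil>} :: real set"
  have "cube c \<inter> T \<subseteq> (\<lambda>f. \<chi> i. f i) ` (PiE UNIV (\<lambda>_. ?A) :: ('l \<Rightarrow> real) set)"
  proof
    fix t assume t: "t \<in> cube c \<inter> T"
    have "t $ i \<in> ?A" for i
    proof -
      have "t $ i \<in> \<int>" using Z t by blast
      then obtain k where k: "t $ i = of_int k" by (rule Ints_cases)
      have "\<bar>t $ i\<bar> \<le> c" using t by (auto simp: cube_def)
      then have "\<bar>k\<bar> \<le> \<lceil>c\<rceil>" unfolding k by linarith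
      then have "k \<in> {- \<lceil>c\<rceil>..\<lceil>c\<rceil>}" by auto
      then show ?thesis unfolding k by (rule imageI)
    qed
    then have "(\<lambda>i. t $ i) \<in> PiE UNIV (\<lambda>_. ?A)" by (intro PiE_I) auto
    moreover have "t = (\<chi> i. (\<lambda>i. t $ i) i)" by simp
    ultimately show "t \<in> (\<lambda>f. \<chi> i. f i) ` (PiE UNIV (\<lambda>_. ?A))" by blast
  qed
  moreover have "finite (PiE UNIV (\<lambda>_. ?A) :: ('l \<Rightarrow> real) set)"
    by (rule finite_PiE) auto
  ultimately have f: "finite (cube c \<inter> T)" by (meson finite_imageI finite_subset)
  have "(\<integral>\<^sup>+s. indicator (cube c) s \<partial>count_space T) = (\<integral>\<^sup>+s. indicator (cube c \<inter> T) s \<partial>count_space T)"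
    by (rule nn_integral_cong) (auto simp: indicator_def)
  also have "\<dots> = emeasure (count_space T) (cube c \<inter> T)" by (rule nn_integral_indicator) auto
  also have "\<dots> < \<infinity>" using f by (simp add: of_nat_less_top)
  finally show ?thesis using False by (simp add: index_measure_def)
qed

end

context exceedance_field
begin

text \<open>
  Seen from a position \<open>r\<close> with \<open>k\<^sub>r(Z) > 0\<close>, the normalized field has the law of \<open>B\<^sup>r\<Theta>\<close>, whose moments are
  locally bounded; normalization only multiplies the integral by a positive constant.  Almost surely some
  rational \<open>r\<close> serves this purpose.
\<close>

lemma power_integral_AE_finite:
  assumes mom: "locally_bounded_moments T \<kappa> M \<Theta> \<tau>" and c: "0 < c"
  shows "AE x in N. (\<integral>\<^sup>+s. indicator (cube c) s * epowr (kap s (Z x)) \<tau> \<partial>index_measure T) < \<infinity>"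
proof -
  let ?\<mu> = "index_measure T"
  interpret \<mu>N: pair_sigma_finite ?\<mu> N ..
  have Zk: "kfield N Z" by (rule random_fieldD(3)[OF Z_random_field])
  have "AE x in N. \<forall>r\<in>rat_points T. kap r (Z x) * (\<integral>\<^sup>+s. indicator (cube c) s * epowr (kap s (normalize (Z x) (kap r (Z x)))) \<tau> \<partial>?\<mu>) \<noteq> \<infinity>"
  proof (rule AE_ball_countable[THEN iffD2, OF countable_rat_points], intro ballI)
    fix r assume "r \<in> rat_points T"
    then have r: "r \<in> T" by (rule rat_points_subset)
    define W where "W x = normalize (Z x) (kap r (Z x))" for x
    have km[measurable]: "(\<lambda>x. kap r (Z x)) \<in> borel_measurable N" by (rule kap_measurable[OF Z_measurable r])
    have Wk: "kfield N W" unfolding W_def by (rule kfield_fdiv[OF Zk]) measurable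
    have j[measurable]: "(\<lambda>y. kap (fst y) (W (snd y))) \<in> borel_measurable (?\<mu> \<Otimes>\<^sub>M N)"
      using kfield_index_measurable[OF Wk] by (simp add: split_beta')
    have j'[measurable]: "(\<lambda>y. kap (snd y) (W (fst y))) \<in> borel_measurable (N \<Otimes>\<^sub>M ?\<mu>)"
      using measurable_compose[OF measurable_pair_swap' j] by (simp add: split_beta')
    define B where "B = (SUP t\<in>cube (c + norm r) \<inter> T. \<integral>\<^sup>+\<omega>. epowr (\<kappa> (shift T (- t) (\<Theta> \<omega>))) \<tau> \<partial>M)"
    have B: "B < \<infinity>" unfolding B_def
      by (rule mom[unfolded locally_bounded_moments_def, rule_format]) (use c in \<open>simp add: add_pos_nonneg\<close>)
    have bound: "(\<integral>\<^sup>+x. kap r (Z x) * epowr (kap s (W x)) \<tau> \<partial>N) \<le> B" if s: "s \<in> T" "s \<in> cube c" for s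
    proof -
      have "(\<lambda>f. epowr (kap s f) \<tau>) \<in> borel_measurable S" using kap_measurable_S[OF s(1)] by measurable
      from Z_identity[OF r this]
      have "(\<integral>\<^sup>+x. kap r (Z x) * epowr (kap s (W x)) \<tau> \<partial>N) = (\<integral>\<^sup>+\<omega>. epowr (kap (s - r) (\<Theta> \<omega>)) \<tau> \<partial>M)"
        using s r by (simp add: W_def kap_shift)
      also have "\<dots> \<le> B" unfolding B_def kap_def
        by (rule SUP_upper) (use s r cube_diff T_diff in auto)
      finally show ?thesis .
    qed
    have m: "(\<lambda>y. indicator (cube c) (fst y) * (kap r (Z (snd y)) * epowr (kap (fst y) (W (snd y))) \<tau>) :: ennreal) \<in> borel_measurable (?\<mu> \<Otimes>\<^sub>M N)"
      by measurable
    have "(\<integral>\<^sup>+x. kap r (Z x) * (\<integral>\<^sup>+s. indicator (cube c) s * epowr (kap s (W x)) \<tau> \<partial>?\<mu>) \<partial>N)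
       = (\<integral>\<^sup>+x. \<integral>\<^sup>+s. indicator (cube c) s * (kap r (Z x) * epowr (kap s (W x)) \<tau>) \<partial>?\<mu> \<partial>N)"
    proof (rule nn_integral_cong)
      fix x assume "x \<in> space N"
      from measurable_Pair1[OF j this] have "(\<lambda>s. indicator (cube c) s * epowr (kap s (W x)) \<tau> :: ennreal) \<in> borel_measurable ?\<mu>"
        by simp
      from nn_integral_cmult[OF this, of "kap r (Z x)", symmetric]
      show "kap r (Z x) * (\<integral>\<^sup>+s. indicator (cube c) s * epowr (kap s (W x)) \<tau> \<partial>?\<mu>)
        = (\<integral>\<^sup>+s. indicator (cube c) s * (kap r (Z x) * epowr (kap s (W x)) \<tau>) \<partial>?\<mu>)" by (simp add: mult.left_commute)
    qed
    also have "\<dots> = (\<integral>\<^sup>+s. \<integral>\<^sup>+x. indicator (cube c) s * (kap r (Z x) * epowr (kap s (W x)) \<tau>) \<partial>N \<partial>?\<mu>)"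
      using \<mu>N.Fubini[OF m] by simp
    also have "\<dots> \<le> (\<integral>\<^sup>+s. indicator (cube c) s * B \<partial>?\<mu>)"
    proof (rule nn_integral_mono)
      fix s assume "s \<in> space ?\<mu>"
      then have s: "s \<in> T" by simp
      have "(\<integral>\<^sup>+x. indicator (cube c) s * (kap r (Z x) * epowr (kap s (W x)) \<tau>) \<partial>N)
          = indicator (cube c) s * (\<integral>\<^sup>+x. kap r (Z x) * epowr (kap s (W x)) \<tau> \<partial>N)"
      proof (rule nn_integral_cmult)
        show "(\<lambda>x. kap r (Z x) * epowr (kap s (W x)) \<tau>) \<in> borel_measurable N"
          by (rule borel_measurable_times_ennreal[OF km measurable_compose[OF
                kap_measurable[OF kfield_measurable[OF Wk] s] epowr_measurable]])
      qed
      also have "\<dots> \<le> indicator (cube c) s * B"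
        using bound[OF s] by (cases "s \<in> cube c") simp_all
      finally show "(\<integral>\<^sup>+x. indicator (cube c) s * (kap r (Z x) * epowr (kap s (W x)) \<tau>) \<partial>N) \<le> indicator (cube c) s * B" .
    qed
    also have "\<dots> = (\<integral>\<^sup>+s. indicator (cube c) s \<partial>?\<mu>) * B" by (rule nn_integral_multc) simp
    also have "\<dots> < \<infinity>" using B cube_index_measure_finite[of c] by (simp add: ennreal_mult_less_top)
    finally have fin: "(\<integral>\<^sup>+x. kap r (Z x) * (\<integral>\<^sup>+s. indicator (cube c) s * epowr (kap s (W x)) \<tau> \<partial>?\<mu>) \<partial>N) \<noteq> \<infinity>" by simp
    have "(\<lambda>x. \<integral>\<^sup>+s. indicator (cube c) s * epowr (kap s (W x)) \<tau> \<partial>?\<mu>) \<in> borel_measurable N"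
      using \<mu>.borel_measurable_nn_integral_fst[of "\<lambda>y. indicator (cube c) (snd y) * epowr (kap (snd y) (W (fst y))) \<tau>" N] by simp
    then have "(\<lambda>x. kap r (Z x) * (\<integral>\<^sup>+s. indicator (cube c) s * epowr (kap s (W x)) \<tau> \<partial>?\<mu>)) \<in> borel_measurable N"
      by measurable
    from nn_integral_noteq_infinite[OF this fin]
    show "AE x in N. kap r (Z x) * (\<integral>\<^sup>+s. indicator (cube c) s * epowr (kap s (normalize (Z x) (kap r (Z x)))) \<tau> \<partial>?\<mu>) \<noteq> \<infinity>"
      unfolding W_def .
  qed
  moreover note kap_Z_AE_finite
  ultimately show ?thesis using Z_somewhere_pos AE_space
  proof eventually_elim
    case (elim x)
    then obtain r where r: "r \<in> rat_points T" "0 < kap r (Z x)" by blast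
    then have k: "kap r (Z x) < \<infinity>" using elim(2) by (auto simp: less_top)
    obtain c' where c': "0 < c'" "\<And>f. normalize f (kap r (Z x)) = fscale T c' f"
      by (rule normalize_eq_fscale[OF r(2) k]) blast
    have e: "0 < c' powr \<alpha>" using c'(1) by simp
    let ?I = "\<integral>\<^sup>+s. indicator (cube c) s * epowr (kap s (Z x)) \<tau> \<partial>?\<mu>"
    have m: "(\<lambda>s. indicator (cube c) s * epowr (kap s (Z x)) \<tau> :: ennreal) \<in> borel_measurable ?\<mu>"
      using measurable_Pair1[OF kfield_index_measurable[OF Zk] elim(4)] by simp
    have "(\<integral>\<^sup>+s. indicator (cube c) s * epowr (kap s (normalize (Z x) (kap r (Z x)))) \<tau> \<partial>?\<mu>)
       = (\<integral>\<^sup>+s. ennreal ((c' powr \<alpha>) powr \<tau>) * (indicator (cube c) s * epowr (kap s (Z x)) \<tau>) \<partial>?\<mu>)"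
      by (rule nn_integral_cong) (simp add: c'(2) kap_fscale[OF c'(1)] epowr_mult[OF e] mult.left_commute)
    also have "\<dots> = ennreal ((c' powr \<alpha>) powr \<tau>) * ?I" by (rule nn_integral_cmult[OF m])
    finally have "kap r (Z x) * (ennreal ((c' powr \<alpha>) powr \<tau>) * ?I) \<noteq> \<infinity>"
      using bspec[OF elim(1) r(1)] by simp
    then show ?case using r(2) e by (auto simp: ennreal_mult_eq_top_iff less_top)
  qed
qed

text \<open>
  If \<open>k\<^sub>s(zZ) > 1\<close> at a rational point \<open>s\<close> of the cube, then \<open>1 < k\<^sub>u(zZ) < \<infinity>\<close> on a set of positions \<open>u\<close> of
  positive measure, and there the power is positive for every exponent \<open>\<tau>\<close>.
\<close>

lemma exceedance_size_pos:
  assumes z: "0 < z" and c: "0 < c"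
  shows "AE x in N. 1 < ennreal (z powr \<alpha>) * local_sup c x \<longrightarrow> 0 < exceedance_size c \<tau> (\<zeta> (z, x))"
proof -
  let ?e = "ennreal (z powr \<alpha>)" and ?\<mu> = "index_measure T"
  define A where "A = {ennreal (z powr (- \<alpha>))<..<\<infinity>}"
  have A: "k \<in> A \<longleftrightarrow> 1 < ?e * k \<and> k < \<infinity>" for k
  proof (cases k)
    case (real q)
    have "z powr (- \<alpha>) < q \<longleftrightarrow> 1 < z powr \<alpha> * q"
      using z by (simp add: powr_minus_divide divide_less_eq mult.commute)
    then show ?thesis using real by (simp add: A_def ennreal_less_iff ennreal_mult[symmetric] flip: ennreal_1)
  qed (simp add: A_def)
  have oA: "open A" unfolding A_def by simp
  have "AE x in N. \<forall>s\<in>cube c \<inter> rat_points T. kap s (Z x) \<in> A \<longrightarrow>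
      0 < (\<integral>\<^sup>+u. indicator (cube c) u * indicator A (kap u (Z x)) \<partial>?\<mu>)"
  proof (rule AE_ball_countable[THEN iffD2])
    show "countable (cube c \<inter> rat_points T)" by (rule countable_subset[OF _ countable_rat_points]) auto
    show "\<forall>s\<in>cube c \<inter> rat_points T. AE x in N. kap s (Z x) \<in> A \<longrightarrow>
      0 < (\<integral>\<^sup>+u. indicator (cube c) u * indicator A (kap u (Z x)) \<partial>?\<mu>)"
      using occupation_pos[OF Z_random_field oA rat_points_subset _ c] by blast
  qed
  moreover note kap_Z_AE_finite
  ultimately show ?thesis using AE_space
  proof eventually_elim
    case (elim x)
    show ?case
    proof
      assume "1 < ?e * local_sup c x"
      then obtain s where s: "s \<in> cube c \<inter> rat_points T" "1 < ?e * kap s (Z x)"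
        unfolding local_sup_def SUP_mult_left_ennreal less_SUP_iff by blast
      have "kap s (Z x) < \<infinity>" using elim(2) s(1) by (auto simp: less_top)
      with s(2) have "kap s (Z x) \<in> A" by (simp add: A)
      with elim(1) s(1) have pos: "0 < (\<integral>\<^sup>+u. indicator (cube c) u * indicator A (kap u (Z x)) \<partial>?\<mu>)" by blast
      show "0 < exceedance_size c \<tau> (\<zeta> (z, x))"
      proof (rule ccontr)
        assume "\<not> 0 < exceedance_size c \<tau> (\<zeta> (z, x))"
        then have 0: "exceedance_size c \<tau> (\<zeta> (z, x)) = 0" by simp
        have zx: "(z, x) \<in> space (\<rho> \<Otimes>\<^sub>M N)" using elim(3) by (simp add: space_pair_measure)
        have m: "(\<lambda>u. kap u (\<zeta> (z, x))) \<in> borel_measurable ?\<mu>"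
          using measurable_Pair1[OF \<zeta>_joint zx] by simp
        have "(\<lambda>u. indicator (cube c) u * (epowr (kap u (\<zeta> (z, x))) \<tau> * indicator {1<..} (kap u (\<zeta> (z, x)))) :: ennreal) \<in> borel_measurable ?\<mu>"
          using m by measurable
        from nn_integral_0_iff_AE[OF this] 0
        have "AE u in ?\<mu>. indicator (cube c) u * (epowr (kap u (\<zeta> (z, x))) \<tau> * indicator {1<..} (kap u (\<zeta> (z, x)))) = (0 :: ennreal)"
          unfolding exceedance_size_def by (rule iffD1)
        with AE_space have "AE u in ?\<mu>. indicator (cube c) u * indicator A (kap u (Z x)) = (0 :: ennreal)"
        proof eventually_elim
          case e: (elim u)
          show ?case
          proof (cases "u \<in> cube c \<and> kap u (Z x) \<in> A")
            case True
            then have u: "1 < ?e * kap u (Z x)" "kap u (Z x) < \<infinity>" by (auto simp: A)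
            have "?e * kap u (Z x) < \<infinity>" using u(2) by (simp add: ennreal_mult_less_top)
            moreover have "0 < ?e * kap u (Z x)" using u(1) by (rule less_trans[rotated]) simp
            ultimately have "0 < epowr (?e * kap u (Z x)) \<tau>" using epowr_pos_finite by blast
            then show ?thesis using e True u(1) z by (simp add: kap_\<zeta>)
          qed (auto simp: indicator_def)
        qed
        from nn_integral_cong_AE[OF this] pos show False by simp
      qed
    qed
  qed
qed

text \<open>
  The quotient \<open>I/I\<close> equals one almost everywhere on the event that the local supremum exceeds the threshold.
\<close>

lemma finite_sup_of_exceedance:
  assumes exc: "exceedance_condition T \<kappa> M \<Theta> Y \<tau>" and mom: "locally_bounded_moments T \<kappa> M \<Theta> \<tau>" and c: "0 < c"
  shows "(\<integral>\<^sup>+x. local_sup c x \<partial>N) < \<infinity>"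
proof -
  let ?I = "\<lambda>z x. exceedance_size c \<tau> (\<zeta> (z, x))"
  have "(\<integral>\<^sup>+x. local_sup c x \<partial>N) = (\<integral>\<^sup>+z. \<integral>\<^sup>+x. indicator {1<..} (ennreal (z powr \<alpha>) * local_sup c x) \<partial>N \<partial>\<rho>)"
    by (rule local_sup_integral)
  also have "\<dots> \<le> (\<integral>\<^sup>+z. \<integral>\<^sup>+x. ?I z x / ?I z x \<partial>N \<partial>\<rho>)"
  proof (rule nn_integral_mono_AE, use AE_pareto_intensity_pos in eventually_elim)
    fix z :: real assume z: "0 < z"
    have e: "0 < z powr \<alpha>" using z by simp
    show "(\<integral>\<^sup>+x. indicator {1<..} (ennreal (z powr \<alpha>) * local_sup c x) \<partial>N) \<le> (\<integral>\<^sup>+x. ?I z x / ?I z x \<partial>N)"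
    proof (rule nn_integral_mono_AE, use exceedance_size_pos[OF z c, of \<tau>] power_integral_AE_finite[OF mom c] AE_space in eventually_elim)
      fix x assume pos: "1 < ennreal (z powr \<alpha>) * local_sup c x \<longrightarrow> 0 < ?I z x"
        and fin: "(\<integral>\<^sup>+s. indicator (cube c) s * epowr (kap s (Z x)) \<tau> \<partial>index_measure T) < \<infinity>" and x: "x \<in> space N"
      have m: "(\<lambda>s. indicator (cube c) s * epowr (kap s (Z x)) \<tau> :: ennreal) \<in> borel_measurable (index_measure T)"
        using measurable_Pair1[OF kfield_index_measurable[OF random_fieldD(3)[OF Z_random_field]] x] by simp
      have "?I z x \<le> (\<integral>\<^sup>+s. ennreal ((z powr \<alpha>) powr \<tau>) * (indicator (cube c) s * epowr (kap s (Z x)) \<tau>) \<partial>index_measure T)"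
        unfolding exceedance_size_def
      proof (rule nn_integral_mono)
        fix s assume "s \<in> space (index_measure T)"
        then show "indicator (cube c) s * (epowr (kap s (\<zeta> (z, x))) \<tau> * indicator {1<..} (kap s (\<zeta> (z, x))))
           \<le> ennreal ((z powr \<alpha>) powr \<tau>) * (indicator (cube c) s * epowr (kap s (Z x)) \<tau>)"
          using z by (simp add: kap_\<zeta> epowr_mult[OF e] indicator_def)
      qed
      also have "\<dots> = ennreal ((z powr \<alpha>) powr \<tau>) * (\<integral>\<^sup>+s. indicator (cube c) s * epowr (kap s (Z x)) \<tau> \<partial>index_measure T)"
        by (rule nn_integral_cmult[OF m])
      also have "\<dots> < \<infinity>" using fin by (simp add: ennreal_mult_less_top)
      finally have "?I z x < \<infinity>" .
      then show "indicator {1<..} (ennreal (z powr \<alpha>) * local_sup c x) \<le> ?I z x / ?I z x"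
        using pos by (cases "1 < ennreal (z powr \<alpha>) * local_sup c x") (auto simp: zero_less_iff_neq_zero)
    qed
  qed
  also have "\<dots> < \<infinity>"
    using exc[unfolded exceedance_condition_def exceedance_integral, rule_format, OF c] .
  finally show ?thesis .
qed

end

section \<open>Tail fields and spectral tail fields\<close>

context homogeneous_functional
begin

text \<open>
  Numerator and denominator of the quotient in (J) are homogeneous of the same degree.
\<close>

lemma cond_J_fscale:
  assumes M: "prob_space M" and J: "cond_J T \<kappa> M V"
    and eq: "AE \<omega> in M. 0 < c \<omega> \<and> W \<omega> = fscale T (c \<omega>) (V \<omega>)"
  shows "cond_J T \<kappa> M W"
  unfolding cond_J_def
proof (intro ballI impI allI)
  fix p :: "real^'l \<Rightarrow> real" and b :: real
  let ?K = "density (count_space (rat_points T)) (\<lambda>r. ennreal (p r))"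
  let ?f = "\<lambda>V. \<lambda>(n, \<omega>). (SUP s\<in>cube b \<inter> rat_points T. \<kappa> (shift T (n - s) (V \<omega>)))
              / (\<integral>\<^sup>+r. \<kappa> (shift T (n - r) (V \<omega>)) * ennreal (p r) \<partial>count_space (rat_points T))"
  assume p: "p \<in> pos_summable T" and K: "prob_space ?K" and b: "0 < b"
  interpret M: prob_space M by (rule M)
  interpret K: prob_space ?K by (rule K)
  interpret KM: pair_prob_space ?K M ..
  obtain A where A: "A \<in> null_sets M" "{\<omega>\<in>space M. \<not> (0 < c \<omega> \<and> W \<omega> = fscale T (c \<omega>) (V \<omega>))} \<subseteq> A"
    using eq unfolding eventually_ae_filter by blast
  have "emeasure (?K \<Otimes>\<^sub>M M) (space ?K \<times> A) = 0"
    using A(1) by (subst M.emeasure_pair_measure_Times) auto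
  then have null: "space ?K \<times> A \<in> null_sets (?K \<Otimes>\<^sub>M M)" using A(1) by (auto intro!: null_setsI)
  have "AE x in ?K \<Otimes>\<^sub>M M. ?f W x = ?f V x"
  proof (rule AE_I'[OF null], rule subsetI)
    fix x assume "x \<in> {x \<in> space (?K \<Otimes>\<^sub>M M). ?f W x \<noteq> ?f V x}"
    then obtain n \<omega> where x: "x = (n, \<omega>)" "n \<in> space ?K" "\<omega> \<in> space M" and ne: "?f W (n, \<omega>) \<noteq> ?f V (n, \<omega>)"
      by (cases x) (auto simp: space_pair_measure)
    have "\<omega> \<in> A"
    proof (rule ccontr)
      assume "\<omega> \<notin> A"
      then have c: "0 < c \<omega>" "W \<omega> = fscale T (c \<omega>) (V \<omega>)" using A(2) x(3) by auto
      have n: "n \<in> T" using x(2) rat_points_subset by simp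
      let ?e = "ennreal (c \<omega> powr \<alpha>)"
      have k: "\<kappa> (shift T (n - s) (W \<omega>)) = ?e * \<kappa> (shift T (n - s) (V \<omega>))" if "s \<in> rat_points T" for s
        using T_diff[OF n rat_points_subset[OF that]] c by (simp add: shift_fscale \<kappa>_fscale)
      have 1: "(SUP s\<in>cube b \<inter> rat_points T. \<kappa> (shift T (n - s) (W \<omega>))) = ?e * (SUP s\<in>cube b \<inter> rat_points T. \<kappa> (shift T (n - s) (V \<omega>)))"
        unfolding SUP_mult_left_ennreal by (intro SUP_cong refl k) simp
      have 2: "(\<integral>\<^sup>+r. \<kappa> (shift T (n - r) (W \<omega>)) * ennreal (p r) \<partial>count_space (rat_points T))
         = ?e * (\<integral>\<^sup>+r. \<kappa> (shift T (n - r) (V \<omega>)) * ennreal (p r) \<partial>count_space (rat_points T))"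
        by (subst nn_integral_cmult[symmetric], simp, rule nn_integral_cong) (simp add: k mult.assoc)
      have e: "?e \<noteq> 0" "?e \<noteq> \<infinity>" using c(1) by auto
      have "?f W (n, \<omega>) = ?f V (n, \<omega>)"
        unfolding prod.case 1 2 mult.commute[of ?e] by (rule divide_mult_eq[OF e])
      with ne show False by contradiction
    qed
    then show "x \<in> space ?K \<times> A" using x by simp
  qed
  then have "(\<integral>\<^sup>+x. ?f W x \<partial>(?K \<Otimes>\<^sub>M M)) = (\<integral>\<^sup>+x. ?f V x \<partial>(?K \<Otimes>\<^sub>M M))"
    by (rule nn_integral_cong_AE)
  also have "\<dots> < \<infinity>" using J[unfolded cond_J_def, rule_format, OF p K b] .
  finally show "(\<integral>\<^sup>+x. ?f W x \<partial>(?K \<Otimes>\<^sub>M M)) < \<infinity>" .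
qed

lemma summable_density_exists:
  "\<exists>p\<in>pos_summable T. prob_space (density (count_space (rat_points T)) (\<lambda>r. ennreal (p r)))"
proof -
  let ?C = "count_space (rat_points T)"
  interpret C: sigma_finite_measure ?C
    by (rule sigma_finite_measure_count_space_countable[OF countable_rat_points])
  obtain h where h: "integral\<^sup>N ?C h \<noteq> \<infinity>" "\<forall>x\<in>rat_points T. 0 < h x \<and> h x < \<infinity>"
    using C.Ex_finite_integrable_function by auto
  define A where "A = integral\<^sup>N ?C h"
  have "h 0 \<le> A" unfolding A_def by (rule nn_integral_ge_point[OF rat_points_zero])
  then have A0: "A \<noteq> 0" using h(2) rat_points_zero by force
  have A1: "A < \<infinity>" using h(1) by (simp add: A_def less_top)
  define p where "p r = enn2real (h r / A)" for r
  have fin: "h r / A < \<infinity>" if "r \<in> rat_points T" for r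
    using h(2) that A0 by (auto simp: ennreal_divide_eq_top_iff less_top[symmetric])
  then have p: "ennreal (p r) = h r / A" if "r \<in> rat_points T" for r using that by (simp add: p_def)
  have "0 < h r / A" if "r \<in> rat_points T" for r using h(2) that A1 by (simp add: ennreal_zero_less_divide)
  then have pos: "0 < p r" if "r \<in> rat_points T" for r using fin that by (simp add: p_def enn2real_positive_iff)
  have "(\<integral>\<^sup>+r. ennreal (p r) \<partial>?C) = (\<integral>\<^sup>+r. h r / A \<partial>?C)" by (rule nn_integral_cong) (simp add: p)
  also have "\<dots> = A / A" unfolding A_def by (rule nn_integral_divide) simp
  also have "\<dots> = 1" using A0 A1 by (simp add: less_top)
  finally have one: "(\<integral>\<^sup>+r. ennreal (p r) \<partial>?C) = 1" .
  have "prob_space (density ?C (\<lambda>r. ennreal (p r)))"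
  proof (rule prob_spaceI)
    have "(\<integral>\<^sup>+r. ennreal (p r) * indicator (rat_points T) r \<partial>?C) = (\<integral>\<^sup>+r. ennreal (p r) \<partial>?C)"
      by (rule nn_integral_cong) simp
    then show "emeasure (density ?C (\<lambda>r. ennreal (p r))) (space (density ?C (\<lambda>r. ennreal (p r)))) = 1"
      by (simp add: emeasure_density one)
  qed
  moreover have "p \<in> pos_summable T" using pos one by (simp add: pos_summable_def)
  ultimately show ?thesis by blast
qed

text \<open>
  The tail identity without shift, for a test map of the normalized path.
\<close>

lemma tail_field_radial:
  assumes M: "prob_space M" and Y[measurable]: "Y \<in> measurable M S" and big: "AE \<omega> in M. 1 < \<kappa> (Y \<omega>)"
    and tl: "tail_law M Y" and G[measurable]: "G \<in> borel_measurable S" and x: "1 \<le> x"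
  shows "(\<integral>\<^sup>+\<omega>. indicator {ennreal x<..} (epowr (\<kappa> (Y \<omega>)) (1 / \<alpha>)) * G (normalize (Y \<omega>) (\<kappa> (Y \<omega>))) \<partial>M)
      = ennreal (x powr (- \<alpha>)) * (\<integral>\<^sup>+\<omega>. G (normalize (Y \<omega>) (\<kappa> (Y \<omega>))) \<partial>M)"
proof -
  have nm: "(\<lambda>g. normalize g (\<kappa> g)) \<in> measurable S S"
    by (rule normalize_measurable[OF measurable_ident_sets]) auto
  from measurable_compose[OF this G] have H: "(\<lambda>g. G (normalize g (\<kappa> g))) \<in> borel_measurable S" .
  have YS: "\<omega> \<in> space M \<Longrightarrow> Y \<omega> \<in> space S" for \<omega> by (rule measurable_space[OF Y])
  have x0: "0 < x" using x by simp
  let ?\<Theta> = "\<lambda>\<omega>. normalize (Y \<omega>) (\<kappa> (Y \<omega>))"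
  have "(\<integral>\<^sup>+\<omega>. G (?\<Theta> \<omega>) \<partial>M) = (\<integral>\<^sup>+\<omega>. indicator {1<..} (\<kappa> (fscale T x (shift T 0 (Y \<omega>)))) * G (normalize (fscale T x (shift T 0 (Y \<omega>))) (\<kappa> (fscale T x (shift T 0 (Y \<omega>))))) \<partial>M)"
  proof (rule nn_integral_cong_AE, use big AE_space in eventually_elim)
    fix \<omega> assume b: "1 < \<kappa> (Y \<omega>)" and \<omega>: "\<omega> \<in> space M"
    have k: "\<kappa> (fscale T x (shift T 0 (Y \<omega>))) = ennreal (x powr \<alpha>) * \<kappa> (Y \<omega>)"
      using x0 by (simp add: shift_zero YS[OF \<omega>] \<kappa>_fscale)
    have "1 \<le> x powr \<alpha>" using x \<alpha>_pos by (simp add: ge_one_powr_ge_zero)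
    then have "1 * \<kappa> (Y \<omega>) \<le> ennreal (x powr \<alpha>) * \<kappa> (Y \<omega>)" by (intro mult_right_mono) (simp_all flip: ennreal_1)
    with b have "1 < ennreal (x powr \<alpha>) * \<kappa> (Y \<omega>)" by simp
    then show "G (?\<Theta> \<omega>) = indicator {1<..} (\<kappa> (fscale T x (shift T 0 (Y \<omega>)))) * G (normalize (fscale T x (shift T 0 (Y \<omega>))) (\<kappa> (fscale T x (shift T 0 (Y \<omega>)))))"
      unfolding k by (simp add: normalize_fscale[OF x0] shift_zero YS[OF \<omega>])
  qed
  also have "\<dots> = (\<integral>\<^sup>+\<omega>. ennreal (x powr \<alpha>) * indicator {1<..} (\<kappa> (fscale T (1 / x) (shift T (- 0) (Y \<omega>)))) * G (?\<Theta> \<omega>) \<partial>M)"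
    by (rule tl[unfolded tail_law_def, rule_format, OF H T_zero x0])
  also have "\<dots> = (\<integral>\<^sup>+\<omega>. ennreal (x powr \<alpha>) * (indicator {ennreal x<..} (epowr (\<kappa> (Y \<omega>)) (1 / \<alpha>)) * G (?\<Theta> \<omega>)) \<partial>M)"
  proof (rule nn_integral_cong)
    fix \<omega> assume \<omega>: "\<omega> \<in> space M"
    have k: "\<kappa> (fscale T (1 / x) (shift T (- 0) (Y \<omega>))) = ennreal ((1 / x) powr \<alpha>) * \<kappa> (Y \<omega>)"
      using x0 by (simp add: shift_zero YS[OF \<omega>] \<kappa>_fscale)
    have "1 < ennreal ((1 / x) powr \<alpha>) * v \<longleftrightarrow> ennreal x < epowr v (1 / \<alpha>)" for v
    proof -
      consider "v = 0" | q where "0 < q" "v = ennreal q" | "v = \<infinity>"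
        by (cases v) (auto simp: less_le)
      then show ?thesis
      proof cases
        case 1 then show ?thesis using \<alpha>_pos by (simp add: epowr_def)
      next
        case 2
        have "x < q powr (1 / \<alpha>) \<longleftrightarrow> x powr \<alpha> < q"
        proof -
          have q: "q = (q powr (1 / \<alpha>)) powr \<alpha>" using 2 \<alpha>_pos by (simp add: powr_powr)
          show ?thesis
          proof (cases "x < q powr (1 / \<alpha>)")
            case True
            then show ?thesis using \<alpha>_pos x0 q powr_less_mono2[of \<alpha> x "q powr (1 / \<alpha>)"] by simp
          next
            case False
            then show ?thesis using \<alpha>_pos x0 q powr_mono2[of \<alpha> "q powr (1 / \<alpha>)" x] by simp
          qed
        qed
        also have "\<dots> \<longleftrightarrow> 1 < (1 / x) powr \<alpha> * q" using x0 by (simp add: powr_divide field_simps)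
        finally show ?thesis using 2 x0 by (simp add: epowr_ennreal ennreal_less_iff ennreal_mult[symmetric] flip: ennreal_1)
      next
        case 3 then show ?thesis using \<alpha>_pos x0 by (simp add: epowr_def ennreal_mult_top)
      qed
    qed
    then show "ennreal (x powr \<alpha>) * indicator {1<..} (\<kappa> (fscale T (1 / x) (shift T (- 0) (Y \<omega>)))) * G (?\<Theta> \<omega>)
       = ennreal (x powr \<alpha>) * (indicator {ennreal x<..} (epowr (\<kappa> (Y \<omega>)) (1 / \<alpha>)) * G (?\<Theta> \<omega>))"
      unfolding k by (simp add: indicator_def)
  qed
  also have "\<dots> = ennreal (x powr \<alpha>) * (\<integral>\<^sup>+\<omega>. indicator {ennreal x<..} (epowr (\<kappa> (Y \<omega>)) (1 / \<alpha>)) * G (?\<Theta> \<omega>) \<partial>M)"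
  proof (rule nn_integral_cmult)
    have [measurable]: "(\<lambda>\<omega>. G (?\<Theta> \<omega>)) \<in> borel_measurable M" by (rule measurable_compose[OF Y H])
    show "(\<lambda>\<omega>. indicator {ennreal x<..} (epowr (\<kappa> (Y \<omega>)) (1 / \<alpha>)) * G (?\<Theta> \<omega>)) \<in> borel_measurable M" by measurable
  qed
  finally have eq: "(\<integral>\<^sup>+\<omega>. G (?\<Theta> \<omega>) \<partial>M) = ennreal (x powr \<alpha>) * (\<integral>\<^sup>+\<omega>. indicator {ennreal x<..} (epowr (\<kappa> (Y \<omega>)) (1 / \<alpha>)) * G (?\<Theta> \<omega>) \<partial>M)" .
  show ?thesis unfolding eq mult.assoc[symmetric]
    using x0 by (simp add: ennreal_mult[symmetric] powr_add[symmetric])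
qed

lemma tail_field_pareto:
  assumes M: "prob_space M" and Y[measurable]: "Y \<in> measurable M S" and big: "AE \<omega> in M. 1 < \<kappa> (Y \<omega>)"
    and tl: "tail_law M Y"
  shows "pareto \<alpha> M (\<lambda>\<omega>. epowr (\<kappa> (Y \<omega>)) (1 / \<alpha>))"
  unfolding pareto_def
proof (intro conjI allI impI)
  interpret prob_space M by (rule M)
  let ?R = "\<lambda>\<omega>. epowr (\<kappa> (Y \<omega>)) (1 / \<alpha>)"
  show Rm[measurable]: "?R \<in> borel_measurable M" by measurable
  fix t :: real assume t: "1 \<le> t"
  have "emeasure M {\<omega> \<in> space M. ennreal t < ?R \<omega>} = (\<integral>\<^sup>+\<omega>. indicator {\<omega> \<in> space M. ennreal t < ?R \<omega>} \<omega> \<partial>M)"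
    by (rule nn_integral_indicator[symmetric]) measurable
  also have "\<dots> = (\<integral>\<^sup>+\<omega>. indicator {ennreal t<..} (?R \<omega>) * 1 \<partial>M)"
    by (rule nn_integral_cong) (simp add: indicator_def)
  also have "\<dots> = ennreal (t powr (- \<alpha>))"
    using tail_field_radial[OF M Y big tl borel_measurable_const t, of 1] by (simp add: emeasure_space_1)
  finally show "prob {\<omega> \<in> space M. ennreal t < ?R \<omega>} = t powr (- \<alpha>)" by (simp add: measure_def)
qed

text \<open>
  For a fixed set \<open>B\<close> of directions, two finite measures of the radius agree on all rays: below \<open>1\<close> because
  the radius exceeds \<open>1\<close>, above by the radial identity.
\<close>

lemma tail_field_independent:
  assumes M: "prob_space M" and Y[measurable]: "Y \<in> measurable M S" and big: "AE \<omega> in M. 1 < \<kappa> (Y \<omega>)"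
    and tl: "tail_law M Y"
  shows "independent_rv M borel (\<lambda>\<omega>. epowr (\<kappa> (Y \<omega>)) (1 / \<alpha>)) S (\<lambda>\<omega>. normalize (Y \<omega>) (\<kappa> (Y \<omega>)))"
proof -
  interpret prob_space M by (rule M)
  let ?R = "\<lambda>\<omega>. epowr (\<kappa> (Y \<omega>)) (1 / \<alpha>)" and ?\<Theta> = "\<lambda>\<omega>. normalize (Y \<omega>) (\<kappa> (Y \<omega>))"
  have Rm[measurable]: "?R \<in> borel_measurable M" by measurable
  have \<Theta>m[measurable]: "?\<Theta> \<in> measurable M S" by (rule normalize_measurable[OF Y]) measurable
  have R1: "AE \<omega> in M. 1 < ?R \<omega>"
    using pareto_AE[OF \<alpha>_pos M tail_field_pareto[OF assms]] by eventually_elim simp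
  have indep: "prob (?R -` A \<inter> space M \<inter> (?\<Theta> -` B \<inter> space M)) = prob (?R -` A \<inter> space M) * prob (?\<Theta> -` B \<inter> space M)"
    if A: "A \<in> sets borel" and B[measurable]: "B \<in> sets S" for A B
  proof -
    let ?b = "emeasure M (?\<Theta> -` B \<inter> space M)"
    define P1 where "P1 = distr (density M (\<lambda>\<omega>. indicator B (?\<Theta> \<omega>))) borel ?R"
    define P2 where "P2 = density (distr M borel ?R) (\<lambda>_. ?b)"
    have P1: "emeasure P1 A = (\<integral>\<^sup>+\<omega>. indicator A (?R \<omega>) * indicator B (?\<Theta> \<omega>) \<partial>M)" if [measurable]: "A \<in> sets borel" for A
      unfolding P1_def by (simp add: emeasure_distr emeasure_density)
        (auto intro!: nn_integral_cong simp: indicator_def)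
    have P2: "emeasure P2 A = ?b * (\<integral>\<^sup>+\<omega>. indicator A (?R \<omega>) \<partial>M)" if [measurable]: "A \<in> sets borel" for A
    proof -
      have "emeasure P2 A = ?b * (\<integral>\<^sup>+r. indicator A r \<partial>distr M borel ?R)"
        unfolding P2_def by (simp add: emeasure_density nn_integral_cmult)
      also have "(\<integral>\<^sup>+r. indicator A r \<partial>distr M borel ?R) = (\<integral>\<^sup>+\<omega>. indicator A (?R \<omega>) \<partial>M)"
        by (rule nn_integral_distr) measurable
      finally show ?thesis .
    qed
    have prob_eq: "emeasure M X = (\<integral>\<^sup>+\<omega>. f \<omega> \<partial>M)"
      if "X \<in> sets M" "\<And>\<omega>. \<omega> \<in> space M \<Longrightarrow> f \<omega> = indicator X \<omega>" for X and f :: "_ \<Rightarrow> ennreal"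
      using that(2) nn_integral_cong[of M f "indicator X"] nn_integral_indicator[OF that(1)] by simp
    have b: "?b = (\<integral>\<^sup>+\<omega>. indicator B (?\<Theta> \<omega>) \<partial>M)"
      by (rule prob_eq[OF measurable_sets[OF \<Theta>m B]]) (simp add: indicator_def)
    \<comment> \<open>no open ray contains 0, so the rays alone do not exhaust the space\<close>
    let ?E = "insert UNIV (range greaterThan) :: ennreal set set"
    have gen: "emeasure P1 X = emeasure P2 X" if "X \<in> ?E" for X
    proof -
      from that consider "X = UNIV" | u where "X = {u<..}" by auto
      then show ?thesis
      proof cases
        case 1 then show ?thesis by (simp add: P1 P2 b emeasure_space_1)
      next
        case (2 u)
        consider "u < 1" | x where "1 \<le> x" "u = ennreal x" | "u = \<infinity>"
        proof (cases u)
          case (real x)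
          then show thesis using that(1)[] that(2)[of x] by (cases "x < 1") (simp_all add: ennreal_less_iff flip: ennreal_1)
        qed (use that(3) in simp)
        then show ?thesis
        proof cases
          case u: 1
          have ae: "AE \<omega> in M. indicator X (?R \<omega>) = (1 :: ennreal)"
            using R1 by eventually_elim (use 2 u in \<open>auto simp: indicator_def dest: less_trans\<close>)
          have "(\<integral>\<^sup>+\<omega>. indicator X (?R \<omega>) * indicator B (?\<Theta> \<omega>) \<partial>M) = (\<integral>\<^sup>+\<omega>. indicator B (?\<Theta> \<omega>) \<partial>M)"
            by (rule nn_integral_cong_AE, use ae in eventually_elim) simp
          moreover have "(\<integral>\<^sup>+\<omega>. indicator X (?R \<omega>) \<partial>M) = (\<integral>\<^sup>+\<omega>. 1 \<partial>M)"
            by (rule nn_integral_cong_AE, use ae in eventually_elim) simp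
          ultimately show ?thesis using 2 by (simp add: P1 P2 b emeasure_space_1)
        next
          case u: (2 x)
          have "(\<integral>\<^sup>+\<omega>. indicator X (?R \<omega>) * indicator B (?\<Theta> \<omega>) \<partial>M) = ennreal (x powr (- \<alpha>)) * ?b"
            unfolding 2 u b by (rule tail_field_radial[OF M Y big tl _ u(1)]) simp
          moreover have "(\<integral>\<^sup>+\<omega>. indicator X (?R \<omega>) \<partial>M) = ennreal (x powr (- \<alpha>))"
            using tail_field_radial[OF M Y big tl borel_measurable_const u(1), of 1] unfolding 2 u by (simp add: emeasure_space_1)
          ultimately show ?thesis using 2 by (simp add: P1 P2 mult.commute)
        next
          case 3 then show ?thesis using 2 by (simp add: P1 P2)
        qed
      qed
    qed
    have "P1 = P2"
    proof (rule measure_eqI_generator_eq[where E = ?E and \<Omega> = UNIV and A = "\<lambda>_. UNIV", OF _ _ gen])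
      show "Int_stable ?E"
      proof (rule Int_stableI)
        fix a b assume "a \<in> ?E" "b \<in> ?E"
        moreover have "{u<..} \<inter> {v<..} = {max u v<..}" for u v :: ennreal by auto
        ultimately show "a \<inter> b \<in> ?E" by auto
      qed
      have s: "sets (borel :: ennreal measure) = sigma_sets UNIV ?E"
      proof (rule antisym)
        have "sets (borel :: ennreal measure) = sigma_sets UNIV (range greaterThan)"
          by (subst borel_Ioi) simp
        also have "\<dots> \<subseteq> sigma_sets UNIV ?E" by (rule sigma_sets_mono') auto
        finally show "sets (borel :: ennreal measure) \<subseteq> sigma_sets UNIV ?E" .
        have "sigma_sets UNIV ?E \<subseteq> sigma_sets UNIV (sets (borel :: ennreal measure))"
          by (rule sigma_sets_mono') auto
        also have "\<dots> = sets (borel :: ennreal measure)" using sets.sigma_sets_eq[of "borel :: ennreal measure"] by simp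
        finally show "sigma_sets UNIV ?E \<subseteq> sets (borel :: ennreal measure)" .
      qed
      show "sets P1 = sigma_sets UNIV ?E" "sets P2 = sigma_sets UNIV ?E" by (simp_all add: P1_def P2_def s)
      have "?b \<le> 1" by (rule emeasure_le_1)
      then show "emeasure P1 UNIV \<noteq> \<infinity>" for i :: nat by (simp add: P1 b[symmetric])
    qed auto
    then have "(\<integral>\<^sup>+\<omega>. indicator A (?R \<omega>) * indicator B (?\<Theta> \<omega>) \<partial>M) = ?b * (\<integral>\<^sup>+\<omega>. indicator A (?R \<omega>) \<partial>M)"
      using P1[OF A] P2[OF A] by simp
    moreover have "emeasure M (?R -` A \<inter> space M \<inter> (?\<Theta> -` B \<inter> space M)) = (\<integral>\<^sup>+\<omega>. indicator A (?R \<omega>) * indicator B (?\<Theta> \<omega>) \<partial>M)"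
      by (rule prob_eq[OF sets.Int[OF measurable_sets[OF Rm A] measurable_sets[OF \<Theta>m B]]]) (simp add: indicator_def)
    moreover have "emeasure M (?R -` A \<inter> space M) = (\<integral>\<^sup>+\<omega>. indicator A (?R \<omega>) \<partial>M)"
      by (rule prob_eq[OF measurable_sets[OF Rm A]]) (simp add: indicator_def)
    ultimately have "emeasure M (?R -` A \<inter> space M \<inter> (?\<Theta> -` B \<inter> space M)) = ?b * emeasure M (?R -` A \<inter> space M)" by simp
    then show ?thesis by (simp add: emeasure_eq_measure ennreal_mult[symmetric] mult.commute)
  qed
  show ?thesis
    unfolding independent_rv_def indep_sets2_eq
    using indep measurable_sets[OF Rm] measurable_sets[OF \<Theta>m] Rm \<Theta>m by auto
qed

end

lemma (in homogeneous_functional) polar_fieldI: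
  fixes \<Theta> :: "'m \<Rightarrow> real^'l \<Rightarrow> real^'d" and R :: "'m \<Rightarrow> ennreal"
  assumes M: "prob_space M" and \<Theta>: "kfield M \<Theta>" "AE \<omega> in M. \<kappa> (\<Theta> \<omega>) = 1" and Y: "kfield M Y"
    and R: "pareto \<alpha> M R" and ind: "independent_rv M borel R S \<Theta>"
    and eq: "AE \<omega> in M. Y \<omega> = fscale T (enn2real (R \<omega>)) (\<Theta> \<omega>)"
  shows "polar_field T \<kappa> \<alpha> M \<Theta> Y (\<lambda>\<omega>. enn2real (R \<omega>))"
proof -
  interpret prob_space M by (rule M)
  show ?thesis
  proof (unfold_locales)
    show "kfield M \<Theta>" "AE \<omega> in M. \<kappa> (\<Theta> \<omega>) = 1" "kfield M Y"
      "AE \<omega> in M. Y \<omega> = fscale T (enn2real (R \<omega>)) (\<Theta> \<omega>)" by fact+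
    show "AE \<omega> in M. 0 < enn2real (R \<omega>)"
      using pareto_AE_enn2real[OF \<alpha>_pos M R] by eventually_elim simp
    fix H :: "(real^'l \<Rightarrow> real^'d) \<Rightarrow> ennreal" assume H: "H \<in> borel_measurable S"
    have "(\<lambda>x. fscale T (fst x) (snd x)) \<in> measurable (borel \<Otimes>\<^sub>M S) S"
      by (rule fscale_measurable) auto
    from measurable_compose[OF this H]
    have m: "(\<lambda>(z, f). H (fscale T z f)) \<in> borel_measurable (borel \<Otimes>\<^sub>M S)" by (simp add: split_beta')
    have "(\<integral>\<^sup>+\<omega>. H (Y \<omega>) \<partial>M) = (\<integral>\<^sup>+\<omega>. H (fscale T (enn2real (R \<omega>)) (\<Theta> \<omega>)) \<partial>M)"
      by (rule nn_integral_cong_AE, use eq in eventually_elim) simp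
    also have "\<dots> = (\<integral>\<^sup>+z. indicator {1<..} z * (\<integral>\<^sup>+\<omega>. H (fscale T z (\<Theta> \<omega>)) \<partial>M) \<partial>pareto_intensity \<alpha>)"
      by (rule pareto_independent_integral[OF \<alpha>_pos M R ind m])
    finally show "(\<integral>\<^sup>+\<omega>. H (Y \<omega>) \<partial>M) = (\<integral>\<^sup>+z. indicator {1<..} z * (\<integral>\<^sup>+\<omega>. H (fscale T z (\<Theta> \<omega>)) \<partial>M) \<partial>pareto_intensity \<alpha>)" .
  qed
qed

context homogeneous_functional
begin

lemma tail_field_decomposition:
  fixes Y :: "'m \<Rightarrow> real^'l \<Rightarrow> real^'d"
  assumes Y: "tail_field T \<kappa> \<alpha> M Y"
    and R_def: "R = (\<lambda>\<omega>. epowr (\<kappa> (Y \<omega>)) (1 / \<alpha>))" and \<Theta>_def: "\<Theta> = (\<lambda>\<omega>. fdiv T (Y \<omega>) (R \<omega>))"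
  shows "pareto \<alpha> M R" and "independent_rv M borel R S \<Theta>" and "spectral_tail_field T \<kappa> M \<Theta>"
    and "tail_spectral_identity T \<kappa> \<alpha> M \<Theta> Y"
    and "\<exists>(N :: ('m \<times> (real^'l)) measure) Z. generates_class T \<kappa> N Z \<and> shift_invariant_class T \<kappa> \<alpha> N Z \<and>
             local_field_law T \<kappa> \<alpha> N Z = distr M S \<Theta> \<and> exceedance_condition T \<kappa> M \<Theta> Y \<tau>"
proof -
  have Yf: "random_field T \<kappa> M Y" and big: "AE \<omega> in M. 1 < \<kappa> (Y \<omega>)" and J: "cond_J T \<kappa> M Y"
    using Y by (auto simp: tail_field_def)
  note Y' = random_fieldD[OF Yf]
  note M = Y'(1)
  interpret prob_space M by (rule M)
  have tl: "tail_law M Y"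
    by (rule tail_law_of_eq_expect[OF Y'(6)]) (use Y in \<open>simp add: tail_field_def\<close>)
  show par: "pareto \<alpha> M R" unfolding R_def by (rule tail_field_pareto[OF M Y'(6) big tl])
  show ind: "independent_rv M borel R S \<Theta>"
    unfolding R_def \<Theta>_def by (rule tail_field_independent[OF M Y'(6) big tl])
  note R_ae = pareto_AE[OF \<alpha>_pos M par]
  have Rm[measurable]: "R \<in> borel_measurable M" using par by (simp add: pareto_def)
  let ?r = "\<lambda>\<omega>. enn2real (R \<omega>)"
  have r_pos: "AE \<omega> in M. 0 < ?r \<omega>"
    using pareto_AE_enn2real[OF \<alpha>_pos M par] by eventually_elim simp
  have \<Theta>_eq: "\<Theta> = (\<lambda>\<omega>. fscale T (1 / ?r \<omega>) (Y \<omega>))" by (simp add: \<Theta>_def fdiv_def)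
  have \<Theta>f: "random_field T \<kappa> M \<Theta>"
    unfolding \<Theta>_eq by (rule random_field_fscale[OF Yf]) (use r_pos in auto)
  have \<Theta>1: "AE \<omega> in M. \<kappa> (\<Theta> \<omega>) = 1"
    using big R_ae AE_space
  proof eventually_elim
    case (elim \<omega>)
    have k: "0 < \<kappa> (Y \<omega>)" using elim(1) by (auto intro: less_trans[of 0 1])
    have "\<kappa> (Y \<omega>) < \<infinity>"
    proof (rule ccontr)
      assume "\<not> \<kappa> (Y \<omega>) < \<infinity>"
      then have "\<kappa> (Y \<omega>) = \<infinity>" by (simp add: less_top[symmetric])
      then have "R \<omega> = \<infinity>" using \<alpha>_pos by (simp add: R_def epowr_def)
      then show False using elim(2) by simp
    qed
    from normalize_eq_fscale[OF k this] obtain c where c: "0 < c" "ennreal (c powr \<alpha>) * \<kappa> (Y \<omega>) = 1"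
      "\<And>f. normalize f (\<kappa> (Y \<omega>)) = fscale T c f" by metis
    have "\<Theta> \<omega> = fscale T c (Y \<omega>)" unfolding \<Theta>_def R_def c(3) ..
    then show ?case using c measurable_space[OF Y'(6) elim(3)] by (simp add: \<kappa>_fscale)
  qed
  have Y_eq: "AE \<omega> in M. Y \<omega> = fscale T (?r \<omega>) (\<Theta> \<omega>)"
    using r_pos AE_space
  proof eventually_elim
    case (elim \<omega>)
    then show ?case using measurable_space[OF Y'(6) elim(2)] by (simp add: \<Theta>_eq fscale_fscale fscale_one)
  qed
  note \<Theta>k = random_fieldD(3)[OF \<Theta>f]
  note pf = polar_fieldI[OF M \<Theta>k \<Theta>1 Y'(3) par ind Y_eq]
  interpret P: polar_field T \<kappa> \<alpha> M \<Theta> Y ?r by (rule pf)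
  have sp: P.spectral_law by (rule P.spectral_law_of_tail_law[OF tl])
  have sl: "shift_law M \<Theta>" by (rule P.shift_law_of_spectral_law[OF sp])
  show "tail_spectral_identity T \<kappa> \<alpha> M \<Theta> Y" by (rule P.tail_spectral_identity_of_spectral_law[OF sp])
  have J\<Theta>: "cond_J T \<kappa> M \<Theta>"
    by (rule cond_J_fscale[OF M J, of "\<lambda>\<omega>. 1 / ?r \<omega>"]) (use r_pos in \<open>eventually_elim, simp add: \<Theta>_eq\<close>)
  show "spectral_tail_field T \<kappa> M \<Theta>"
    unfolding spectral_tail_field_def
    using \<Theta>f \<Theta>1 J\<Theta> spectral_eq_expect[OF M \<Theta>k sl] by blast
  obtain p where p: "p \<in> pos_summable T" "prob_space (density (count_space (rat_points T)) (\<lambda>r. ennreal (p r)))"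
    using summable_density_exists by blast
  have mf: "mixed_field T \<kappa> \<alpha> M \<Theta> p"
    by (intro mixed_field.intro mixed_field_axioms.intro homogeneous_functional_axioms M \<Theta>f \<Theta>1 sl p)
  interpret E: exceedance_field T \<kappa> \<alpha> M \<Theta> p Y ?r
    by (intro exceedance_field.intro mf pf)
  have fin: "(\<integral>\<^sup>+x. E.local_sup c x \<partial>E.N) < \<infinity>" if "0 < c" for c
    using J\<Theta>[unfolded cond_J_def, rule_format, OF p that] unfolding E.J_integral .
  show "\<exists>(N :: ('m \<times> (real^'l)) measure) Z. generates_class T \<kappa> N Z \<and> shift_invariant_class T \<kappa> \<alpha> N Z \<and>
             local_field_law T \<kappa> \<alpha> N Z = distr M S \<Theta> \<and> exceedance_condition T \<kappa> M \<Theta> Y \<tau>"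
    by (intro exI[of _ E.N] exI[of _ E.Z] conjI E.Z_generates_class[OF fin] E.Z_shift_invariant_class[OF fin]
          E.Z_local_field_law E.exceedance_condition_of_finite_sup[OF fin])
qed

text \<open>
  For every density \<open>p\<close>, the exceedance condition bounds the local suprema of the field mixed with \<open>p\<close>,
  which is condition (J) for \<open>\<Theta>\<close> and thus for \<open>Y\<close>.
\<close>

lemma tail_field_of_polar_decomposition:
  fixes \<Theta> :: "'m \<Rightarrow> real^'l \<Rightarrow> real^'d" and R :: "'m \<Rightarrow> ennreal"
  assumes \<Theta>f: "random_field T \<kappa> M \<Theta>" and \<Theta>1: "AE \<omega> in M. \<kappa> (\<Theta> \<omega>) = 1"
    and par: "pareto \<alpha> M R" and ind: "independent_rv M borel R S \<Theta>"
    and Y_def: "Y = (\<lambda>\<omega>. fscale T (enn2real (R \<omega>)) (\<Theta> \<omega>))"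
    and tsi: "tail_spectral_identity T \<kappa> \<alpha> M \<Theta> Y"
    and mom: "locally_bounded_moments T \<kappa> M \<Theta> \<tau>" and exc: "exceedance_condition T \<kappa> M \<Theta> Y \<tau>"
  shows "tail_field T \<kappa> \<alpha> M Y"
proof -
  note \<Theta>' = random_fieldD[OF \<Theta>f]
  note M = \<Theta>'(1)
  interpret prob_space M by (rule M)
  have Rm[measurable]: "R \<in> borel_measurable M" using par by (simp add: pareto_def)
  let ?r = "\<lambda>\<omega>. enn2real (R \<omega>)"
  have r_big: "AE \<omega> in M. 1 < ?r \<omega>"
    by (rule pareto_AE_enn2real[OF \<alpha>_pos M par])
  then have r_pos: "AE \<omega> in M. 0 < ?r \<omega>" by eventually_elim simp
  have Yf: "random_field T \<kappa> M Y"
    unfolding Y_def by (rule random_field_fscale[OF \<Theta>f]) (use r_pos in auto)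
  have Y_eq: "AE \<omega> in M. Y \<omega> = fscale T (?r \<omega>) (\<Theta> \<omega>)" by (simp add: Y_def)
  note pf = polar_fieldI[OF M \<Theta>'(3) \<Theta>1 random_fieldD(3)[OF Yf] par ind Y_eq]
  interpret P: polar_field T \<kappa> \<alpha> M \<Theta> Y ?r by (rule pf)
  have sp: P.spectral_law by (rule P.spectral_law_of_tail_spectral_identity[OF tsi])
  have tl: "tail_law M Y" by (rule P.tail_law_of_spectral_law[OF sp])
  have sl: "shift_law M \<Theta>" by (rule P.shift_law_of_spectral_law[OF sp])
  have big: "AE \<omega> in M. 1 < \<kappa> (Y \<omega>)"
    using r_big \<Theta>1 AE_space
  proof eventually_elim
    case (elim \<omega>)
    have "1 < ?r \<omega> powr \<alpha>" using elim(1) one_less_powr_iff[OF \<alpha>_pos, of "?r \<omega>"] by simp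
    moreover have "\<kappa> (Y \<omega>) = ennreal (?r \<omega> powr \<alpha>)"
      using elim measurable_space[OF \<Theta>'(6) elim(3)] by (simp add: Y_def \<kappa>_fscale)
    ultimately show ?case by (simp add: ennreal_less_iff flip: ennreal_1)
  qed
  have J: "cond_J T \<kappa> M \<Theta>"
    unfolding cond_J_def
  proof (intro ballI impI allI)
    fix p :: "real^'l \<Rightarrow> real" and c :: real
    assume p: "p \<in> pos_summable T" "prob_space (density (count_space (rat_points T)) (\<lambda>r. ennreal (p r)))" and c: "0 < c"
    have mf: "mixed_field T \<kappa> \<alpha> M \<Theta> p"
      by (intro mixed_field.intro mixed_field_axioms.intro homogeneous_functional_axioms M \<Theta>f \<Theta>1 sl p)
    interpret E: exceedance_field T \<kappa> \<alpha> M \<Theta> p Y ?r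
      by (intro exceedance_field.intro mf pf)
    show "(\<integral>\<^sup>+(n, \<omega>). (SUP s\<in>cube c \<inter> rat_points T. \<kappa> (shift T (n - s) (\<Theta> \<omega>)))
              / (\<integral>\<^sup>+r. \<kappa> (shift T (n - r) (\<Theta> \<omega>)) * ennreal (p r) \<partial>count_space (rat_points T))
            \<partial>(density (count_space (rat_points T)) (\<lambda>r. ennreal (p r)) \<Otimes>\<^sub>M M)) < \<infinity>"
      unfolding E.J_integral by (rule E.finite_sup_of_exceedance[OF exc mom c])
  qed
  have JY: "cond_J T \<kappa> M Y"
    by (rule cond_J_fscale[OF M J, of ?r]) (use r_pos in \<open>eventually_elim, simp add: Y_def\<close>)
  show ?thesis
    unfolding tail_field_def using Yf big JY eq_expect_of_tail_law[OF tl] by blast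
qed

end

theorem theorem5p9:
  fixes T :: "(real^'l::finite) set"
    and \<kappa> :: "(real^'l \<Rightarrow> real^'d::finite) \<Rightarrow> ennreal"
    and \<alpha> :: real
  assumes "index_group T" and "0 < \<alpha>" and "(\<lambda>f. enn2ereal (\<kappa> f)) \<in> hom_maps T \<alpha>"
  shows
   "(\<forall>(M :: 'a measure) Y R \<Theta>.
       tail_field T \<kappa> \<alpha> M Y \<and>
       R = (\<lambda>\<omega>. epowr (\<kappa> (Y \<omega>)) (1 / \<alpha>)) \<and> \<Theta> = (\<lambda>\<omega>. fdiv T (Y \<omega>) (R \<omega>)) \<longrightarrow>
       pareto \<alpha> M R \<and>
       independent_rv M borel R (path_space T) \<Theta> \<and>
       spectral_tail_field T \<kappa> M \<Theta> \<and>
       tail_spectral_identity T \<kappa> \<alpha> M \<Theta> Y \<and>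
       (\<forall>\<tau>. locally_bounded_moments T \<kappa> M \<Theta> \<tau> \<longrightarrow>
          (\<exists>(N :: ('a \<times> (real^'l)) measure) Z.
             generates_class T \<kappa> N Z \<and> shift_invariant_class T \<kappa> \<alpha> N Z \<and>
             local_field_law T \<kappa> \<alpha> N Z = distr M (path_space T) \<Theta> \<and>
             exceedance_condition T \<kappa> M \<Theta> Y \<tau>)))
    \<and>
    (\<forall>(M :: 'b measure) \<Theta> R \<tau>.
       random_field T \<kappa> M \<Theta> \<and> (AE \<omega> in M. \<kappa> (\<Theta> \<omega>) = 1) \<and>
       pareto \<alpha> M R \<and> independent_rv M borel R (path_space T) \<Theta> \<and>
       tail_spectral_identity T \<kappa> \<alpha> M \<Theta> (\<lambda>\<omega>. fscale T (enn2real (R \<omega>)) (\<Theta> \<omega>)) \<and>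
       locally_bounded_moments T \<kappa> M \<Theta> \<tau> \<and>
       exceedance_condition T \<kappa> M \<Theta> (\<lambda>\<omega>. fscale T (enn2real (R \<omega>)) (\<Theta> \<omega>)) \<tau> \<longrightarrow>
       tail_field T \<kappa> \<alpha> M (\<lambda>\<omega>. fscale T (enn2real (R \<omega>)) (\<Theta> \<omega>)))"
proof -
  interpret homogeneous_functional T \<kappa> \<alpha>
    by (rule homogeneous_functional.intro[OF assms])
  show ?thesis
  proof (intro conjI allI impI; elim conjE)
    fix M :: "'a measure" and Y :: "'a \<Rightarrow> real^'l \<Rightarrow> real^'d" and R \<Theta>
    assume a: "tail_field T \<kappa> \<alpha> M Y" "R = (\<lambda>\<omega>. epowr (\<kappa> (Y \<omega>)) (1 / \<alpha>))" "\<Theta> = (\<lambda>\<omega>. fdiv T (Y \<omega>) (R \<omega>))"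
    note d = tail_field_decomposition[OF a]
    show "pareto \<alpha> M R" "independent_rv M borel R (path_space T) \<Theta>" "spectral_tail_field T \<kappa> M \<Theta>"
      "tail_spectral_identity T \<kappa> \<alpha> M \<Theta> Y" by (rule d)+
    show "\<exists>(N :: ('a \<times> (real^'l)) measure) Z. generates_class T \<kappa> N Z \<and> shift_invariant_class T \<kappa> \<alpha> N Z \<and>
             local_field_law T \<kappa> \<alpha> N Z = distr M (path_space T) \<Theta> \<and> exceedance_condition T \<kappa> M \<Theta> Y \<tau>" for \<tau>
      by (rule d(5))
  next
    fix M :: "'b measure" and \<Theta> :: "'b \<Rightarrow> real^'l \<Rightarrow> real^'d" and R \<tau>
    assume "random_field T \<kappa> M \<Theta>" "AE \<omega> in M. \<kappa> (\<Theta> \<omega>) = 1" "pareto \<alpha> M R" "independent_rv M borel R (path_space T) \<Theta>"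
      "tail_spectral_identity T \<kappa> \<alpha> M \<Theta> (\<lambda>\<omega>. fscale T (enn2real (R \<omega>)) (\<Theta> \<omega>))"
      "locally_bounded_moments T \<kappa> M \<Theta> \<tau>"
      "exceedance_condition T \<kappa> M \<Theta> (\<lambda>\<omega>. fscale T (enn2real (R \<omega>)) (\<Theta> \<omega>)) \<tau>"
    then show "tail_field T \<kappa> \<alpha> M (\<lambda>\<omega>. fscale T (enn2real (R \<omega>)) (\<Theta> \<omega>))"
      by (intro tail_field_of_polar_decomposition[OF _ _ _ _ refl])
  qed
qed

end
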